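(* Let $\{\mathcal{A},\mathcal{G},\mathcal{G}',\chi\}$ be a Long-Moody system and $F$ an object of $\mathbf{Fct}(\mathcal{G},R\text{-}\mathfrak{Mod})$ (respectively, let $\{\mathcal{A},\mathcal{G},\mathcal{G}',\chi\}$ be a coherent Long-Moody system and $F$ an object of $\mathbf{Fct}(\mathfrak{U}\mathcal{G},R\text{-}\mathfrak{Mod})$). If for every natural number $n$ the $R[\mathcal{A}(\underline{n})]$-module $F(\underline{n+1})$ (with structure given by $F\circ\chi_n$) is trivial, then there is a natural isomorphism $$\mathbf{LM}(F)\cong H_1(\mathcal{A};R)\otimes_R F(1\natural-)$$ of functors on $\mathcal{G}$ (respectively on $\mathfrak{U}\mathcal{G}$).
   Context: $R$ is a fixed non-trivial commutative ring; $\mathfrak{Gr}$ is the category of groups; $\mathbf{Fct}(\mathfrak{C},\mathfrak{D})$ is the category of functors. For a group $G$, $\mathcal{I}_{R[G]}$ is the augmentation ideal (a right $R[G]$-module), functorial in $G$ via $\mathcal{I}_{R[-]}$. $H_1(\mathcal{A};R)$ denotes the composite $H_1(-;R)\circ\mathcal{A}$, where $H_1(-;R):\mathfrak{Gr}\to R\text{-}\mathfrak{Mod}$ is first group homology; $\otimes_R$ of functors is pointwise. Quillen's bracket construction. For a strict monoidal groupoid $(\mathcal{G}',\natural,0)$, $\mathfrak{U}\mathcal{G}'$ has the same objects; a morphism $A\to B$ is a class $[X,f]$ of pairs with $f:X\natural A\to B$ in $\mathcal{G}'$, where $(X,f)\sim(X',f')$ iff there is an isomorphism $\psi:X\to X'$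 with $f'\circ(\psi\natural id_A)=f$; $[Y,g]\circ[X,f]=[Y\natural X,g\circ(id_Y\natural f)]$; identities $[0,id]$. A morphism $\varphi$ of $\mathcal{G}'$ is identified with $[0,\varphi]$. If $\mathcal{G}'$ has a braiding $b$, $\mathfrak{U}\mathcal{G}'$ is strict monoidal with $[X,f]\natural[Y,g]=[X\natural Y,(f\natural g)\circ(id_X\natural b_{A,Y}^{-1}\natural id_C)]$ for $[X,f]:A\to B$, $[Y,g]:C\to D$. Setting. $(\mathcal{G}',\natural,0,b)$ is a locally small strict braided monoidal groupoid with no zero divisors ($A\natural B\cong0$ iff $A\cong B\cong 0$) and $\mathrm{Aut}(0)=\{id_0\}$; $\underline{0},1$ are fixed objects with $1\not\cong 0$; $\underline{n}=1^{\natural n}\natural\underline{0}$. $\mathcal{G}$ is the full subgroupoid of $\mathcal{G}'$ on $\{\underline{n}\}_{n\in\mathbb{N}}$, $G_n=\mathrm{Aut}(\underline{n})$, and $\mathfrak{U}\mathcal{G}$ is the full subcategory of $\mathfrak{U}\mathcal{G}'$ on $\{\underline{n}\}_{n\in\mathbb{N}}$. $1\natural-$ is the endofunctor $\underline{n}\mapsto\underline{n+1}$, $\varphi\mapsto id_1\natural\varphi$. $\mathcal{A}:\mathfrak{U}\mathcal{G}\to\mathfrak{Gr}$ is a functor. Long-Moody systems. The Grothendieck construction $\int^{\mathfrak{U}\mathcal{G}}\mathcal{A}$ has objects $\underline{n}$, morphisms $\underline{n}\to\underline{n'}$ the pairs $(h,\varphi)$ with $\varphi\in\mathrm{Hom}_{\mathfrak{U}\mathcal{G}}(\underline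 n,\underline n')$, $h\in\mathcal{A}(\underline{n'})$, and composition $(h',\varphi')\circ(h,\varphi)=(h'\mathcal{A}(\varphi')(h),\varphi'\varphi)$; $\mathfrak{s}_{\mathcal{A}}(\varphi)=(e,\varphi)$; similarly over $\mathcal{G}$. $\{\mathcal{A},\mathcal{G},\mathcal{G}',\chi\}$ is a Long-Moody system if $\chi:\int^{\mathcal{G}}\mathcal{A}\to\mathcal{G}$ is a functor with $\chi\circ\mathfrak{s}_{\mathcal{A}}=1\natural-$; it is coherent if moreover $\chi$ extends to a functor $\chi:\int^{\mathfrak{U}\mathcal{G}}\mathcal{A}\to\mathfrak{U}\mathcal{G}$ with $\chi\circ\mathfrak{s}_{\mathcal{A}}=1\natural-$. Put $\chi_n(h)=\chi(h,id_{\underline{n}})$, $\chi_n:\mathcal{A}(\underline{n})\to G_{n+1}$. The Long-Moody functor $\mathbf{LM}$ is the endofunctor of $\mathbf{Fct}(\mathcal{G},R\text{-}\mathfrak{Mod})$ (of $\mathbf{Fct}(\mathfrak{U}\mathcal{G},R\text{-}\mathfrak{Mod})$ in the coherent case) with $\mathbf{LM}(F)(\underline{n})=\mathcal{I}_{R[\mathcal{A}(\underline{n})]}\otimes_{R[\mathcal{A}(\underline{n})]}F(\underline{n+1})$ ($F(\underline{n+1})$ a left module via $F\circ\chi_n$), $\mathbf{LM}(F)(\varphi)(i\otimes v)=\mathcal{I}_{R[-]}(\mathcal{A}(\varphi))(i)\otimes F(id_1\natural\varphi)(v)$, and $\mathbf{LM}(\eta)_{\underline{n}}=id\otimes\eta_{\underline{n+1}}$.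 *)

theory Defs
  imports "HOL-Algebra.Module" "HOL-Algebra.AbelCoset"
begin

section \<open>Categories and functors\<close>

record ('o, 'a) cat =
  obj :: "'o set"
  arr :: "'a set"
  src :: "'a \<Rightarrow> 'o"
  tgt :: "'a \<Rightarrow> 'o"
  ident :: "'o \<Rightarrow> 'a"
  cmp :: "'a \<Rightarrow> 'a \<Rightarrow> 'a"  (infixr \<open>\<bullet>\<index>\<close> 70)

definition hom_set :: "('o, 'a, 'z) cat_scheme \<Rightarrow> 'o \<Rightarrow> 'o \<Rightarrow> 'a set" where
  "hom_set C A B = {f \<in> arr C. src C f = A \<and> tgt C f = B}"

text \<open>Composition is in the usual order: \<open>g \<bullet> f\<close> is "first \<open>f\<close>, then \<open>g\<close>".\<close>

locale category =
  fixes C :: "('o, 'a, 'z) cat_scheme" (structure)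
  assumes src_obj: "f \<in> arr C \<Longrightarrow> src C f \<in> obj C"
    and tgt_obj: "f \<in> arr C \<Longrightarrow> tgt C f \<in> obj C"
    and ident_hom: "A \<in> obj C \<Longrightarrow> ident C A \<in> hom_set C A A"
    and cmp_hom: "\<lbrakk>f \<in> hom_set C A B; g \<in> hom_set C B D\<rbrakk> \<Longrightarrow> g \<bullet> f \<in> hom_set C A D"
    and cmp_assoc: "\<lbrakk>f \<in> hom_set C A B; g \<in> hom_set C B D; h \<in> hom_set C D E\<rbrakk>
          \<Longrightarrow> h \<bullet> (g \<bullet> f) = (h \<bullet> g) \<bullet> f"
    and ident_left: "f \<in> hom_set C A B \<Longrightarrow> ident C B \<bullet> f = f"
    and ident_right: "f \<in> hom_set C A B \<Longrightarrow> f \<bullet> ident C A = f"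

definition is_inverse :: "('o, 'a, 'z) cat_scheme \<Rightarrow> 'a \<Rightarrow> 'a \<Rightarrow> bool" where
  "is_inverse C f g \<longleftrightarrow> f \<in> arr C \<and> g \<in> hom_set C (tgt C f) (src C f) \<and>
     g \<bullet>\<^bsub>C\<^esub> f = ident C (src C f) \<and> f \<bullet>\<^bsub>C\<^esub> g = ident C (tgt C f)"

definition inv_arr :: "('o, 'a, 'z) cat_scheme \<Rightarrow> 'a \<Rightarrow> 'a" where
  "inv_arr C f = (THE g. is_inverse C f g)"

definition iso_set :: "('o, 'a, 'z) cat_scheme \<Rightarrow> 'o \<Rightarrow> 'o \<Rightarrow> 'a set" where
  "iso_set C A B = {f \<in> hom_set C A B. \<exists>g. is_inverse C f g}"

definition isomorphic_objs :: "('o, 'a, 'z) cat_scheme \<Rightarrow> 'o \<Rightarrow> 'o \<Rightarrow> bool" where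
  "isomorphic_objs C A B \<longleftrightarrow> iso_set C A B \<noteq> {}"

locale groupoid = category +
  assumes invertible: "f \<in> arr C \<Longrightarrow> \<exists>g. is_inverse C f g"

definition full_subcat :: "('o, 'a, 'z) cat_scheme \<Rightarrow> 'o set \<Rightarrow> ('o, 'a) cat" where
  "full_subcat C S = \<lparr>obj = S, arr = {f \<in> arr C. src C f \<in> S \<and> tgt C f \<in> S},
     src = src C, tgt = tgt C, ident = ident C, cmp = cmp C\<rparr>"

text \<open>The raw data of a functor. The type \<open>'x\<close> is that of the values on objects (objects of a
  category, groups or modules), and \<open>'y\<close> that of the values on arrows.\<close>

record ('o, 'a, 'x, 'y) fctr =
  fobj :: "'o \<Rightarrow> 'x"
  farr :: "'a \<Rightarrow> 'y"

definition fctr_comp :: "('p, 'b, 'x, 'y) fctr \<Rightarrow> ('o, 'a, 'p, 'b) fctr \<Rightarrow> ('o, 'a, 'x, 'y) fctr" where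
  "fctr_comp F T = \<lparr>fobj = (\<lambda>A. fobj F (fobj T A)), farr = (\<lambda>f. farr F (farr T f))\<rparr>"

definition cat_fctr ::
  "('o, 'a, 'z) cat_scheme \<Rightarrow> ('p, 'b, 'w) cat_scheme \<Rightarrow> ('o, 'a, 'p, 'b) fctr \<Rightarrow> bool" where
  "cat_fctr C D F \<longleftrightarrow>
     (\<forall>A\<in>obj C. fobj F A \<in> obj D) \<and>
     (\<forall>f\<in>arr C. farr F f \<in> hom_set D (fobj F (src C f)) (fobj F (tgt C f))) \<and>
     (\<forall>A\<in>obj C. farr F (ident C A) = ident D (fobj F A)) \<and>
     (\<forall>f\<in>arr C. \<forall>g\<in>arr C. src C g = tgt C f \<longrightarrow>
        farr F (g \<bullet>\<^bsub>C\<^esub> f) = farr F g \<bullet>\<^bsub>D\<^esub> farr F f)"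

text \<open>Functors to groups. Maps between carriers are only relevant on the carriers.\<close>

definition group_fctr ::
  "('o, 'a, 'z) cat_scheme \<Rightarrow> ('o, 'a, 'g monoid, 'g \<Rightarrow> 'g) fctr \<Rightarrow> bool" where
  "group_fctr C F \<longleftrightarrow>
     (\<forall>A\<in>obj C. group (fobj F A)) \<and>
     (\<forall>f\<in>arr C. farr F f \<in> hom (fobj F (src C f)) (fobj F (tgt C f))) \<and>
     (\<forall>A\<in>obj C. \<forall>x\<in>carrier (fobj F A). farr F (ident C A) x = x) \<and>
     (\<forall>f\<in>arr C. \<forall>g\<in>arr C. src C g = tgt C f \<longrightarrow>
        (\<forall>x\<in>carrier (fobj F (src C f)). farr F (g \<bullet>\<^bsub>C\<^esub> f) x = farr F g (farr F f x)))"

definition module_hom ::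
  "('r, 'z) ring_scheme \<Rightarrow> ('r, 'm, 'y) module_scheme \<Rightarrow> ('r, 'n, 'w) module_scheme \<Rightarrow> ('m \<Rightarrow> 'n) set" where
  "module_hom R M N = {f \<in> carrier M \<rightarrow> carrier N.
     (\<forall>x\<in>carrier M. \<forall>y\<in>carrier M. f (x \<oplus>\<^bsub>M\<^esub> y) = f x \<oplus>\<^bsub>N\<^esub> f y) \<and>
     (\<forall>r\<in>carrier R. \<forall>x\<in>carrier M. f (r \<odot>\<^bsub>M\<^esub> x) = r \<odot>\<^bsub>N\<^esub> f x)}"

definition module_fctr ::
  "('r, 'z) ring_scheme \<Rightarrow> ('o, 'a, 'w) cat_scheme \<Rightarrow>
   ('o, 'a, ('r, 'm) module, 'm \<Rightarrow> 'm) fctr \<Rightarrow> bool" where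
  "module_fctr R C F \<longleftrightarrow>
     (\<forall>A\<in>obj C. module R (fobj F A)) \<and>
     (\<forall>f\<in>arr C. farr F f \<in> module_hom R (fobj F (src C f)) (fobj F (tgt C f))) \<and>
     (\<forall>A\<in>obj C. \<forall>x\<in>carrier (fobj F A). farr F (ident C A) x = x) \<and>
     (\<forall>f\<in>arr C. \<forall>g\<in>arr C. src C g = tgt C f \<longrightarrow>
        (\<forall>x\<in>carrier (fobj F (src C f)). farr F (g \<bullet>\<^bsub>C\<^esub> f) x = farr F g (farr F f x)))"

text \<open>Natural isomorphism in the category of functors from \<open>C\<close> to \<open>R\<close>-modules; that both sides
  really are such functors is part of the assertion.\<close>

definition naturally_isomorphic ::
  "('r, 'z) ring_scheme \<Rightarrow> ('o, 'a, 'w) cat_scheme \<Rightarrow>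
   ('o, 'a, ('r, 'm) module, 'm \<Rightarrow> 'm) fctr \<Rightarrow> ('o, 'a, ('r, 'n) module, 'n \<Rightarrow> 'n) fctr \<Rightarrow> bool" where
  "naturally_isomorphic R C F F' \<longleftrightarrow> module_fctr R C F \<and> module_fctr R C F' \<and>
     (\<exists>\<eta>. (\<forall>A\<in>obj C. \<eta> A \<in> module_hom R (fobj F A) (fobj F' A) \<and>
              bij_betw (\<eta> A) (carrier (fobj F A)) (carrier (fobj F' A))) \<and>
          (\<forall>f\<in>arr C. \<forall>x\<in>carrier (fobj F (src C f)).
              \<eta> (tgt C f) (farr F f x) = farr F' f (\<eta> (src C f) x)))"


section \<open>Strict braided monoidal groupoids and Quillen's bracket construction\<close>

record ('o, 'a) braided_cat = "('o, 'a) cat" +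
  unit_obj :: 'o
  tensor_obj :: "'o \<Rightarrow> 'o \<Rightarrow> 'o"  (infixr \<open>\<natural>\<index>\<close> 80)
  tensor_arr :: "'a \<Rightarrow> 'a \<Rightarrow> 'a"  (infixr \<open>\<sharp>\<index>\<close> 80)
  braid :: "'o \<Rightarrow> 'o \<Rightarrow> 'a"

text \<open>The two coherence conditions between braiding and unit follow from the hexagons, and
  invertibility of the braiding is automatic in a groupoid.\<close>

locale strict_braided_groupoid = groupoid G
  for G :: "('o, 'a) braided_cat" (structure) +
  assumes unit_in: "unit_obj G \<in> obj G"
    and tensor_obj_in: "\<lbrakk>A \<in> obj G; B \<in> obj G\<rbrakk> \<Longrightarrow> A \<natural> B \<in> obj G"
    and tensor_arr_in: "\<lbrakk>f \<in> hom_set G A B; g \<in> hom_set G C D\<rbrakk>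
          \<Longrightarrow> f \<sharp> g \<in> hom_set G (A \<natural> C) (B \<natural> D)"
    and tensor_ident: "\<lbrakk>A \<in> obj G; B \<in> obj G\<rbrakk> \<Longrightarrow> ident G A \<sharp> ident G B = ident G (A \<natural> B)"
    and interchange:
      "\<lbrakk>f \<in> hom_set G A B; f' \<in> hom_set G B C; g \<in> hom_set G A' B'; g' \<in> hom_set G B' C'\<rbrakk>
        \<Longrightarrow> (f' \<bullet> f) \<sharp> (g' \<bullet> g) = (f' \<sharp> g') \<bullet> (f \<sharp> g)"
    and obj_assoc: "\<lbrakk>A \<in> obj G; B \<in> obj G; C \<in> obj G\<rbrakk> \<Longrightarrow> (A \<natural> B) \<natural> C = A \<natural> (B \<natural> C)"
    and obj_unit_left: "A \<in> obj G \<Longrightarrow> unit_obj G \<natural> A = A"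
    and obj_unit_right: "A \<in> obj G \<Longrightarrow> A \<natural> unit_obj G = A"
    and arr_assoc: "\<lbrakk>f \<in> arr G; g \<in> arr G; h \<in> arr G\<rbrakk> \<Longrightarrow> (f \<sharp> g) \<sharp> h = f \<sharp> (g \<sharp> h)"
    and arr_unit_left: "f \<in> arr G \<Longrightarrow> ident G (unit_obj G) \<sharp> f = f"
    and arr_unit_right: "f \<in> arr G \<Longrightarrow> f \<sharp> ident G (unit_obj G) = f"
    and braid_in: "\<lbrakk>A \<in> obj G; B \<in> obj G\<rbrakk> \<Longrightarrow> braid G A B \<in> hom_set G (A \<natural> B) (B \<natural> A)"
    and braid_natural: "\<lbrakk>f \<in> hom_set G A B; g \<in> hom_set G C D\<rbrakk>
          \<Longrightarrow> (g \<sharp> f) \<bullet> braid G A C = braid G B D \<bullet> (f \<sharp> g)"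
    and hexagon_right: "\<lbrakk>A \<in> obj G; B \<in> obj G; C \<in> obj G\<rbrakk>
          \<Longrightarrow> braid G A (B \<natural> C) = (ident G B \<sharp> braid G A C) \<bullet> (braid G A B \<sharp> ident G C)"
    and hexagon_left: "\<lbrakk>A \<in> obj G; B \<in> obj G; C \<in> obj G\<rbrakk>
          \<Longrightarrow> braid G (A \<natural> B) C = (braid G A C \<sharp> ident G B) \<bullet> (ident G A \<sharp> braid G B C)"

text \<open>A morphism \<open>A \<rightarrow> B\<close> of \<open>\<UU>G\<close> is the triple of \<open>A\<close>, \<open>B\<close> and an equivalence class of pairs
  \<open>(X, f)\<close>; \<open>A\<close> has to be recorded since it need not be determined by \<open>X\<close> and \<open>X \<natural> A\<close>.\<close>

type_synonym ('o, 'a) qarr = "'o \<times> 'o \<times> ('o \<times> 'a) set"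

definition bracket ::
  "('o, 'a) braided_cat \<Rightarrow> 'o \<Rightarrow> 'o \<Rightarrow> 'o \<Rightarrow> 'a \<Rightarrow> ('o, 'a) qarr" where
  "bracket G A B X f = (A, B, {(X', f'). X' \<in> obj G \<and> f' \<in> hom_set G (X' \<natural>\<^bsub>G\<^esub> A) B \<and>
     (\<exists>\<psi>\<in>iso_set G X X'. f' \<bullet>\<^bsub>G\<^esub> (\<psi> \<sharp>\<^bsub>G\<^esub> ident G A) = f)})"

abbreviation qsrc :: "('o, 'a) qarr \<Rightarrow> 'o" where "qsrc \<phi> \<equiv> fst \<phi>"
abbreviation qtgt :: "('o, 'a) qarr \<Rightarrow> 'o" where "qtgt \<phi> \<equiv> fst (snd \<phi>)"
abbreviation qcls :: "('o, 'a) qarr \<Rightarrow> ('o \<times> 'a) set" where "qcls \<phi> \<equiv> snd (snd \<phi>)"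

text \<open>Operations on classes are given by the union, over all choices of representatives, of the
  resulting classes (which all coincide).\<close>

definition qcomp ::
  "('o, 'a) braided_cat \<Rightarrow> ('o, 'a) qarr \<Rightarrow> ('o, 'a) qarr \<Rightarrow> ('o, 'a) qarr" where
  "qcomp G \<gamma> \<phi> = (qsrc \<phi>, qtgt \<gamma>,
     \<Union>(X, f)\<in>qcls \<phi>. \<Union>(Y, g)\<in>qcls \<gamma>.
       qcls (bracket G (qsrc \<phi>) (qtgt \<gamma>) (Y \<natural>\<^bsub>G\<^esub> X) (g \<bullet>\<^bsub>G\<^esub> (ident G Y \<sharp>\<^bsub>G\<^esub> f))))"

definition qtensor ::
  "('o, 'a) braided_cat \<Rightarrow> ('o, 'a) qarr \<Rightarrow> ('o, 'a) qarr \<Rightarrow> ('o, 'a) qarr" where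
  "qtensor G \<phi> \<gamma> = (qsrc \<phi> \<natural>\<^bsub>G\<^esub> qsrc \<gamma>, qtgt \<phi> \<natural>\<^bsub>G\<^esub> qtgt \<gamma>,
     \<Union>(X, f)\<in>qcls \<phi>. \<Union>(Y, g)\<in>qcls \<gamma>.
       qcls (bracket G (qsrc \<phi> \<natural>\<^bsub>G\<^esub> qsrc \<gamma>) (qtgt \<phi> \<natural>\<^bsub>G\<^esub> qtgt \<gamma>) (X \<natural>\<^bsub>G\<^esub> Y)
         ((f \<sharp>\<^bsub>G\<^esub> g) \<bullet>\<^bsub>G\<^esub>
          (ident G X \<sharp>\<^bsub>G\<^esub> inv_arr G (braid G (qsrc \<phi>) Y) \<sharp>\<^bsub>G\<^esub> ident G (qsrc \<gamma>)))))"

definition quillen :: "('o, 'a) braided_cat \<Rightarrow> ('o, ('o, 'a) qarr) cat" where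
  "quillen G = \<lparr>obj = obj G,
     arr = {bracket G A B X f |A B X f. A \<in> obj G \<and> B \<in> obj G \<and> X \<in> obj G \<and>
              f \<in> hom_set G (X \<natural>\<^bsub>G\<^esub> A) B},
     src = (\<lambda>\<phi>. qsrc \<phi>), tgt = (\<lambda>\<phi>. qtgt \<phi>),
     ident = (\<lambda>A. bracket G A A (unit_obj G) (ident G A)),
     cmp = qcomp G\<rparr>"

text \<open>The identification of a morphism \<open>\<phi>\<close> of \<open>G\<close> with the morphism \<open>[0, \<phi>]\<close> of \<open>\<UU>G\<close>.\<close>

definition emb :: "('o, 'a) braided_cat \<Rightarrow> 'a \<Rightarrow> ('o, 'a) qarr" where
  "emb G \<phi> = bracket G (src G \<phi>) (tgt G \<phi>) (unit_obj G) \<phi>"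

definition emb_fctr :: "('o, 'a) braided_cat \<Rightarrow> ('o, 'a, 'o, ('o, 'a) qarr) fctr" where
  "emb_fctr G = \<lparr>fobj = (\<lambda>A. A), farr = emb G\<rparr>"


section \<open>Long-Moody systems\<close>

text \<open>Besides the unit object 0 of \<open>G\<close> there are two chosen objects: \<open>z\<close>, usually written as an
  underlined 0, and \<open>u\<close>, usually written 1.\<close>

locale long_moody_setting = strict_braided_groupoid G
  for G :: "('o, 'a) braided_cat" (structure) +
  fixes z u :: 'o
  assumes z_in: "z \<in> obj G"
    and u_in: "u \<in> obj G"
    and u_nontrivial: "\<not> isomorphic_objs G u (unit_obj G)"
    and no_zero_divisors: "\<lbrakk>A \<in> obj G; B \<in> obj G\<rbrakk> \<Longrightarrow>
          isomorphic_objs G (A \<natural> B) (unit_obj G) \<longleftrightarrow>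
          isomorphic_objs G A (unit_obj G) \<and> isomorphic_objs G B (unit_obj G)"
    and aut_unit: "iso_set G (unit_obj G) (unit_obj G) = {ident G (unit_obj G)}"

definition nobj :: "('o, 'a) braided_cat \<Rightarrow> 'o \<Rightarrow> 'o \<Rightarrow> nat \<Rightarrow> 'o" where
  "nobj G z u n = ((\<lambda>A. u \<natural>\<^bsub>G\<^esub> A) ^^ n) (unit_obj G) \<natural>\<^bsub>G\<^esub> z"

definition subG :: "('o, 'a) braided_cat \<Rightarrow> 'o \<Rightarrow> 'o \<Rightarrow> ('o, 'a) cat" where
  "subG G z u = full_subcat G (range (nobj G z u))"

definition subUG :: "('o, 'a) braided_cat \<Rightarrow> 'o \<Rightarrow> 'o \<Rightarrow> ('o, ('o, 'a) qarr) cat" where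
  "subUG G z u = full_subcat (quillen G) (range (nobj G z u))"

definition shift :: "('o, 'a) braided_cat \<Rightarrow> 'o \<Rightarrow> ('o, 'a, 'o, 'a) fctr" where
  "shift G u = \<lparr>fobj = (\<lambda>A. u \<natural>\<^bsub>G\<^esub> A), farr = (\<lambda>\<phi>. ident G u \<sharp>\<^bsub>G\<^esub> \<phi>)\<rparr>"

definition shiftU ::
  "('o, 'a) braided_cat \<Rightarrow> 'o \<Rightarrow> ('o, ('o, 'a) qarr, 'o, ('o, 'a) qarr) fctr" where
  "shiftU G u = \<lparr>fobj = (\<lambda>A. u \<natural>\<^bsub>G\<^esub> A), farr = (\<lambda>\<phi>. qtensor G (ident (quillen G) u) \<phi>)\<rparr>"

definition grothendieck ::
  "('o, 'a, 'z) cat_scheme \<Rightarrow> ('o, 'a, 'g monoid, 'g \<Rightarrow> 'g) fctr \<Rightarrow> ('o, 'g \<times> 'a) cat" where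
  "grothendieck C A = \<lparr>obj = obj C,
     arr = {(h, \<phi>). \<phi> \<in> arr C \<and> h \<in> carrier (fobj A (tgt C \<phi>))},
     src = (\<lambda>(h, \<phi>). src C \<phi>), tgt = (\<lambda>(h, \<phi>). tgt C \<phi>),
     ident = (\<lambda>n. (\<one>\<^bsub>fobj A n\<^esub>, ident C n)),
     cmp = (\<lambda>(h', \<phi>') (h, \<phi>). (h' \<otimes>\<^bsub>fobj A (tgt C \<phi>')\<^esub> farr A \<phi>' h, \<phi>' \<bullet>\<^bsub>C\<^esub> \<phi>))\<rparr>"

definition gsection ::
  "('o, 'a, 'z) cat_scheme \<Rightarrow> ('o, 'a, 'g monoid, 'g \<Rightarrow> 'g) fctr \<Rightarrow> ('o, 'a, 'o, 'g \<times> 'a) fctr" where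
  "gsection C A = \<lparr>fobj = (\<lambda>n. n), farr = (\<lambda>\<phi>. (\<one>\<^bsub>fobj A (tgt C \<phi>)\<^esub>, \<phi>))\<rparr>"

definition fctr_eq_on ::
  "('o, 'a, 'z) cat_scheme \<Rightarrow> ('o, 'a, 'x, 'y) fctr \<Rightarrow> ('o, 'a, 'x, 'y) fctr \<Rightarrow> bool" where
  "fctr_eq_on C F F' \<longleftrightarrow>
     (\<forall>A\<in>obj C. fobj F A = fobj F' A) \<and> (\<forall>f\<in>arr C. farr F f = farr F' f)"

text \<open>The functor \<open>A\<close> is defined on \<open>\<UU>G\<close>; its restriction to \<open>G\<close> is \<open>fctr_comp A (emb_fctr G)\<close>.\<close>

definition long_moody_system ::
  "('o, 'a) braided_cat \<Rightarrow> 'o \<Rightarrow> 'o \<Rightarrow> ('o, ('o, 'a) qarr, 'g monoid, 'g \<Rightarrow> 'g) fctr \<Rightarrow>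
   ('o, 'g \<times> 'a, 'o, 'a) fctr \<Rightarrow> bool" where
  "long_moody_system G z u A \<chi> \<longleftrightarrow>
     long_moody_setting G z u \<and>
     group_fctr (subUG G z u) A \<and>
     cat_fctr (grothendieck (subG G z u) (fctr_comp A (emb_fctr G))) (subG G z u) \<chi> \<and>
     fctr_eq_on (subG G z u)
       (fctr_comp \<chi> (gsection (subG G z u) (fctr_comp A (emb_fctr G)))) (shift G u)"

definition coherent_long_moody_system ::
  "('o, 'a) braided_cat \<Rightarrow> 'o \<Rightarrow> 'o \<Rightarrow> ('o, ('o, 'a) qarr, 'g monoid, 'g \<Rightarrow> 'g) fctr \<Rightarrow>
   ('o, 'g \<times> 'a, 'o, 'a) fctr \<Rightarrow> bool" where
  "coherent_long_moody_system G z u A \<chi> \<longleftrightarrow>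
     long_moody_system G z u A \<chi> \<and>
     (\<exists>\<chi>'. cat_fctr (grothendieck (subUG G z u) A) (subUG G z u) \<chi>' \<and>
        fctr_eq_on (subUG G z u) (fctr_comp \<chi>' (gsection (subUG G z u) A)) (shiftU G u) \<and>
        fctr_eq_on (grothendieck (subG G z u) (fctr_comp A (emb_fctr G)))
          (fctr_comp \<chi>' \<lparr>fobj = (\<lambda>n. n), farr = (\<lambda>(h, \<phi>). (h, emb G \<phi>))\<rparr>)
          (fctr_comp (emb_fctr G) \<chi>))"

text \<open>The homomorphism from \<open>A(n)\<close> to the automorphism group of \<open>u \<natural> n\<close>, for an object \<open>n\<close>.\<close>

definition chi :: "('o, 'a) braided_cat \<Rightarrow> ('o, 'g \<times> 'a, 'o, 'a) fctr \<Rightarrow> 'o \<Rightarrow> 'g \<Rightarrow> 'a" where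
  "chi G \<chi> n h = farr \<chi> (h, ident G n)"


section \<open>Free modules, quotients, group rings, tensor products\<close>

text \<open>Modules are values of the library's record type; as in the library's notion of a module, the
  ring fields \<open>mult\<close> and \<open>one\<close> of that record play no role for a module and are left unspecified.\<close>

definition free_module :: "('r, 'z) ring_scheme \<Rightarrow> 'x set \<Rightarrow> ('r, 'x \<Rightarrow> 'r) module" where
  "free_module R X =
     \<lparr>carrier = {f. range f \<subseteq> carrier R \<and> finite {x. f x \<noteq> \<zero>\<^bsub>R\<^esub>} \<and> {x. f x \<noteq> \<zero>\<^bsub>R\<^esub>} \<subseteq> X},
      mult = undefined, one = undefined,
      zero = (\<lambda>_. \<zero>\<^bsub>R\<^esub>), add = (\<lambda>f g x. f x \<oplus>\<^bsub>R\<^esub> g x), smult = (\<lambda>r f x. r \<otimes>\<^bsub>R\<^esub> f x)\<rparr>"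

definition basis_elt :: "('r, 'z) ring_scheme \<Rightarrow> 'x \<Rightarrow> 'x \<Rightarrow> 'r" where
  "basis_elt R x = (\<lambda>y. if y = x then \<one>\<^bsub>R\<^esub> else \<zero>\<^bsub>R\<^esub>)"

text \<open>The linear extension to a free module of a map \<open>t\<close> from the basis to a module \<open>M\<close>.\<close>

definition lin_ext ::
  "('r, 'z) ring_scheme \<Rightarrow> ('r, 'm, 'w) module_scheme \<Rightarrow> ('x \<Rightarrow> 'm) \<Rightarrow> ('x \<Rightarrow> 'r) \<Rightarrow> 'm" where
  "lin_ext R M t f = (\<Oplus>\<^bsub>M\<^esub>x\<in>{x. f x \<noteq> \<zero>\<^bsub>R\<^esub>}. f x \<odot>\<^bsub>M\<^esub> t x)"

definition submodule_gen ::
  "('r, 'z) ring_scheme \<Rightarrow> ('r, 'm, 'w) module_scheme \<Rightarrow> 'm set \<Rightarrow> 'm set" where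
  "submodule_gen R M X = \<Inter>{H. submodule H R M \<and> X \<subseteq> H}"

definition quot_module ::
  "('r, 'm, 'w) module_scheme \<Rightarrow> 'm set \<Rightarrow> ('r, 'm set) module" where
  "quot_module M N =
     \<lparr>carrier = a_rcosets\<^bsub>M\<^esub> N, mult = undefined, one = undefined,
      zero = N, add = (\<lambda>c d. c <+>\<^bsub>M\<^esub> d), smult = (\<lambda>r c. N <+>\<^bsub>M\<^esub> ((\<lambda>x. r \<odot>\<^bsub>M\<^esub> x) ` c))\<rparr>"

text \<open>The map \<open>M/N \<rightarrow> M'/N'\<close> induced by a homomorphism \<open>f\<close> from \<open>M\<close> to \<open>M'\<close> with \<open>f N \<subseteq> N'\<close>.\<close>

definition quot_map ::
  "('r, 'n, 'w) module_scheme \<Rightarrow> 'n set \<Rightarrow> ('m \<Rightarrow> 'n) \<Rightarrow> 'm set \<Rightarrow> 'n set" where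
  "quot_map M' N' f c = N' <+>\<^bsub>M'\<^esub> (f ` c)"

text \<open>The group ring, with convolution product.\<close>

definition group_ring :: "('r, 'z) ring_scheme \<Rightarrow> 'g monoid \<Rightarrow> ('r, 'g \<Rightarrow> 'r) module" where
  "group_ring R K = (free_module R (carrier K))
     \<lparr>mult := (\<lambda>x y. lin_ext R (free_module R (carrier K))
                (\<lambda>g. lin_ext R (free_module R (carrier K)) (\<lambda>h. basis_elt R (g \<otimes>\<^bsub>K\<^esub> h)) y) x),
      one := basis_elt R \<one>\<^bsub>K\<^esub>\<rparr>"

definition augmentation :: "('r, 'z) ring_scheme \<Rightarrow> ('g \<Rightarrow> 'r) \<Rightarrow> 'r" where
  "augmentation R x = (\<Oplus>\<^bsub>R\<^esub>g\<in>{g. x g \<noteq> \<zero>\<^bsub>R\<^esub>}. x g)"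

definition aug_ideal :: "('r, 'z) ring_scheme \<Rightarrow> 'g monoid \<Rightarrow> ('r, 'g \<Rightarrow> 'r) module" where
  "aug_ideal R K = (group_ring R K)
     \<lparr>carrier := {x \<in> carrier (group_ring R K). augmentation R x = \<zero>\<^bsub>R\<^esub>}\<rparr>"

definition group_ring_map ::
  "('r, 'z) ring_scheme \<Rightarrow> 'h monoid \<Rightarrow> ('g \<Rightarrow> 'h) \<Rightarrow> ('g \<Rightarrow> 'r) \<Rightarrow> ('h \<Rightarrow> 'r)" where
  "group_ring_map R K' f = lin_ext R (group_ring R K') (\<lambda>g. basis_elt R (f g))"

text \<open>The left action of the group ring on a module \<open>V\<close> given by linear automorphisms
  \<open>\<rho> g\<close> of \<open>V\<close>.\<close>

definition group_ring_action ::
  "('r, 'z) ring_scheme \<Rightarrow> ('r, 'v, 'w) module_scheme \<Rightarrow> ('g \<Rightarrow> 'v \<Rightarrow> 'v) \<Rightarrow> ('g \<Rightarrow> 'r) \<Rightarrow> 'v \<Rightarrow> 'v" where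
  "group_ring_action R V \<rho> s v = lin_ext R V (\<lambda>g. \<rho> g v) s"

definition trivial_group_ring_module ::
  "('r, 'z) ring_scheme \<Rightarrow> 'g monoid \<Rightarrow> ('r, 'v, 'w) module_scheme \<Rightarrow>
   (('g \<Rightarrow> 'r) \<Rightarrow> 'v \<Rightarrow> 'v) \<Rightarrow> bool" where
  "trivial_group_ring_module R K V act \<longleftrightarrow>
     (\<forall>g\<in>carrier K. \<forall>v\<in>carrier V. act (basis_elt R g) v = v)"

text \<open>The tensor product over \<open>S\<close> of a right \<open>S\<close>-module \<open>M\<close> (action \<open>\<rho>\<close>) and a left \<open>S\<close>-module \<open>N\<close>
  (action \<open>\<Lambda>\<close>), where \<open>S\<close> is the underlying set of an \<open>R\<close>-algebra: the free \<open>R\<close>-module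
  on \<open>M \<times> N\<close> modulo the relations of biadditivity, of \<open>S\<close>-balancedness, and
  \<open>(r m) \<otimes> n = r (m \<otimes> n)\<close>, the last of which describes the \<open>R\<close>-module structure.\<close>

definition tensor_rels ::
  "('r, 'z) ring_scheme \<Rightarrow> 's set \<Rightarrow> ('r, 'm) module \<Rightarrow> ('m \<Rightarrow> 's \<Rightarrow> 'm) \<Rightarrow>
   ('r, 'n) module \<Rightarrow> ('s \<Rightarrow> 'n \<Rightarrow> 'n) \<Rightarrow> ('m \<times> 'n \<Rightarrow> 'r) set" where
  "tensor_rels R S M \<rho> N \<Lambda> =
    (let L = free_module R (carrier M \<times> carrier N); e = (\<lambda>m n. basis_elt R (m, n)) in
     submodule_gen R L
      ({e (m \<oplus>\<^bsub>M\<^esub> m') n \<ominus>\<^bsub>L\<^esub> (e m n \<oplus>\<^bsub>L\<^esub> e m' n) |m m' n.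
          m \<in> carrier M \<and> m' \<in> carrier M \<and> n \<in> carrier N} \<union>
       {e m (n \<oplus>\<^bsub>N\<^esub> n') \<ominus>\<^bsub>L\<^esub> (e m n \<oplus>\<^bsub>L\<^esub> e m n') |m n n'.
          m \<in> carrier M \<and> n \<in> carrier N \<and> n' \<in> carrier N} \<union>
       {e (\<rho> m s) n \<ominus>\<^bsub>L\<^esub> e m (\<Lambda> s n) |m s n.
          m \<in> carrier M \<and> s \<in> S \<and> n \<in> carrier N} \<union>
       {e (r \<odot>\<^bsub>M\<^esub> m) n \<ominus>\<^bsub>L\<^esub> (r \<odot>\<^bsub>L\<^esub> e m n) |r m n.
          r \<in> carrier R \<and> m \<in> carrier M \<and> n \<in> carrier N}))"

definition tensor_prod ::
  "('r, 'z) ring_scheme \<Rightarrow> 's set \<Rightarrow> ('r, 'm) module \<Rightarrow> ('m \<Rightarrow> 's \<Rightarrow> 'm) \<Rightarrow>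
   ('r, 'n) module \<Rightarrow> ('s \<Rightarrow> 'n \<Rightarrow> 'n) \<Rightarrow> ('r, ('m \<times> 'n \<Rightarrow> 'r) set) module" where
  "tensor_prod R S M \<rho> N \<Lambda> =
     quot_module (free_module R (carrier M \<times> carrier N)) (tensor_rels R S M \<rho> N \<Lambda>)"

text \<open>The map \<open>m \<otimes> n \<mapsto> f m \<otimes> g n\<close> into the tensor product of \<open>M'\<close> and \<open>N'\<close>.\<close>

definition tensor_map ::
  "('r, 'z) ring_scheme \<Rightarrow> 't set \<Rightarrow> ('r, 'm') module \<Rightarrow> ('m' \<Rightarrow> 't \<Rightarrow> 'm') \<Rightarrow>
   ('r, 'n') module \<Rightarrow> ('t \<Rightarrow> 'n' \<Rightarrow> 'n') \<Rightarrow> ('m \<Rightarrow> 'm') \<Rightarrow> ('n \<Rightarrow> 'n') \<Rightarrow>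
   ('m \<times> 'n \<Rightarrow> 'r) set \<Rightarrow> ('m' \<times> 'n' \<Rightarrow> 'r) set" where
  "tensor_map R S' M' \<rho>' N' \<Lambda>' f g =
     (let L' = free_module R (carrier M' \<times> carrier N') in
      quot_map L' (tensor_rels R S' M' \<rho>' N' \<Lambda>')
        (lin_ext R L' (\<lambda>(m, n). basis_elt R (f m, g n))))"

definition tensor_fctr ::
  "('r, 'z) ring_scheme \<Rightarrow> ('o, 'a, 'w) cat_scheme \<Rightarrow>
   ('o, 'a, ('r, 'm) module, 'm \<Rightarrow> 'm) fctr \<Rightarrow> ('o, 'a, ('r, 'n) module, 'n \<Rightarrow> 'n) fctr \<Rightarrow>
   ('o, 'a, ('r, ('m \<times> 'n \<Rightarrow> 'r) set) module, ('m \<times> 'n \<Rightarrow> 'r) set \<Rightarrow> ('m \<times> 'n \<Rightarrow> 'r) set) fctr" where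
  "tensor_fctr R C F F' =
     \<lparr>fobj = (\<lambda>A. tensor_prod R (carrier R)
                (fobj F A) (\<lambda>m r. r \<odot>\<^bsub>fobj F A\<^esub> m) (fobj F' A) (\<lambda>r n. r \<odot>\<^bsub>fobj F' A\<^esub> n)),
      farr = (\<lambda>\<phi>. let B = tgt C \<phi> in tensor_map R (carrier R)
                (fobj F B) (\<lambda>m r. r \<odot>\<^bsub>fobj F B\<^esub> m) (fobj F' B) (\<lambda>r n. r \<odot>\<^bsub>fobj F' B\<^esub> n)
                (farr F \<phi>) (farr F' \<phi>))\<rparr>"


section \<open>Group homology\<close>

text \<open>Homology of a group with trivial coefficients \<open>R\<close>, computed by the (inhomogeneous,
  unnormalised) bar complex: the coinvariants of the bar resolution are in degree \<open>n\<close> free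
  over \<open>R\<close> on \<open>n\<close>-tuples \<open>[g\<^sub>1|...|g\<^sub>n]\<close>.\<close>

definition bar_module :: "('r, 'z) ring_scheme \<Rightarrow> 'g monoid \<Rightarrow> nat \<Rightarrow> ('r, 'g list \<Rightarrow> 'r) module" where
  "bar_module R K n = free_module R {gs. length gs = n \<and> set gs \<subseteq> carrier K}"

text \<open>The faces of \<open>[g\<^sub>1|...|g\<^sub>n]\<close> (with \<open>n > 0\<close>): drop \<open>g\<^sub>1\<close>, multiply \<open>g\<^sub>i\<close> and \<open>g\<^sub>i\<^sub>+\<^sub>1\<close> for
  \<open>0 < i < n\<close>, or drop \<open>g\<^sub>n\<close>.\<close>

definition bar_face :: "'g monoid \<Rightarrow> nat \<Rightarrow> 'g list \<Rightarrow> 'g list" where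
  "bar_face K i gs =
     (if i = 0 then tl gs
      else if i < length gs
        then take (i - 1) gs @ [gs ! (i - 1) \<otimes>\<^bsub>K\<^esub> gs ! i] @ drop (i + 1) gs
      else butlast gs)"

definition bar_boundary ::
  "('r, 'z) ring_scheme \<Rightarrow> 'g monoid \<Rightarrow> nat \<Rightarrow> ('g list \<Rightarrow> 'r) \<Rightarrow> ('g list \<Rightarrow> 'r)" where
  "bar_boundary R K n = lin_ext R (bar_module R K (n - 1))
     (\<lambda>gs. \<Oplus>\<^bsub>bar_module R K (n - 1)\<^esub>i\<in>{0..n}.
        (\<ominus>\<^bsub>R\<^esub> \<one>\<^bsub>R\<^esub>) [^]\<^bsub>R\<^esub> i \<odot>\<^bsub>bar_module R K (n - 1)\<^esub> basis_elt R (bar_face K i gs))"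

definition bar_cycles ::
  "('r, 'z) ring_scheme \<Rightarrow> 'g monoid \<Rightarrow> nat \<Rightarrow> ('r, 'g list \<Rightarrow> 'r) module" where
  "bar_cycles R K n = (bar_module R K n)
     \<lparr>carrier := {c \<in> carrier (bar_module R K n).
        n = 0 \<or> bar_boundary R K n c = \<zero>\<^bsub>bar_module R K (n - 1)\<^esub>}\<rparr>"

definition bar_boundaries ::
  "('r, 'z) ring_scheme \<Rightarrow> 'g monoid \<Rightarrow> nat \<Rightarrow> ('g list \<Rightarrow> 'r) set" where
  "bar_boundaries R K n = bar_boundary R K (n + 1) ` carrier (bar_module R K (n + 1))"

definition group_homology ::
  "('r, 'z) ring_scheme \<Rightarrow> nat \<Rightarrow> 'g monoid \<Rightarrow> ('r, ('g list \<Rightarrow> 'r) set) module" where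
  "group_homology R n K = quot_module (bar_cycles R K n) (bar_boundaries R K n)"

definition group_homology_map ::
  "('r, 'z) ring_scheme \<Rightarrow> nat \<Rightarrow> 'h monoid \<Rightarrow> ('g \<Rightarrow> 'h) \<Rightarrow>
   ('g list \<Rightarrow> 'r) set \<Rightarrow> ('h list \<Rightarrow> 'r) set" where
  "group_homology_map R n K' f = quot_map (bar_cycles R K' n) (bar_boundaries R K' n)
     (lin_ext R (bar_module R K' n) (\<lambda>gs. basis_elt R (map f gs)))"

definition H1_fctr ::
  "('r, 'z) ring_scheme \<Rightarrow> ('o, 'a, 'w) cat_scheme \<Rightarrow> ('o, 'a, 'g monoid, 'g \<Rightarrow> 'g) fctr \<Rightarrow>
   ('o, 'a, ('r, ('g list \<Rightarrow> 'r) set) module,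
    ('g list \<Rightarrow> 'r) set \<Rightarrow> ('g list \<Rightarrow> 'r) set) fctr" where
  "H1_fctr R C A =
     \<lparr>fobj = (\<lambda>n. group_homology R 1 (fobj A n)),
      farr = (\<lambda>\<phi>. group_homology_map R 1 (fobj A (tgt C \<phi>)) (farr A \<phi>))\<rparr>"


section \<open>The Long-Moody functor\<close>

text \<open>The construction is the same over \<open>G\<close> and over \<open>\<UU>G\<close>. The parameters are the
  category \<open>C\<close>, the functor \<open>A\<close> from \<open>C\<close> to groups, the endofunctor \<open>T\<close> (which is \<open>1 \<natural> -\<close>) and,
  for each object \<open>n\<close> of \<open>C\<close>, the map \<open>x n\<close> from \<open>A(n)\<close> to the automorphisms of \<open>T n\<close>
  (which is \<open>\<chi>\<^sub>n\<close>).\<close>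

definition LM_action ::
  "('r, 'z) ring_scheme \<Rightarrow> ('o, 'a, 'o, 'a) fctr \<Rightarrow> ('o \<Rightarrow> 'g \<Rightarrow> 'a) \<Rightarrow>
   ('o, 'a, ('r, 'v) module, 'v \<Rightarrow> 'v) fctr \<Rightarrow> 'o \<Rightarrow> ('g \<Rightarrow> 'r) \<Rightarrow> 'v \<Rightarrow> 'v" where
  "LM_action R T x F n = group_ring_action R (fobj F (fobj T n)) (\<lambda>h. farr F (x n h))"

definition LM ::
  "('r, 'z) ring_scheme \<Rightarrow> ('o, 'a, 'w) cat_scheme \<Rightarrow> ('o, 'a, 'g monoid, 'g \<Rightarrow> 'g) fctr \<Rightarrow>
   ('o, 'a, 'o, 'a) fctr \<Rightarrow> ('o \<Rightarrow> 'g \<Rightarrow> 'a) \<Rightarrow> ('o, 'a, ('r, 'v) module, 'v \<Rightarrow> 'v) fctr \<Rightarrow>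
   ('o, 'a, ('r, (('g \<Rightarrow> 'r) \<times> 'v \<Rightarrow> 'r) set) module,
    (('g \<Rightarrow> 'r) \<times> 'v \<Rightarrow> 'r) set \<Rightarrow> (('g \<Rightarrow> 'r) \<times> 'v \<Rightarrow> 'r) set) fctr" where
  "LM R C A T x F =
     \<lparr>fobj = (\<lambda>n. let K = fobj A n in
        tensor_prod R (carrier (group_ring R K)) (aug_ideal R K) (mult (group_ring R K))
          (fobj F (fobj T n)) (LM_action R T x F n)),
      farr = (\<lambda>\<phi>. let n' = tgt C \<phi>; K' = fobj A n' in
        tensor_map R (carrier (group_ring R K')) (aug_ideal R K') (mult (group_ring R K'))
          (fobj F (fobj T n')) (LM_action R T x F n')
          (group_ring_map R K' (farr A \<phi>)) (farr F (farr T \<phi>)))\<rparr>"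

end

theory Submission
  imports Defs
begin

text \<open>For a group \<open>K\<close> with augmentation ideal \<open>I\<close>, sending \<open>g - 1\<close> to the class of \<open>[g]\<close> is the
  isomorphism \<open>I/I\<^sup>2 \<cong> H\<^sub>1(K; R)\<close>. Tensoring \<open>I\<close> over \<open>R[K]\<close> with a module on which \<open>K\<close> acts
  trivially only sees \<open>I/I\<^sup>2\<close>, so \<open>I \<otimes>\<^bsub>R[K]\<^esub> V \<cong> H\<^sub>1(K; R) \<otimes>\<^sub>R V\<close>, naturally in \<open>K\<close> and \<open>V\<close>.
  Once the modules are trivial, \<open>\<chi>\<close> is needed only to see that \<open>1 \<natural> -\<close> is an endofunctor, as it is the
  composite of \<open>\<chi>\<close> with the section of the Grothendieck construction; in the coherent case this
  avoids verifying functoriality of the tensor product of \<open>\<UU>G\<close>.\<close>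

text \<open>The quotient \<open>I/I\<^sup>2\<close> is never formed. A map of tensor products is
  built in each direction from the universal property:
  \<open>x \<otimes> v \<mapsto> \<phi> x \<otimes> v\<close>, where \<open>\<phi>\<close> extends
  \<open>g \<mapsto> [g]\<close> linearly, and
  \<open>[g] \<otimes> v \<mapsto> (g - 1) \<otimes> v\<close>. The two are not symmetric. While
  \<open>\<phi>\<close> lives on \<open>I\<close> itself, \<open>[g] \<mapsto> g - 1\<close> does
  not descend to homology with values in \<open>I\<close>: the defect
  \<open>(gk - 1) - (g - 1) - (k - 1) = (g - 1)(k - 1)\<close> vanishes only after tensoring with a
  module on which \<open>K\<close> acts trivially. Hence the second map is pushed down to homology
  for each fixed \<open>v\<close>, with values in the tensor product. Triviality is used in the form
  that \<open>s\<close> in \<open>R[K]\<close> acts as the scalar \<open>\<epsilon>(s)\<close>, its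
  augmentation. The rule \<open>\<phi>(xy) = \<epsilon>(y) \<phi>(x) + \<epsilon>(x)
  \<phi>(y)\<close> then makes \<open>\<phi>\<close> balanced on \<open>I\<close>, where
  \<open>\<epsilon>(x) = 0\<close>. As all modules are concrete sets of functions or cosets,
  equations between linear maps are tested on generators: group elements, the \<open>g - 1\<close>,
  one-element tuples, pure tensors.\<close>

section \<open>Linear maps between modules, their kernels and images\<close>

lemma module_hom_closed: "f \<in> module_hom R M N \<Longrightarrow> x \<in> carrier M \<Longrightarrow> f x \<in> carrier N"
  by (auto simp: module_hom_def)

lemma module_hom_add:
  "f \<in> module_hom R M N \<Longrightarrow> x \<in> carrier M \<Longrightarrow> y \<in> carrier M \<Longrightarrow> f (x \<oplus>\<^bsub>M\<^esub> y) = f x \<oplus>\<^bsub>N\<^esub> f y"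
  by (auto simp: module_hom_def)

lemma module_hom_smult:
  "f \<in> module_hom R M N \<Longrightarrow> r \<in> carrier R \<Longrightarrow> x \<in> carrier M \<Longrightarrow> f (r \<odot>\<^bsub>M\<^esub> x) = r \<odot>\<^bsub>N\<^esub> f x"
  by (auto simp: module_hom_def)

lemma module_homI:
  assumes "\<And>x. x \<in> carrier M \<Longrightarrow> f x \<in> carrier N"
    and "\<And>x y. x \<in> carrier M \<Longrightarrow> y \<in> carrier M \<Longrightarrow> f (x \<oplus>\<^bsub>M\<^esub> y) = f x \<oplus>\<^bsub>N\<^esub> f y"
    and "\<And>r x. r \<in> carrier R \<Longrightarrow> x \<in> carrier M \<Longrightarrow> f (r \<odot>\<^bsub>M\<^esub> x) = r \<odot>\<^bsub>N\<^esub> f x"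
  shows "f \<in> module_hom R M N"
  using assms by (auto simp: module_hom_def)

lemma module_hom_ident: "(\<lambda>x. x) \<in> module_hom R M M"
  by (simp add: module_hom_def)

lemma module_hom_compose:
  assumes "f \<in> module_hom R M N" "g \<in> module_hom R N P"
  shows "(\<lambda>x. g (f x)) \<in> module_hom R M P"
  by (rule module_homI)
    (simp_all add: module_hom_closed[OF assms(1)] module_hom_closed[OF assms(2)]
      module_hom_add[OF assms(1)] module_hom_add[OF assms(2)]
      module_hom_smult[OF assms(1)] module_hom_smult[OF assms(2)])

lemma module_hom_zero:
  assumes "module R M" "module R N" "f \<in> module_hom R M N"
  shows "f \<zero>\<^bsub>M\<^esub> = \<zero>\<^bsub>N\<^esub>"
proof -
  interpret M: module R M by fact
  interpret N: module R N by fact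
  have "f \<zero>\<^bsub>M\<^esub> = f (\<zero>\<^bsub>R\<^esub> \<odot>\<^bsub>M\<^esub> \<zero>\<^bsub>M\<^esub>)" by simp
  also have "\<dots> = \<zero>\<^bsub>R\<^esub> \<odot>\<^bsub>N\<^esub> f \<zero>\<^bsub>M\<^esub>" by (rule module_hom_smult[OF assms(3)]) auto
  also have "\<dots> = \<zero>\<^bsub>N\<^esub>" by (rule N.smult_l_null) (rule module_hom_closed[OF assms(3)], simp)
  finally show ?thesis .
qed

lemma module_hom_uminus:
  assumes "module R M" "module R N" "f \<in> module_hom R M N" and x: "x \<in> carrier M"
  shows "f (\<ominus>\<^bsub>M\<^esub> x) = \<ominus>\<^bsub>N\<^esub> f x"
proof -
  interpret M: module R M by fact
  interpret N: module R N by fact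
  have fx: "f x \<in> carrier N" by (rule module_hom_closed[OF assms(3) x])
  have "\<ominus>\<^bsub>M\<^esub> x = (\<ominus>\<^bsub>R\<^esub> \<one>\<^bsub>R\<^esub>) \<odot>\<^bsub>M\<^esub> x" using x by (simp add: M.smult_l_minus)
  hence "f (\<ominus>\<^bsub>M\<^esub> x) = (\<ominus>\<^bsub>R\<^esub> \<one>\<^bsub>R\<^esub>) \<odot>\<^bsub>N\<^esub> f x"
    using module_hom_smult[OF assms(3) _ x, of "\<ominus>\<^bsub>R\<^esub> \<one>\<^bsub>R\<^esub>"] by simp
  thus ?thesis using fx by (simp add: N.smult_l_minus)
qed

lemma module_hom_diff:
  assumes "module R M" "module R N" "f \<in> module_hom R M N" "x \<in> carrier M" "y \<in> carrier M"
  shows "f (x \<ominus>\<^bsub>M\<^esub> y) = f x \<ominus>\<^bsub>N\<^esub> f y"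
proof -
  interpret M: module R M by fact
  show ?thesis
    using assms by (simp add: a_minus_def module_hom_add[OF assms(3)] module_hom_uminus[OF assms(1-3)])
qed

lemma module_hom_finsum:
  assumes "module R M" "module R N" "f \<in> module_hom R M N"
    and "finite A" "\<And>a. a \<in> A \<Longrightarrow> t a \<in> carrier M"
  shows "f (finsum M t A) = finsum N (\<lambda>a. f (t a)) A"
proof -
  interpret M: module R M by fact
  interpret N: module R N by fact
  note cl = module_hom_closed[OF assms(3)]
  show ?thesis using assms(4,5)
  proof (induction A)
    case empty
    show ?case by (simp add: module_hom_zero[OF assms(1-3)])
  next
    case (insert a A)
    have "finsum M t A \<in> carrier M" using insert by (auto intro!: M.finsum_closed)
    thus ?case using insert
      by (simp add: M.finsum_insert N.finsum_insert Pi_def cl module_hom_add[OF assms(3)])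
  qed
qed

lemma module_hom_kernel_submodule:
  assumes "module R M" "module R N" "f \<in> module_hom R M N"
  shows "submodule {x \<in> carrier M. f x = \<zero>\<^bsub>N\<^esub>} R M"
proof -
  interpret M: module R M by fact
  interpret N: module R N by fact
  show ?thesis
    by (rule M.submoduleI)
      (auto simp: module_hom_zero[OF assms] module_hom_uminus[OF assms]
        module_hom_add[OF assms(3)] module_hom_smult[OF assms(3)])
qed

lemma module_hom_image_submodule:
  assumes "module R M" "module R N" "f \<in> module_hom R M N"
  shows "submodule (f ` carrier M) R N"
proof -
  interpret M: module R M by fact
  interpret N: module R N by fact
  show ?thesis
  proof (rule N.submoduleI)
    show "f ` carrier M \<subseteq> carrier N" using module_hom_closed[OF assms(3)] by auto
    show "\<zero>\<^bsub>N\<^esub> \<in> f ` carrier M" using module_hom_zero[OF assms] by (metis M.zero_closed imageI)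
    show "\<ominus>\<^bsub>N\<^esub> a \<in> f ` carrier M" if "a \<in> f ` carrier M" for a
      using that by (auto simp: module_hom_uminus[OF assms, symmetric])
    show "a \<oplus>\<^bsub>N\<^esub> b \<in> f ` carrier M" if "a \<in> f ` carrier M" "b \<in> f ` carrier M" for a b
      using that by (auto simp: module_hom_add[OF assms(3), symmetric])
    show "a \<odot>\<^bsub>N\<^esub> b \<in> f ` carrier M" if "a \<in> carrier R" "b \<in> f ` carrier M" for a b
      using that by (auto simp: module_hom_smult[OF assms(3), symmetric])
  qed
qed


section \<open>Free modules\<close>

lemma free_module_simps:
  "carrier (free_module R X) =
     {f. range f \<subseteq> carrier R \<and> finite {x. f x \<noteq> \<zero>\<^bsub>R\<^esub>} \<and> {x. f x \<noteq> \<zero>\<^bsub>R\<^esub>} \<subseteq> X}"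
  "\<zero>\<^bsub>free_module R X\<^esub> = (\<lambda>_. \<zero>\<^bsub>R\<^esub>)"
  "f \<oplus>\<^bsub>free_module R X\<^esub> g = (\<lambda>x. f x \<oplus>\<^bsub>R\<^esub> g x)"
  "r \<odot>\<^bsub>free_module R X\<^esub> f = (\<lambda>x. r \<otimes>\<^bsub>R\<^esub> f x)"
  by (simp_all add: free_module_def)

lemma free_moduleD:
  assumes "f \<in> carrier (free_module R X)"
  shows "f x \<in> carrier R" "finite {x. f x \<noteq> \<zero>\<^bsub>R\<^esub>}" "{x. f x \<noteq> \<zero>\<^bsub>R\<^esub>} \<subseteq> X"
  using assms by (auto simp: free_module_simps)

context cring
begin

text \<open>Finiteness is asked of a superset \<open>B\<close> of the support because the support of
  a sum or a multiple is only bounded, not determined, by those of the operands.\<close>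

lemma free_moduleI:
  assumes "\<And>x. f x \<in> carrier R" "finite B" "B \<subseteq> X" "\<And>x. x \<notin> B \<Longrightarrow> f x = \<zero>"
  shows "f \<in> carrier (free_module R X)"
proof -
  have "{x. f x \<noteq> \<zero>} \<subseteq> B" using assms(4) by blast
  thus ?thesis using assms(1-3) by (auto simp: free_module_simps intro: finite_subset)
qed

lemma module_free_module: "module R (free_module R X)"
proof (rule moduleI)
  let ?F = "free_module R X"
  show "cring R" by (rule cring_axioms)
  note cl = free_moduleD(1)[where X = X and R = R]
  have add: "f \<oplus>\<^bsub>?F\<^esub> g \<in> carrier ?F" if "f \<in> carrier ?F" "g \<in> carrier ?F" for f g
    unfolding free_module_simps(3)
    by (rule free_moduleI[of _ "{x. f x \<noteq> \<zero>} \<union> {x. g x \<noteq> \<zero>}"])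
      (use free_moduleD[OF that(1)] free_moduleD[OF that(2)] in auto)
  have sm: "r \<odot>\<^bsub>?F\<^esub> f \<in> carrier ?F" if "f \<in> carrier ?F" "r \<in> carrier R" for f r
    unfolding free_module_simps(4)
    by (rule free_moduleI[of _ "{x. f x \<noteq> \<zero>}"]) (use that free_moduleD[OF that(1)] in auto)
  show "abelian_group ?F"
  proof (rule abelian_groupI)
    show "\<exists>g\<in>carrier ?F. g \<oplus>\<^bsub>?F\<^esub> f = \<zero>\<^bsub>?F\<^esub>" if f: "f \<in> carrier ?F" for f
    proof
      show "(\<ominus> \<one>) \<odot>\<^bsub>?F\<^esub> f \<in> carrier ?F" by (rule sm[OF f]) simp
      show "((\<ominus> \<one>) \<odot>\<^bsub>?F\<^esub> f) \<oplus>\<^bsub>?F\<^esub> f = \<zero>\<^bsub>?F\<^esub>"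
        using free_moduleD(1)[OF f] by (simp add: free_module_simps l_minus l_neg)
    qed
  next
    show "\<zero>\<^bsub>?F\<^esub> \<in> carrier ?F" by (simp add: free_module_simps)
  qed (simp_all add: add[unfolded free_module_simps(3)] free_module_simps(2,3) cl a_ac)
  show "r \<odot>\<^bsub>?F\<^esub> f \<in> carrier ?F" if "r \<in> carrier R" "f \<in> carrier ?F" for r f
    by (rule sm[OF that(2,1)])
qed (simp_all add: free_module_simps(3,4) free_moduleD(1)[where X = X and R = R] l_distr r_distr m_assoc)

lemma basis_elt_closed: "x \<in> X \<Longrightarrow> basis_elt R x \<in> carrier (free_module R X)"
  by (rule free_moduleI[of _ "{x}"]) (auto simp: basis_elt_def)

end

context module
begin

lemma finsum_smult_rdistr:
  assumes "finite B" "\<And>i. i \<in> B \<Longrightarrow> a i \<in> carrier R" "m \<in> carrier M"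
  shows "(\<Oplus>\<^bsub>M\<^esub>i\<in>B. a i \<odot>\<^bsub>M\<^esub> m) = (\<Oplus>i\<in>B. a i) \<odot>\<^bsub>M\<^esub> m"
  using assms
proof (induction B)
  case empty
  thus ?case by simp
next
  case (insert b B)
  have "finsum R a B \<in> carrier R" using insert by (auto intro!: R.finsum_closed)
  with insert show ?case
    by (simp add: M.finsum_insert R.finsum_insert Pi_def smult_l_distr)
qed

text \<open>The sum in \<open>lin_ext\<close> runs over the support of \<open>f\<close>, which may
  shrink under addition and scaling. A larger common index set makes linearity in \<open>f\<close> a
  statement about sums over one fixed set.\<close>

lemma lin_ext_superset:
  assumes "f \<in> carrier (free_module R X)" "\<And>x. x \<in> X \<Longrightarrow> t x \<in> carrier M"
    and "finite B" "{x. f x \<noteq> \<zero>} \<subseteq> B" "B \<subseteq> X"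
  shows "lin_ext R M t f = (\<Oplus>\<^bsub>M\<^esub>x\<in>B. f x \<odot>\<^bsub>M\<^esub> t x)"
  unfolding lin_ext_def
proof (rule M.add.finprod_mono_neutral_cong_left)
  show "finite B" "{x. f x \<noteq> \<zero>} \<subseteq> B" by fact+
  show "f x \<odot>\<^bsub>M\<^esub> t x = \<zero>\<^bsub>M\<^esub>" if "x \<in> B - {x. f x \<noteq> \<zero>}" for x
    using that assms(2,5) by auto
qed (use assms free_moduleD(1)[OF assms(1)] in auto)

lemma lin_ext_closed:
  assumes "f \<in> carrier (free_module R X)" "\<And>x. x \<in> X \<Longrightarrow> t x \<in> carrier M"
  shows "lin_ext R M t f \<in> carrier M"
  unfolding lin_ext_def
  by (rule M.finsum_closed) (use assms free_moduleD[OF assms(1)] in auto)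

lemma lin_ext_hom:
  assumes t: "\<And>x. x \<in> X \<Longrightarrow> t x \<in> carrier M"
  shows "lin_ext R M t \<in> module_hom R (free_module R X) M"
proof -
  interpret F: module R "free_module R X" by (rule R.module_free_module)
  show ?thesis
  proof (rule module_homI)
    fix f assume f: "f \<in> carrier (free_module R X)"
    show "lin_ext R M t f \<in> carrier M" by (rule lin_ext_closed[OF f t])
    note fD = free_moduleD[OF f]
    {
      fix g assume g: "g \<in> carrier (free_module R X)"
      note gD = free_moduleD[OF g]
      let ?B = "{x. f x \<noteq> \<zero>} \<union> {x. g x \<noteq> \<zero>}"
      have B: "finite ?B" "?B \<subseteq> X" using fD gD by auto
      have S: "{x. f x \<oplus> g x \<noteq> \<zero>} \<subseteq> ?B" by auto
      have tB: "x \<in> ?B \<Longrightarrow> t x \<in> carrier M" for x using t B(2) by auto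
      have "lin_ext R M t (f \<oplus>\<^bsub>free_module R X\<^esub> g) = (\<Oplus>\<^bsub>M\<^esub>x\<in>?B. (f x \<oplus> g x) \<odot>\<^bsub>M\<^esub> t x)"
        using lin_ext_superset[where t = t, OF F.a_closed[OF f g] t B(1) _ B(2)] S
        by (simp add: free_module_simps)
      also have "\<dots> = (\<Oplus>\<^bsub>M\<^esub>x\<in>?B. f x \<odot>\<^bsub>M\<^esub> t x \<oplus>\<^bsub>M\<^esub> g x \<odot>\<^bsub>M\<^esub> t x)"
        by (rule M.finsum_cong') (use tB fD(1) gD(1) in \<open>auto simp: smult_l_distr\<close>)
      also have "\<dots> = (\<Oplus>\<^bsub>M\<^esub>x\<in>?B. f x \<odot>\<^bsub>M\<^esub> t x) \<oplus>\<^bsub>M\<^esub> (\<Oplus>\<^bsub>M\<^esub>x\<in>?B. g x \<odot>\<^bsub>M\<^esub> t x)"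
        by (rule M.finsum_addf) (use tB fD(1) gD(1) in auto)
      also have "\<dots> = lin_ext R M t f \<oplus>\<^bsub>M\<^esub> lin_ext R M t g"
        using lin_ext_superset[OF f t B(1) _ B(2)] lin_ext_superset[OF g t B(1) _ B(2)] by auto
      finally show "lin_ext R M t (f \<oplus>\<^bsub>free_module R X\<^esub> g) = lin_ext R M t f \<oplus>\<^bsub>M\<^esub> lin_ext R M t g" .
    }
    fix r assume r: "r \<in> carrier R"
    let ?B = "{x. f x \<noteq> \<zero>}"
    have S: "{x. r \<otimes> f x \<noteq> \<zero>} \<subseteq> ?B" using r by auto
    have "lin_ext R M t (r \<odot>\<^bsub>free_module R X\<^esub> f) = (\<Oplus>\<^bsub>M\<^esub>x\<in>?B. (r \<otimes> f x) \<odot>\<^bsub>M\<^esub> t x)"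
      using lin_ext_superset[where t = t, OF F.smult_closed[OF r f] t fD(2) _ fD(3)] S
      by (simp add: free_module_simps)
    also have "\<dots> = (\<Oplus>\<^bsub>M\<^esub>x\<in>?B. r \<odot>\<^bsub>M\<^esub> (f x \<odot>\<^bsub>M\<^esub> t x))"
      by (rule M.finsum_cong') (use t r fD in \<open>auto simp: smult_assoc1\<close>)
    also have "\<dots> = r \<odot>\<^bsub>M\<^esub> lin_ext R M t f"
      unfolding lin_ext_def
      by (rule finsum_smult_ldistr[symmetric]) (use fD r t in auto)
    finally show "lin_ext R M t (r \<odot>\<^bsub>free_module R X\<^esub> f) = r \<odot>\<^bsub>M\<^esub> lin_ext R M t f" .
  qed
qed

lemma lin_ext_basis:
  assumes "t x \<in> carrier M"
  shows "lin_ext R M t (basis_elt R x) = t x"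
proof -
  \<comment> \<open>The index set \<open>{x}\<close> replaces the support, which would be empty over
    the zero ring.\<close>
  have "lin_ext R M t (basis_elt R x) = (\<Oplus>\<^bsub>M\<^esub>y\<in>{x}. basis_elt R x y \<odot>\<^bsub>M\<^esub> t y)"
    by (rule lin_ext_superset[of _ "{x}"]) (use assms in \<open>auto simp: R.basis_elt_closed, simp add: basis_elt_def split: if_splits\<close>)
  also have "\<dots> = t x"
    using assms by (simp add: M.finsum_insert basis_elt_def)
  finally show ?thesis .
qed

lemma lin_ext_cong:
  assumes "f \<in> carrier (free_module R X)" "\<And>x. x \<in> X \<Longrightarrow> t x = t' x" "\<And>x. x \<in> X \<Longrightarrow> t' x \<in> carrier M"
  shows "lin_ext R M t f = lin_ext R M t' f"
  unfolding lin_ext_def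
  by (rule M.finsum_cong') (use assms free_moduleD[OF assms(1)] in auto)

lemma lin_ext_add_fun:
  assumes f: "f \<in> carrier (free_module R X)"
    and t: "\<And>x. x \<in> X \<Longrightarrow> t x \<in> carrier M" "\<And>x. x \<in> X \<Longrightarrow> t' x \<in> carrier M"
  shows "lin_ext R M (\<lambda>x. t x \<oplus>\<^bsub>M\<^esub> t' x) f = lin_ext R M t f \<oplus>\<^bsub>M\<^esub> lin_ext R M t' f"
proof -
  note fD = free_moduleD[OF f]
  have "lin_ext R M (\<lambda>x. t x \<oplus>\<^bsub>M\<^esub> t' x) f
    = (\<Oplus>\<^bsub>M\<^esub>x\<in>{x. f x \<noteq> \<zero>}. f x \<odot>\<^bsub>M\<^esub> t x \<oplus>\<^bsub>M\<^esub> f x \<odot>\<^bsub>M\<^esub> t' x)"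
    unfolding lin_ext_def
    by (rule M.finsum_cong') (use fD t in \<open>auto simp: smult_r_distr\<close>)
  also have "\<dots> = lin_ext R M t f \<oplus>\<^bsub>M\<^esub> lin_ext R M t' f"
    unfolding lin_ext_def by (rule M.finsum_addf) (use fD t in auto)
  finally show ?thesis .
qed

lemma lin_ext_smult_fun:
  assumes f: "f \<in> carrier (free_module R X)" and r: "r \<in> carrier R"
    and t: "\<And>x. x \<in> X \<Longrightarrow> t x \<in> carrier M"
  shows "lin_ext R M (\<lambda>x. r \<odot>\<^bsub>M\<^esub> t x) f = r \<odot>\<^bsub>M\<^esub> lin_ext R M t f"
proof -
  note fD = free_moduleD[OF f]
  have "lin_ext R M (\<lambda>x. r \<odot>\<^bsub>M\<^esub> t x) f = (\<Oplus>\<^bsub>M\<^esub>x\<in>{x. f x \<noteq> \<zero>}. r \<odot>\<^bsub>M\<^esub> (f x \<odot>\<^bsub>M\<^esub> t x))"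
    unfolding lin_ext_def
    by (rule M.finsum_cong') (use fD t r in \<open>auto simp: smult_assoc1[symmetric] R.m_comm\<close>)
  also have "\<dots> = r \<odot>\<^bsub>M\<^esub> lin_ext R M t f"
    unfolding lin_ext_def
    by (rule finsum_smult_ldistr[symmetric]) (use fD r t in auto)
  finally show ?thesis .
qed

text \<open>With a constant family the coefficients can be added up before acting. This is how a
  trivial action of a group becomes multiplication by the augmentation.\<close>

lemma lin_ext_const:
  assumes f: "f \<in> carrier (free_module R X)" and m: "m \<in> carrier M"
  shows "lin_ext R M (\<lambda>_. m) f = augmentation R f \<odot>\<^bsub>M\<^esub> m"
  unfolding lin_ext_def augmentation_def
  by (rule finsum_smult_rdistr) (use free_moduleD[OF f] m in auto)

end

lemma module_hom_lin_ext:
  assumes M: "module R M" and N: "module R N" and h: "h \<in> module_hom R M N"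
    and f: "f \<in> carrier (free_module R X)" and t: "\<And>x. x \<in> X \<Longrightarrow> t x \<in> carrier M"
  shows "h (lin_ext R M t f) = lin_ext R N (\<lambda>x. h (t x)) f"
proof -
  interpret M: module R M by fact
  interpret N: module R N by fact
  note fD = free_moduleD[OF f]
  have "h (lin_ext R M t f) = (\<Oplus>\<^bsub>N\<^esub>x\<in>{x. f x \<noteq> \<zero>\<^bsub>R\<^esub>}. h (f x \<odot>\<^bsub>M\<^esub> t x))"
    unfolding lin_ext_def
    by (rule module_hom_finsum[OF M N h fD(2)]) (use fD t in auto)
  also have "\<dots> = lin_ext R N (\<lambda>x. h (t x)) f"
    unfolding lin_ext_def
    by (rule N.finsum_cong')
      (use fD t in \<open>auto simp: module_hom_smult[OF h] module_hom_closed[OF h] subset_iff\<close>)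
  finally show ?thesis .
qed

context cring
begin

lemma lin_ext_basis_id:
  assumes f: "f \<in> carrier (free_module R X)"
  shows "lin_ext R (free_module R X) (basis_elt R) f = f"
proof
  fix y
  let ?F = "free_module R X"
  interpret F: module R ?F by (rule module_free_module)
  note fD = free_moduleD[OF f]
  \<comment> \<open>Addition in \<open>?F\<close> is pointwise, so evaluation at \<open>y\<close>
    turns the combination of basis elements into a sum in \<open>R\<close> whose only possibly
    nonzero term is the one at \<open>y\<close>.\<close>
  have eval: "finsum ?F t B y = (\<Oplus>x\<in>B. t x y)"
    if "finite B" "\<And>x. x \<in> B \<Longrightarrow> t x \<in> carrier ?F" for t :: "'c \<Rightarrow> 'c \<Rightarrow> 'a" and B
    using that
  proof (induction B)
    case empty
    show ?case by (simp add: free_module_simps)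
  next
    case (insert b B)
    have "t x y \<in> carrier R" if "x \<in> insert b B" for x
      using free_moduleD(1)[OF insert.prems[OF that]] .
    moreover have "finsum ?F t (insert b B) = t b \<oplus>\<^bsub>?F\<^esub> finsum ?F t B"
      by (rule F.finsum_insert) (use insert in auto)
    ultimately show ?case using insert by (simp add: Pi_def free_module_simps(3))
  qed
  have "lin_ext R ?F (basis_elt R) f y
      = (\<Oplus>x\<in>{x. f x \<noteq> \<zero>}. (f x \<odot>\<^bsub>?F\<^esub> basis_elt R x) y)"
    unfolding lin_ext_def
    by (rule eval) (use fD in \<open>auto intro!: F.smult_closed basis_elt_closed\<close>)
  also have "\<dots> = (\<Oplus>x\<in>{x. f x \<noteq> \<zero>}. if y = x then f x else \<zero>)"
    by (rule add.finprod_cong') (use fD in \<open>auto simp: basis_elt_def free_module_simps(4)\<close>)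
  also have "\<dots> = f y"
  proof (cases "f y = \<zero>")
    case True
    hence "(\<Oplus>x\<in>{x. f x \<noteq> \<zero>}. if y = x then f x else \<zero>) = (\<Oplus>x\<in>{x. f x \<noteq> \<zero>}. \<zero>)"
      by (intro add.finprod_cong') auto
    thus ?thesis using True by (simp add: finsum_zero)
  next
    case False
    thus ?thesis using add.finprod_singleton[of y "{x. f x \<noteq> \<zero>}" f] fD by (auto simp: eq_commute)
  qed
  finally show "lin_ext R ?F (basis_elt R) f y = f y" .
qed

text \<open>The uniqueness half of the universal property of a free module; \<open>lin_ext\<close>
  provides existence.\<close>

lemma module_hom_free_eqI:
  assumes M: "module R M" and h: "h \<in> module_hom R (free_module R X) M"
    and h': "h' \<in> module_hom R (free_module R X) M"
    and eq: "\<And>x. x \<in> X \<Longrightarrow> h (basis_elt R x) = h' (basis_elt R x)"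
    and f: "f \<in> carrier (free_module R X)"
  shows "h f = h' f"
proof -
  let ?F = "free_module R X"
  interpret M: module R M by fact
  have F: "module R ?F" by (rule module_free_module)
  have "h f = h (lin_ext R ?F (basis_elt R) f)" by (simp add: lin_ext_basis_id[OF f])
  also have "\<dots> = lin_ext R M (\<lambda>x. h (basis_elt R x)) f"
    by (rule module_hom_lin_ext[OF F M h f]) (rule basis_elt_closed)
  also have "\<dots> = lin_ext R M (\<lambda>x. h' (basis_elt R x)) f"
    by (rule M.lin_ext_cong[OF f]) (simp_all add: eq module_hom_closed[OF h'] basis_elt_closed)
  also have "\<dots> = h' (lin_ext R ?F (basis_elt R) f)"
    by (rule module_hom_lin_ext[OF F M h' f, symmetric]) (rule basis_elt_closed)
  finally show ?thesis by (simp add: lin_ext_basis_id[OF f])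
qed

end

section \<open>Quotients of modules\<close>

lemma quot_module_simps:
  "carrier (quot_module M N) = a_rcosets\<^bsub>M\<^esub> N"
  "\<zero>\<^bsub>quot_module M N\<^esub> = N"
  "c \<oplus>\<^bsub>quot_module M N\<^esub> d = c <+>\<^bsub>M\<^esub> d"
  "r \<odot>\<^bsub>quot_module M N\<^esub> c = N <+>\<^bsub>M\<^esub> ((\<lambda>x. r \<odot>\<^bsub>M\<^esub> x) ` c)"
  by (simp_all add: quot_module_def)

lemma submodule_abelian_subgroup:
  assumes "module R M" "submodule N R M"
  shows "abelian_subgroup N M"
proof -
  interpret module R M by fact
  show ?thesis
    by (rule abelian_subgroupI3[OF additive_subgroup.intro])
      (use submodule.axioms(1)[OF assms(2)] M.abelian_group_axioms in auto)
qed

text \<open>The image of the coset of \<open>x\<close> is in general only part of the coset of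
  \<open>f x\<close>. Adding \<open>N'\<close> in \<open>quot_map\<close> fills it up, and
  \<open>f N \<subseteq> N'\<close> keeps the result inside a single coset.\<close>

lemma quot_map_coset:
  assumes M: "module R M" and M': "module R M'" and N: "submodule N R M" and N': "submodule N' R M'"
    and f: "f \<in> module_hom R M M'" and fN: "f ` N \<subseteq> N'" and x: "x \<in> carrier M"
  shows "quot_map M' N' f (N +>\<^bsub>M\<^esub> x) = N' +>\<^bsub>M'\<^esub> f x"
proof -
  interpret M: module R M by fact
  interpret M': module R M' by fact
  interpret N: abelian_subgroup N M by (rule submodule_abelian_subgroup[OF M N])
  interpret N': abelian_subgroup N' M' by (rule submodule_abelian_subgroup[OF M' N'])
  have fx: "f x \<in> carrier M'" by (rule module_hom_closed[OF f x])
  have NM: "y \<in> N \<Longrightarrow> y \<in> carrier M" for y using N.a_subset by auto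
  have NM': "y \<in> N' \<Longrightarrow> y \<in> carrier M'" for y using N'.a_subset by auto
  have *: "f (a \<oplus>\<^bsub>M\<^esub> x) = f a \<oplus>\<^bsub>M'\<^esub> f x" if "a \<in> N" for a
    by (rule module_hom_add[OF f NM[OF that] x])
  show ?thesis
  proof
    show "quot_map M' N' f (N +>\<^bsub>M\<^esub> x) \<subseteq> N' +>\<^bsub>M'\<^esub> f x"
    proof
      fix z assume "z \<in> quot_map M' N' f (N +>\<^bsub>M\<^esub> x)"
      then obtain b a where ab: "b \<in> N'" "a \<in> N" "z = b \<oplus>\<^bsub>M'\<^esub> f (a \<oplus>\<^bsub>M\<^esub> x)"
        by (auto simp: quot_map_def set_add_def' a_r_coset_def')
      have fa: "f a \<in> N'" using fN ab(2) by auto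
      have "z = (b \<oplus>\<^bsub>M'\<^esub> f a) \<oplus>\<^bsub>M'\<^esub> f x"
        using ab fa fx by (simp add: * NM' M'.a_assoc)
      thus "z \<in> N' +>\<^bsub>M'\<^esub> f x" using ab(1) fa by (auto simp: a_r_coset_def')
    qed
    show "N' +>\<^bsub>M'\<^esub> f x \<subseteq> quot_map M' N' f (N +>\<^bsub>M\<^esub> x)"
    proof
      fix z assume "z \<in> N' +>\<^bsub>M'\<^esub> f x"
      then obtain b where b: "b \<in> N'" "z = b \<oplus>\<^bsub>M'\<^esub> f x" by (auto simp: a_r_coset_def')
      have "x \<in> N +>\<^bsub>M\<^esub> x" by (rule N.a_rcos_self[OF x])
      thus "z \<in> quot_map M' N' f (N +>\<^bsub>M\<^esub> x)"
        using b by (auto simp: quot_map_def set_add_def')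
    qed
  qed
qed

lemma module_hom_scale:
  assumes "module R M" "r \<in> carrier R"
  shows "(\<lambda>x. r \<odot>\<^bsub>M\<^esub> x) \<in> module_hom R M M"
proof -
  interpret module R M by fact
  show ?thesis
    by (rule module_homI)
      (use assms(2) in \<open>simp_all add: smult_r_distr smult_assoc1[symmetric] R.m_comm\<close>)
qed

locale module_quotient = module R M for R (structure) and M (structure) +
  fixes N
  assumes submodule: "submodule N R M"
begin

sublocale abelian_subgroup N M
  by (rule submodule_abelian_subgroup[OF module_axioms submodule])

lemma coset_closed: "x \<in> carrier M \<Longrightarrow> N +>\<^bsub>M\<^esub> x \<in> carrier (quot_module M N)"
  by (auto simp: quot_module_simps A_RCOSETS_def')

lemma quot_carrierE:
  assumes "c \<in> carrier (quot_module M N)"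
  obtains x where "x \<in> carrier M" "c = N +>\<^bsub>M\<^esub> x"
  using assms by (auto simp: quot_module_simps A_RCOSETS_def')

lemma coset_add:
  assumes "x \<in> carrier M" "y \<in> carrier M"
  shows "(N +>\<^bsub>M\<^esub> x) \<oplus>\<^bsub>quot_module M N\<^esub> (N +>\<^bsub>M\<^esub> y) = N +>\<^bsub>M\<^esub> (x \<oplus>\<^bsub>M\<^esub> y)"
  using assms by (simp add: quot_module_simps a_rcos_sum)

lemma coset_smult:
  assumes "r \<in> carrier R" "x \<in> carrier M"
  shows "r \<odot>\<^bsub>quot_module M N\<^esub> (N +>\<^bsub>M\<^esub> x) = N +>\<^bsub>M\<^esub> (r \<odot>\<^bsub>M\<^esub> x)"
  \<comment> \<open>Scalar multiplication on the quotient is literally the map induced by scaling on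
    \<open>M\<close>, which sends \<open>N\<close> into itself.\<close>
  unfolding quot_module_simps quot_map_def[symmetric]
  by (rule quot_map_coset[OF module_axioms module_axioms submodule submodule
        module_hom_scale[OF module_axioms assms(1)] _ assms(2)])
    (use submodule.smult_closed[OF submodule assms(1)] in auto)

lemma coset_zero: "N +>\<^bsub>M\<^esub> \<zero>\<^bsub>M\<^esub> = \<zero>\<^bsub>quot_module M N\<^esub>"
  using a_subset by (simp add: quot_module_simps a_coset_add_zero)

lemma module_quot_module: "module R (quot_module M N)"
proof (rule moduleI)
  let ?Q = "quot_module M N"
  show "cring R" by (rule R.cring_axioms)
  show "abelian_group ?Q"
  proof (rule abelian_groupI)
    show "\<zero>\<^bsub>?Q\<^esub> \<in> carrier ?Q" by (simp add: coset_zero[symmetric] coset_closed)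
    fix c assume c: "c \<in> carrier ?Q"
    then obtain x where x: "x \<in> carrier M" "c = N +>\<^bsub>M\<^esub> x" by (rule quot_carrierE)
    show "\<zero>\<^bsub>?Q\<^esub> \<oplus>\<^bsub>?Q\<^esub> c = c" using x by (simp add: coset_zero[symmetric] coset_add)
    show "\<exists>d\<in>carrier ?Q. d \<oplus>\<^bsub>?Q\<^esub> c = \<zero>\<^bsub>?Q\<^esub>"
      using x by (intro bexI[of _ "N +>\<^bsub>M\<^esub> (\<ominus>\<^bsub>M\<^esub> x)"])
        (simp_all add: coset_zero[symmetric] coset_add coset_closed l_neg)
    fix d assume d: "d \<in> carrier ?Q"
    then obtain y where y: "y \<in> carrier M" "d = N +>\<^bsub>M\<^esub> y" by (rule quot_carrierE)
    show "c \<oplus>\<^bsub>?Q\<^esub> d \<in> carrier ?Q" "c \<oplus>\<^bsub>?Q\<^esub> d = d \<oplus>\<^bsub>?Q\<^esub> c"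
      using x y by (simp_all add: coset_add coset_closed M.a_comm)
    fix e assume e: "e \<in> carrier ?Q"
    then obtain w where w: "w \<in> carrier M" "e = N +>\<^bsub>M\<^esub> w" by (rule quot_carrierE)
    show "c \<oplus>\<^bsub>?Q\<^esub> d \<oplus>\<^bsub>?Q\<^esub> e = c \<oplus>\<^bsub>?Q\<^esub> (d \<oplus>\<^bsub>?Q\<^esub> e)"
      using x y w by (simp add: coset_add M.a_assoc)
  qed
qed (auto elim!: quot_carrierE simp: coset_smult coset_add coset_closed
    smult_l_distr smult_r_distr smult_assoc1)

lemma coset_hom: "(\<lambda>x. N +>\<^bsub>M\<^esub> x) \<in> module_hom R M (quot_module M N)"
  by (rule module_homI) (simp_all add: coset_closed coset_add coset_smult)

lemma coset_eqI:
  assumes "x \<in> carrier M" "y \<in> carrier M" "x \<ominus>\<^bsub>M\<^esub> y \<in> N"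
  shows "N +>\<^bsub>M\<^esub> x = N +>\<^bsub>M\<^esub> y"
proof -
  have "x \<in> N +>\<^bsub>M\<^esub> y" using assms by (simp add: a_rcos_module a_minus_def)
  thus ?thesis by (rule a_repr_independence'[OF _ assms(2), symmetric])
qed

end

text \<open>No representative is chosen: when \<open>h\<close> vanishes on the submodule, it is
  constant on each coset, and the image is a singleton.\<close>

definition quot_lift :: "('m \<Rightarrow> 'p) \<Rightarrow> 'm set \<Rightarrow> 'p" where
  "quot_lift h c = the_elem (h ` c)"

context module_quotient
begin

lemma
  assumes P: "module R P" and h: "h \<in> module_hom R M P" and hN: "\<And>x. x \<in> N \<Longrightarrow> h x = \<zero>\<^bsub>P\<^esub>"
  shows quot_lift_coset: "x \<in> carrier M \<Longrightarrow> quot_lift h (N +>\<^bsub>M\<^esub> x) = h x"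
    and quot_lift_hom: "quot_lift h \<in> module_hom R (quot_module M N) P"
proof -
  interpret P: module R P by fact
  show *: "quot_lift h (N +>\<^bsub>M\<^esub> x) = h x" if x: "x \<in> carrier M" for x
  proof -
    have "h (a \<oplus>\<^bsub>M\<^esub> x) = h x" if "a \<in> N" for a
      using that x a_subset hN[OF that] module_hom_closed[OF h x]
      by (subst module_hom_add[OF h]) auto
    hence "h ` (N +>\<^bsub>M\<^esub> x) = {h x}" using a_rcos_self[OF x]
      by (auto simp: a_r_coset_def')
    thus ?thesis by (simp add: quot_lift_def)
  qed
  show "quot_lift h \<in> module_hom R (quot_module M N) P"
    by (rule module_homI; elim quot_carrierE)
      (simp_all add: * coset_add coset_smult module_hom_closed[OF h] module_hom_add[OF h]
        module_hom_smult[OF h])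
qed

end

lemma quot_map_hom:
  assumes M: "module R M" and M': "module R M'" and N: "submodule N R M" and N': "submodule N' R M'"
    and f: "f \<in> module_hom R M M'" and fN: "f ` N \<subseteq> N'"
  shows "quot_map M' N' f \<in> module_hom R (quot_module M N) (quot_module M' N')"
proof -
  interpret Q: module_quotient R M N using M N by (simp add: module_quotient_def module_quotient_axioms_def)
  interpret Q': module_quotient R M' N' using M' N' by (simp add: module_quotient_def module_quotient_axioms_def)
  note [simp] = quot_map_coset[OF M M' N N' f fN]
  show ?thesis
    by (rule module_homI; elim Q.quot_carrierE)
      (simp_all add: Q.coset_add Q.coset_smult Q'.coset_closed Q'.coset_add Q'.coset_smult
        module_hom_closed[OF f] module_hom_add[OF f] module_hom_smult[OF f])
qed

context module
begin

lemma submodule_gen_submodule: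
  assumes "X \<subseteq> carrier M"
  shows "submodule (submodule_gen R M X) R M"
proof (rule submoduleI)
  let ?S = "{H. submodule H R M \<and> X \<subseteq> H}"
  have car: "carrier M \<in> ?S" using carrier_is_submodule assms by simp
  show "submodule_gen R M X \<subseteq> carrier M" using car by (auto simp: submodule_gen_def)
  show "\<zero>\<^bsub>M\<^esub> \<in> submodule_gen R M X"
    using subgroup.one_closed[OF submodule.axioms(1)] by (fastforce simp: submodule_gen_def)
qed (auto simp: submodule_gen_def submoduleE(3-5))

lemma submodule_gen_incl: "X \<subseteq> submodule_gen R M X"
  by (auto simp: submodule_gen_def)

text \<open>The kernel of \<open>h\<close> is one of the submodules over which the intersection
  \<open>submodule_gen\<close> is taken.\<close>

lemma module_hom_zero_on_gen:
  assumes X: "X \<subseteq> carrier M" and P: "module R P" and h: "h \<in> module_hom R M P"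
    and hX: "\<And>x. x \<in> X \<Longrightarrow> h x = \<zero>\<^bsub>P\<^esub>" and x: "x \<in> submodule_gen R M X"
  shows "h x = \<zero>\<^bsub>P\<^esub>"
proof -
  have "submodule {x \<in> carrier M. h x = \<zero>\<^bsub>P\<^esub>} R M"
    by (rule module_hom_kernel_submodule[OF module_axioms P h])
  hence "submodule_gen R M X \<subseteq> {x \<in> carrier M. h x = \<zero>\<^bsub>P\<^esub>}"
    using X hX unfolding submodule_gen_def by (intro Inter_lower) auto
  thus ?thesis using x by auto
qed

end


section \<open>The universal property of the tensor product\<close>

text \<open>One condition for each of the four families of relations in \<open>tensor_rels\<close>.
  Like those relations, it asks for \<open>R\<close>-linearity in the left variable only; in the
  right variable this has to come from \<open>S\<close>-balancedness.\<close>

definition balanced ::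
  "('r, 'z) ring_scheme \<Rightarrow> 's set \<Rightarrow> ('r, 'm, 'x) module_scheme \<Rightarrow> ('m \<Rightarrow> 's \<Rightarrow> 'm) \<Rightarrow>
   ('r, 'n, 'y) module_scheme \<Rightarrow> ('s \<Rightarrow> 'n \<Rightarrow> 'n) \<Rightarrow> ('r, 'p, 'w) module_scheme \<Rightarrow> ('m \<Rightarrow> 'n \<Rightarrow> 'p) \<Rightarrow> bool"
  where
  "balanced R S M \<rho> N \<Lambda> P b \<longleftrightarrow>
     (\<forall>m\<in>carrier M. \<forall>n\<in>carrier N. b m n \<in> carrier P) \<and>
     (\<forall>m\<in>carrier M. \<forall>m'\<in>carrier M. \<forall>n\<in>carrier N. b (m \<oplus>\<^bsub>M\<^esub> m') n = b m n \<oplus>\<^bsub>P\<^esub> b m' n) \<and>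
     (\<forall>m\<in>carrier M. \<forall>n\<in>carrier N. \<forall>n'\<in>carrier N. b m (n \<oplus>\<^bsub>N\<^esub> n') = b m n \<oplus>\<^bsub>P\<^esub> b m n') \<and>
     (\<forall>m\<in>carrier M. \<forall>s\<in>S. \<forall>n\<in>carrier N. b (\<rho> m s) n = b m (\<Lambda> s n)) \<and>
     (\<forall>r\<in>carrier R. \<forall>m\<in>carrier M. \<forall>n\<in>carrier N. b (r \<odot>\<^bsub>M\<^esub> m) n = r \<odot>\<^bsub>P\<^esub> b m n)"

lemma balancedD:
  assumes "balanced R S M \<rho> N \<Lambda> P b"
  shows "m \<in> carrier M \<Longrightarrow> n \<in> carrier N \<Longrightarrow> b m n \<in> carrier P"
    "m \<in> carrier M \<Longrightarrow> m' \<in> carrier M \<Longrightarrow> n \<in> carrier N \<Longrightarrow> b (m \<oplus>\<^bsub>M\<^esub> m') n = b m n \<oplus>\<^bsub>P\<^esub> b m' n"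
    "m \<in> carrier M \<Longrightarrow> n \<in> carrier N \<Longrightarrow> n' \<in> carrier N \<Longrightarrow> b m (n \<oplus>\<^bsub>N\<^esub> n') = b m n \<oplus>\<^bsub>P\<^esub> b m n'"
    "m \<in> carrier M \<Longrightarrow> s \<in> S \<Longrightarrow> n \<in> carrier N \<Longrightarrow> b (\<rho> m s) n = b m (\<Lambda> s n)"
    "r \<in> carrier R \<Longrightarrow> m \<in> carrier M \<Longrightarrow> n \<in> carrier N \<Longrightarrow> b (r \<odot>\<^bsub>M\<^esub> m) n = r \<odot>\<^bsub>P\<^esub> b m n"
  using assms by (simp_all add: balanced_def)

definition pure_tensor ::
  "('r, 'z) ring_scheme \<Rightarrow> 's set \<Rightarrow> ('r, 'm) module \<Rightarrow> ('m \<Rightarrow> 's \<Rightarrow> 'm) \<Rightarrow>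
   ('r, 'n) module \<Rightarrow> ('s \<Rightarrow> 'n \<Rightarrow> 'n) \<Rightarrow> 'm \<Rightarrow> 'n \<Rightarrow> ('m \<times> 'n \<Rightarrow> 'r) set" where
  "pure_tensor R S M \<rho> N \<Lambda> m n =
     tensor_rels R S M \<rho> N \<Lambda> +>\<^bsub>free_module R (carrier M \<times> carrier N)\<^esub> basis_elt R (m, n)"

definition tensor_lift ::
  "('r, 'z) ring_scheme \<Rightarrow> ('r, 'p, 'w) module_scheme \<Rightarrow> ('m \<Rightarrow> 'n \<Rightarrow> 'p) \<Rightarrow> ('m \<times> 'n \<Rightarrow> 'r) set \<Rightarrow> 'p"
  where "tensor_lift R P b = quot_lift (lin_ext R P (\<lambda>(m, n). b m n))"

locale tensor_data = M: module R M + N: module R N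
  for R :: "('r, 'z) ring_scheme" and S :: "'s set" and M :: "('r, 'm) module" and \<rho>
    and N :: "('r, 'n) module" and \<Lambda> +
  assumes \<rho>_closed: "m \<in> carrier M \<Longrightarrow> s \<in> S \<Longrightarrow> \<rho> m s \<in> carrier M"
    and \<Lambda>_closed: "n \<in> carrier N \<Longrightarrow> s \<in> S \<Longrightarrow> \<Lambda> s n \<in> carrier N"
begin

abbreviation L where "L \<equiv> free_module R (carrier M \<times> carrier N)"
abbreviation rels where "rels \<equiv> tensor_rels R S M \<rho> N \<Lambda>"
abbreviation T where "T \<equiv> tensor_prod R S M \<rho> N \<Lambda>"
abbreviation pure where "pure \<equiv> pure_tensor R S M \<rho> N \<Lambda>"

text \<open>The generating set that stands anonymously inside \<open>tensor_rels\<close>, named so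
  that facts about generated submodules can be applied to it.\<close>

definition gens where
  "gens = (let e = (\<lambda>m n. basis_elt R (m, n)) in
      {e (m \<oplus>\<^bsub>M\<^esub> m') n \<ominus>\<^bsub>L\<^esub> (e m n \<oplus>\<^bsub>L\<^esub> e m' n) |m m' n.
          m \<in> carrier M \<and> m' \<in> carrier M \<and> n \<in> carrier N} \<union>
       {e m (n \<oplus>\<^bsub>N\<^esub> n') \<ominus>\<^bsub>L\<^esub> (e m n \<oplus>\<^bsub>L\<^esub> e m n') |m n n'.
          m \<in> carrier M \<and> n \<in> carrier N \<and> n' \<in> carrier N} \<union>
       {e (\<rho> m s) n \<ominus>\<^bsub>L\<^esub> e m (\<Lambda> s n) |m s n.
          m \<in> carrier M \<and> s \<in> S \<and> n \<in> carrier N} \<union>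
       {e (r \<odot>\<^bsub>M\<^esub> m) n \<ominus>\<^bsub>L\<^esub> (r \<odot>\<^bsub>L\<^esub> e m n) |r m n.
          r \<in> carrier R \<and> m \<in> carrier M \<and> n \<in> carrier N})"

lemma rels_eq: "rels = submodule_gen R L gens"
  by (simp add: tensor_rels_def gens_def Let_def)

sublocale L: module R L by (rule M.R.module_free_module)

lemma basis_closed: "m \<in> carrier M \<Longrightarrow> n \<in> carrier N \<Longrightarrow> basis_elt R (m, n) \<in> carrier L"
  by (rule M.R.basis_elt_closed) simp

lemma gens_closed: "gens \<subseteq> carrier L"
  unfolding gens_def Let_def
  by (auto intro!: L.minus_closed L.a_closed L.smult_closed basis_closed \<rho>_closed \<Lambda>_closed)

sublocale Q: module_quotient R L rels
  by (intro module_quotient.intro module_quotient_axioms.intro L.module_axioms)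
    (simp add: rels_eq L.submodule_gen_submodule[OF gens_closed])

lemma T_eq: "T = quot_module L rels"
  by (simp add: tensor_prod_def)

lemma module_T: "module R T"
  unfolding T_eq by (rule Q.module_quot_module)

lemma gens_rels: "x \<in> gens \<Longrightarrow> x \<in> rels"
  using L.submodule_gen_incl[of gens] by (auto simp: rels_eq)

lemma balanced_pure: "balanced R S M \<rho> N \<Lambda> T pure"
  unfolding balanced_def pure_tensor_def T_eq
proof (intro conjI ballI)
  fix m m' n n' s r
  show "rels +>\<^bsub>L\<^esub> basis_elt R (m, n) \<in> carrier (quot_module L rels)"
    if "m \<in> carrier M" "n \<in> carrier N"
    using that by (simp add: Q.coset_closed basis_closed)
  show "rels +>\<^bsub>L\<^esub> basis_elt R (m \<oplus>\<^bsub>M\<^esub> m', n) =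
    (rels +>\<^bsub>L\<^esub> basis_elt R (m, n)) \<oplus>\<^bsub>quot_module L rels\<^esub> (rels +>\<^bsub>L\<^esub> basis_elt R (m', n))"
    if "m \<in> carrier M" "m' \<in> carrier M" "n \<in> carrier N"
    using that
    by (subst Q.coset_add, simp_all add: basis_closed)
      (rule Q.coset_eqI, simp_all add: basis_closed, rule gens_rels, unfold gens_def Let_def, blast)
  show "rels +>\<^bsub>L\<^esub> basis_elt R (m, n \<oplus>\<^bsub>N\<^esub> n') =
    (rels +>\<^bsub>L\<^esub> basis_elt R (m, n)) \<oplus>\<^bsub>quot_module L rels\<^esub> (rels +>\<^bsub>L\<^esub> basis_elt R (m, n'))"
    if "m \<in> carrier M" "n \<in> carrier N" "n' \<in> carrier N"
    using that
    by (subst Q.coset_add, simp_all add: basis_closed)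
      (rule Q.coset_eqI, simp_all add: basis_closed, rule gens_rels, unfold gens_def Let_def, blast)
  show "rels +>\<^bsub>L\<^esub> basis_elt R (\<rho> m s, n) = rels +>\<^bsub>L\<^esub> basis_elt R (m, \<Lambda> s n)"
    if "m \<in> carrier M" "s \<in> S" "n \<in> carrier N"
    using that
    by (intro Q.coset_eqI gens_rels)
      (simp_all add: basis_closed \<rho>_closed \<Lambda>_closed, unfold gens_def Let_def, blast)
  show "rels +>\<^bsub>L\<^esub> basis_elt R (r \<odot>\<^bsub>M\<^esub> m, n) =
    r \<odot>\<^bsub>quot_module L rels\<^esub> (rels +>\<^bsub>L\<^esub> basis_elt R (m, n))"
    if "r \<in> carrier R" "m \<in> carrier M" "n \<in> carrier N"
    using that
    by (subst Q.coset_smult, simp_all add: basis_closed)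
      (rule Q.coset_eqI, simp_all add: basis_closed, rule gens_rels, unfold gens_def Let_def, blast)
qed

lemmas pure_closed = balancedD(1)[OF balanced_pure]
  and pure_add_left = balancedD(2)[OF balanced_pure]
  and pure_add_right = balancedD(3)[OF balanced_pure]
  and pure_balanced = balancedD(4)[OF balanced_pure]
  and pure_smult = balancedD(5)[OF balanced_pure]

lemma pure_hom_left: "n \<in> carrier N \<Longrightarrow> (\<lambda>m. pure m n) \<in> module_hom R M T"
  by (rule module_homI) (simp_all add: pure_closed pure_add_left pure_smult)

text \<open>On a generator of the relations the linear extension of \<open>b\<close> takes the
  difference of the two sides of one condition in \<open>balanced\<close>, so it vanishes there and
  hence on all relations.\<close>

lemma
  assumes P: "module R P" and b: "balanced R S M \<rho> N \<Lambda> P b"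
  shows lin_ext_balanced_hom: "lin_ext R P (\<lambda>(m, n). b m n) \<in> module_hom R L P"
    and lin_ext_balanced_basis: "m \<in> carrier M \<Longrightarrow> n \<in> carrier N \<Longrightarrow>
      lin_ext R P (\<lambda>(m, n). b m n) (basis_elt R (m, n)) = b m n"
    and lin_ext_balanced_rels: "x \<in> rels \<Longrightarrow> lin_ext R P (\<lambda>(m, n). b m n) x = \<zero>\<^bsub>P\<^esub>"
proof -
  interpret P: module R P by fact
  note bD = balancedD[OF b]
  let ?h = "lin_ext R P (\<lambda>(m, n). b m n)"
  show hom: "?h \<in> module_hom R L P" by (rule P.lin_ext_hom) (auto simp: bD)
  have *: "?h (basis_elt R (m, n)) = b m n" if "m \<in> carrier M" "n \<in> carrier N" for m n
    using that P.lin_ext_basis[of "\<lambda>(m, n). b m n" "(m, n)"] by (simp add: bD)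
  thus "m \<in> carrier M \<Longrightarrow> n \<in> carrier N \<Longrightarrow> ?h (basis_elt R (m, n)) = b m n" .
  have diff: "?h (x \<ominus>\<^bsub>L\<^esub> y) = ?h x \<ominus>\<^bsub>P\<^esub> ?h y" if "x \<in> carrier L" "y \<in> carrier L" for x y
    by (rule module_hom_diff[OF L.module_axioms P hom that])
  have "y \<ominus>\<^bsub>P\<^esub> y = \<zero>\<^bsub>P\<^esub>" if "y \<in> carrier P" for y
    using that by (simp add: a_minus_def P.r_neg)
  hence "?h x = \<zero>\<^bsub>P\<^esub>" if "x \<in> gens" for x
    using that unfolding gens_def Let_def
    by (auto simp: diff basis_closed module_hom_add[OF hom] module_hom_smult[OF hom] *
        \<rho>_closed \<Lambda>_closed bD)
  thus "x \<in> rels \<Longrightarrow> ?h x = \<zero>\<^bsub>P\<^esub>"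
    using L.module_hom_zero_on_gen[OF gens_closed P hom] by (simp add: rels_eq)
qed

lemma
  assumes P: "module R P" and b: "balanced R S M \<rho> N \<Lambda> P b"
  shows tensor_lift_hom: "tensor_lift R P b \<in> module_hom R T P"
    and tensor_lift_pure: "m \<in> carrier M \<Longrightarrow> n \<in> carrier N \<Longrightarrow> tensor_lift R P b (pure m n) = b m n"
proof -
  note 1 = lin_ext_balanced_hom[OF P b] lin_ext_balanced_rels[OF P b]
  show "tensor_lift R P b \<in> module_hom R T P"
    unfolding tensor_lift_def T_eq by (rule Q.quot_lift_hom[OF P 1])
  have "x \<in> carrier L \<Longrightarrow> tensor_lift R P b (rels +>\<^bsub>L\<^esub> x) = lin_ext R P (\<lambda>(m, n). b m n) x" for x
    unfolding tensor_lift_def by (rule Q.quot_lift_coset[OF P 1])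
  thus "m \<in> carrier M \<Longrightarrow> n \<in> carrier N \<Longrightarrow> tensor_lift R P b (pure m n) = b m n"
    by (simp add: pure_tensor_def basis_closed lin_ext_balanced_basis[OF P b])
qed

text \<open>The uniqueness half of the universal property of the tensor product,
  \<open>tensor_lift\<close> being the existence half: cosets of basis elements are pure tensors,
  and the basis elements determine a map from \<open>L\<close>.\<close>

lemma tensor_hom_eqI:
  assumes P: "module R P" and h: "h \<in> module_hom R T P" and h': "h' \<in> module_hom R T P"
    and eq: "\<And>m n. m \<in> carrier M \<Longrightarrow> n \<in> carrier N \<Longrightarrow> h (pure m n) = h' (pure m n)"
    and x: "x \<in> carrier T"
  shows "h x = h' x"
proof -
  obtain c where c: "c \<in> carrier L" "x = rels +>\<^bsub>L\<^esub> c"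
    using x unfolding T_eq by (rule Q.quot_carrierE)
  have "h (rels +>\<^bsub>L\<^esub> c) = h' (rels +>\<^bsub>L\<^esub> c)"
    by (rule M.R.module_hom_free_eqI[where X = "carrier M \<times> carrier N", OF P _ _ _ c(1)])
      (use module_hom_compose[OF Q.coset_hom] h h' eq in \<open>auto simp: T_eq pure_tensor_def\<close>)
  thus ?thesis using c(2) by simp
qed

end

text \<open>The two tensor products may be over different rings, and \<open>f\<close> and
  \<open>g\<close> are semilinear along \<open>\<sigma>\<close>. In the applications
  \<open>\<sigma>\<close> is the map of group rings induced by a group homomorphism, or the identity
  of \<open>R\<close>.\<close>

locale tensor_data_map =
  A: tensor_data R S M \<rho> N \<Lambda> + B: tensor_data R S' M' \<rho>' N' \<Lambda>'
  for R :: "('r, 'z) ring_scheme"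
    and S :: "'s set" and M :: "('r, 'm) module" and \<rho> and N :: "('r, 'n) module" and \<Lambda>
    and S' :: "'t set" and M' :: "('r, 'k) module" and \<rho>' and N' :: "('r, 'l) module" and \<Lambda>' +
  fixes f g \<sigma>
  assumes f_hom: "f \<in> module_hom R M M'" and g_hom: "g \<in> module_hom R N N'"
    and \<sigma>_closed: "s \<in> S \<Longrightarrow> \<sigma> s \<in> S'"
    and f_compat: "m \<in> carrier M \<Longrightarrow> s \<in> S \<Longrightarrow> f (\<rho> m s) = \<rho>' (f m) (\<sigma> s)"
    and g_compat: "n \<in> carrier N \<Longrightarrow> s \<in> S \<Longrightarrow> g (\<Lambda> s n) = \<Lambda>' (\<sigma> s) (g n)"
begin

abbreviation tmap where "tmap \<equiv> tensor_map R S' M' \<rho>' N' \<Lambda>' f g"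

lemma balanced_map: "balanced R S M \<rho> N \<Lambda> B.T (\<lambda>m n. B.pure (f m) (g n))"
  unfolding balanced_def
  by (auto simp: module_hom_closed[OF f_hom] module_hom_closed[OF g_hom] module_hom_add[OF f_hom]
      module_hom_add[OF g_hom] module_hom_smult[OF f_hom] f_compat g_compat \<sigma>_closed
      B.pure_closed B.pure_add_left B.pure_add_right B.pure_balanced B.pure_smult)

text \<open>That relations go to relations follows from the universal property: followed by the
  projection to \<open>B.T\<close>, the map on free modules is the linear extension of the balanced
  map \<open>(m, n) \<mapsto> f m \<otimes> g n\<close>, already known to kill
  \<open>A.rels\<close>.\<close>

lemma
  shows tensor_map_hom: "tmap \<in> module_hom R A.T B.T"
    and tensor_map_pure: "m \<in> carrier M \<Longrightarrow> n \<in> carrier N \<Longrightarrow> tmap (A.pure m n) = B.pure (f m) (g n)"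
proof -
  let ?t = "\<lambda>(m, n). basis_elt R (f m, g n)"
  let ?h = "lin_ext R B.L ?t"
  have t: "?t x \<in> carrier B.L" if "x \<in> carrier M \<times> carrier N" for x
    using that by (auto simp: B.basis_closed module_hom_closed[OF f_hom] module_hom_closed[OF g_hom])
  have h: "?h \<in> module_hom R A.L B.L" by (rule B.L.lin_ext_hom[OF t])
  have cos: "(\<lambda>x. B.rels +>\<^bsub>B.L\<^esub> x) \<in> module_hom R B.L B.T"
    unfolding B.T_eq by (rule B.Q.coset_hom)
  have "B.rels +>\<^bsub>B.L\<^esub> ?h x = lin_ext R B.T (\<lambda>(m, n). B.pure (f m) (g n)) x" if "x \<in> carrier A.L" for x
    by (subst module_hom_lin_ext[OF B.L.module_axioms B.module_T cos that t])
      (simp_all add: case_prod_unfold pure_tensor_def)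
  hence "B.rels +>\<^bsub>B.L\<^esub> ?h x = \<zero>\<^bsub>B.T\<^esub>" if "x \<in> A.rels" for x
    using A.lin_ext_balanced_rels[OF B.module_T balanced_map that] that A.Q.a_subset by auto
  \<comment> \<open>The zero of \<open>B.T\<close> is the coset \<open>B.rels\<close> itself, and
    \<open>?h x\<close> lies in its own coset.\<close>
  hence rels: "?h ` A.rels \<subseteq> B.rels"
    using A.Q.a_subset module_hom_closed[OF h] B.Q.a_rcos_self
    by (force simp: B.T_eq quot_module_simps)
  have eq: "tmap = quot_map B.L B.rels ?h" by (simp add: tensor_map_def fun_eq_iff Let_def)
  show "tmap \<in> module_hom R A.T B.T"
    unfolding eq A.T_eq B.T_eq
    by (rule quot_map_hom[OF A.L.module_axioms B.L.module_axioms A.Q.submodule B.Q.submodule h rels])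
  show "tmap (A.pure m n) = B.pure (f m) (g n)" if "m \<in> carrier M" "n \<in> carrier N"
    unfolding eq pure_tensor_def
    by (subst quot_map_coset[OF A.L.module_axioms B.L.module_axioms A.Q.submodule B.Q.submodule h rels])
      (use that t[of "(m, n)"] B.L.lin_ext_basis[of ?t "(m, n)"] in \<open>simp_all add: A.basis_closed\<close>)
qed

end

section \<open>Group rings and augmentation ideals\<close>

text \<open>\<open>R\<close> as a module over itself, so that the augmentation is a module homomorphism.\<close>

definition regular_module :: "('r, 'z) ring_scheme \<Rightarrow> ('r, 'r) module" where
  "regular_module R = \<lparr>carrier = carrier R, mult = undefined, one = undefined,
     zero = \<zero>\<^bsub>R\<^esub>, add = add R, smult = mult R\<rparr>"

lemma regular_module_simps:
  "carrier (regular_module R) = carrier R"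
  "\<zero>\<^bsub>regular_module R\<^esub> = \<zero>\<^bsub>R\<^esub>"
  "x \<oplus>\<^bsub>regular_module R\<^esub> y = x \<oplus>\<^bsub>R\<^esub> y"
  "r \<odot>\<^bsub>regular_module R\<^esub> x = r \<otimes>\<^bsub>R\<^esub> x"
  by (simp_all add: regular_module_def)

lemma (in cring) module_regular_module: "module R (regular_module R)"
proof (rule moduleI)
  show "abelian_group (regular_module R)"
    by (rule abelian_groupI)
      (auto simp: regular_module_simps a_ac intro: bexI[of _ "\<ominus> _"] l_neg)
qed (auto simp: regular_module_simps l_distr r_distr m_assoc cring_axioms)

locale cring_group = R: cring R + K: group K
  for R :: "('r, 'z) ring_scheme" and K :: "'g monoid"
begin

abbreviation RK where "RK \<equiv> free_module R (carrier K)"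
abbreviation I where "I \<equiv> aug_ideal R K"
abbreviation basis where "basis \<equiv> basis_elt R"
abbreviation gmult where "gmult \<equiv> mult (group_ring R K)"

sublocale RK: module R RK by (rule R.module_free_module)
sublocale reg: module R "regular_module R" by (rule R.module_regular_module)

lemma group_ring_simps:
  "carrier (group_ring R K) = carrier RK"
  "gmult = (\<lambda>x y. lin_ext R RK (\<lambda>g. lin_ext R RK (\<lambda>h. basis (g \<otimes>\<^bsub>K\<^esub> h)) y) x)"
  by (simp_all add: group_ring_def)

lemma augmentation_eq_lin_ext:
  assumes "x \<in> carrier RK"
  shows "augmentation R x = lin_ext R (regular_module R) (\<lambda>_. \<one>\<^bsub>R\<^esub>) x"
  using reg.lin_ext_const[OF assms, of "\<one>\<^bsub>R\<^esub>"] free_moduleD[OF assms]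
  by (simp add: regular_module_simps augmentation_def R.finsum_closed)

lemma augmentation_hom: "augmentation R \<in> module_hom R RK (regular_module R)"
proof -
  have hom: "lin_ext R (regular_module R) (\<lambda>_. \<one>\<^bsub>R\<^esub>) \<in> module_hom R RK (regular_module R)"
    by (rule reg.lin_ext_hom) (simp add: regular_module_simps)
  show ?thesis
    by (rule module_homI)
      (simp_all add: augmentation_eq_lin_ext module_hom_closed[OF hom] module_hom_add[OF hom]
        module_hom_smult[OF hom])
qed

lemma augmentation_closed: "x \<in> carrier RK \<Longrightarrow> augmentation R x \<in> carrier R"
  using module_hom_closed[OF augmentation_hom] by (simp add: regular_module_simps)

lemma augmentation_basis: "g \<in> carrier K \<Longrightarrow> augmentation R (basis g) = \<one>\<^bsub>R\<^esub>"
  by (simp add: augmentation_eq_lin_ext R.basis_elt_closed reg.lin_ext_basis regular_module_simps)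

text \<open>Convolution is a nested pair of linear extensions. Applied to each of them, with
  \<open>a\<close> equal to \<open>\<one>\<close> inside and to the augmentation of the right factor
  outside, this makes the augmentation multiplicative.\<close>

lemma augmentation_lin_ext:
  assumes "x \<in> carrier RK" "\<And>g. g \<in> carrier K \<Longrightarrow> t g \<in> carrier RK"
    and "\<And>g. g \<in> carrier K \<Longrightarrow> augmentation R (t g) = a" and a: "a \<in> carrier R"
  shows "augmentation R (lin_ext R RK t x) = augmentation R x \<otimes>\<^bsub>R\<^esub> a"
proof -
  have "augmentation R (lin_ext R RK t x) = lin_ext R (regular_module R) (\<lambda>g. augmentation R (t g)) x"
    by (rule module_hom_lin_ext[OF RK.module_axioms reg.module_axioms augmentation_hom]) fact+
  also have "\<dots> = lin_ext R (regular_module R) (\<lambda>_. a) x"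
    by (rule reg.lin_ext_cong[OF assms(1)]) (use assms in \<open>simp_all add: regular_module_simps\<close>)
  also have "\<dots> = augmentation R x \<otimes>\<^bsub>R\<^esub> a"
    using reg.lin_ext_const[OF assms(1), of a] a by (simp add: regular_module_simps)
  finally show ?thesis .
qed

lemma aug_ideal_eq: "I = (group_ring R K)\<lparr>carrier := {x \<in> carrier RK. augmentation R x = \<zero>\<^bsub>R\<^esub>}\<rparr>"
  by (simp add: aug_ideal_def group_ring_simps)

lemma aug_ideal_simps:
  "carrier I = {x \<in> carrier RK. augmentation R x = \<zero>\<^bsub>R\<^esub>}"
  "\<zero>\<^bsub>I\<^esub> = \<zero>\<^bsub>RK\<^esub>"
  "x \<oplus>\<^bsub>I\<^esub> y = x \<oplus>\<^bsub>RK\<^esub> y"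
  "r \<odot>\<^bsub>I\<^esub> x = r \<odot>\<^bsub>RK\<^esub> x"
  by (simp_all add: aug_ideal_eq group_ring_def)

lemma module_aug_ideal: "module R I"
proof -
  have sub: "submodule {x \<in> carrier RK. augmentation R x = \<zero>\<^bsub>R\<^esub>} R RK"
    using module_hom_kernel_submodule[OF RK.module_axioms reg.module_axioms augmentation_hom]
    by (simp add: regular_module_simps)
  have "module R (RK\<lparr>carrier := {x \<in> carrier RK. augmentation R x = \<zero>\<^bsub>R\<^esub>}\<rparr>)"
    by (rule submodule.submodule_is_module[OF sub RK.module_axioms])
  \<comment> \<open>The record \<open>I\<close> and the restricted free module agree in carrier,
    zero, addition and scalar multiplication, and these determine whether the module axioms
    hold.\<close>
  moreover have "add I = add RK" by (simp add: aug_ideal_simps fun_eq_iff)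
  ultimately show ?thesis
    unfolding module_def module_axioms_def abelian_group_def abelian_group_axioms_def abelian_monoid_def
    by (simp add: aug_ideal_simps)
qed

sublocale I: module R I by (rule module_aug_ideal)

lemma lin_ext_basis_mult_closed:
  assumes "g \<in> carrier K" "y \<in> carrier RK"
  shows "lin_ext R RK (\<lambda>h. basis (g \<otimes>\<^bsub>K\<^esub> h)) y \<in> carrier RK"
  using assms by (intro RK.lin_ext_closed[OF assms(2)] R.basis_elt_closed) auto

lemma gmult_closed:
  assumes "x \<in> carrier RK" "y \<in> carrier RK"
  shows "gmult x y \<in> carrier RK"
  unfolding group_ring_simps
  by (rule RK.lin_ext_closed[OF assms(1)]) (rule lin_ext_basis_mult_closed[OF _ assms(2)])

lemma augmentation_gmult:
  assumes "x \<in> carrier RK" "y \<in> carrier RK"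
  shows "augmentation R (gmult x y) = augmentation R x \<otimes>\<^bsub>R\<^esub> augmentation R y"
  unfolding group_ring_simps
proof (rule augmentation_lin_ext[OF assms(1) lin_ext_basis_mult_closed[OF _ assms(2)] _
      augmentation_closed[OF assms(2)]])
  fix g assume g: "g \<in> carrier K"
  have "augmentation R (lin_ext R RK (\<lambda>h. basis (g \<otimes>\<^bsub>K\<^esub> h)) y) = augmentation R y \<otimes>\<^bsub>R\<^esub> \<one>\<^bsub>R\<^esub>"
    by (rule augmentation_lin_ext[OF assms(2)])
      (use g in \<open>simp_all add: R.basis_elt_closed augmentation_basis\<close>)
  thus "augmentation R (lin_ext R RK (\<lambda>h. basis (g \<otimes>\<^bsub>K\<^esub> h)) y) = augmentation R y"
    using augmentation_closed[OF assms(2)] by simp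
qed

lemma aug_ideal_gmult_closed: "x \<in> carrier I \<Longrightarrow> y \<in> carrier RK \<Longrightarrow> gmult x y \<in> carrier I"
  by (simp add: aug_ideal_simps gmult_closed augmentation_gmult augmentation_closed)

definition \<delta> where "\<delta> g = basis g \<ominus>\<^bsub>RK\<^esub> basis \<one>\<^bsub>K\<^esub>"

lemma \<delta>_closed: "g \<in> carrier K \<Longrightarrow> \<delta> g \<in> carrier I"
  using module_hom_diff[OF RK.module_axioms reg.module_axioms augmentation_hom, of "basis g" "basis \<one>\<^bsub>K\<^esub>"]
    reg.r_neg[of "\<one>\<^bsub>R\<^esub>"]
  by (simp add: aug_ideal_simps \<delta>_def R.basis_elt_closed augmentation_basis regular_module_simps
      a_minus_def)

text \<open>So \<open>\<delta>\<close> is a crossed homomorphism for right multiplication. Where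
  \<open>h\<close> acts trivially it becomes additive, which is exactly the relation defining first
  homology.\<close>

lemma \<delta>_mult:
  assumes g: "g \<in> carrier K" and h: "h \<in> carrier K"
  shows "\<delta> (g \<otimes>\<^bsub>K\<^esub> h) = gmult (\<delta> g) (basis h) \<oplus>\<^bsub>I\<^esub> \<delta> h"
proof -
  let ?t = "\<lambda>k. basis (k \<otimes>\<^bsub>K\<^esub> h)"
  have t: "k \<in> carrier K \<Longrightarrow> ?t k \<in> carrier RK" for k using h by (simp add: R.basis_elt_closed)
  have \<delta>: "\<delta> g \<in> carrier RK" using \<delta>_closed[OF g] by (simp add: aug_ideal_simps)
  have "gmult (\<delta> g) (basis h) = lin_ext R RK ?t (\<delta> g)"
    unfolding group_ring_simps
    by (rule RK.lin_ext_cong[OF \<delta>]) (use h in \<open>simp_all add: RK.lin_ext_basis t R.basis_elt_closed\<close>)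
  also have "\<dots> = lin_ext R RK ?t (basis g) \<ominus>\<^bsub>RK\<^esub> lin_ext R RK ?t (basis \<one>\<^bsub>K\<^esub>)"
    unfolding \<delta>_def
    by (rule module_hom_diff[OF RK.module_axioms RK.module_axioms RK.lin_ext_hom[OF t]])
      (simp_all add: R.basis_elt_closed g)
  also have "\<dots> = basis (g \<otimes>\<^bsub>K\<^esub> h) \<ominus>\<^bsub>RK\<^esub> basis h"
    using g h by (simp add: RK.lin_ext_basis R.basis_elt_closed)
  finally show ?thesis
    using g h RK.r_neg1[of "basis h" "\<ominus>\<^bsub>RK\<^esub> basis \<one>\<^bsub>K\<^esub>"]
    by (simp add: aug_ideal_simps \<delta>_def a_minus_def RK.a_assoc R.basis_elt_closed)
qed

end

locale cring_group_hom = A: cring_group R K + B: cring_group R K'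
  for R :: "('r, 'z) ring_scheme" and K :: "'g monoid" and K' :: "'h monoid" +
  fixes f assumes f_hom: "f \<in> hom K K'"
begin

lemma f_closed: "g \<in> carrier K \<Longrightarrow> f g \<in> carrier K'"
  using f_hom by (auto simp: hom_def)

lemma f_mult: "g \<in> carrier K \<Longrightarrow> h \<in> carrier K \<Longrightarrow> f (g \<otimes>\<^bsub>K\<^esub> h) = f g \<otimes>\<^bsub>K'\<^esub> f h"
  using f_hom by (auto simp: hom_def)

abbreviation F where "F \<equiv> group_ring_map R K' f"

lemma F_eq: "F = lin_ext R B.RK (\<lambda>g. B.basis (f g))"
proof -
  \<comment> \<open>\<open>lin_ext\<close> depends on its target only through the additive and
    scalar structure, which the group ring shares with its underlying free module.\<close>
  have "lin_ext R (group_ring R K') t x = lin_ext R B.RK t x" for t :: "'g \<Rightarrow> _" and x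
    by (simp add: lin_ext_def group_ring_def finsum_def finprod_def)
  thus ?thesis by (simp add: group_ring_map_def fun_eq_iff)
qed

lemma basis_f_closed: "g \<in> carrier K \<Longrightarrow> B.basis (f g) \<in> carrier B.RK"
  by (simp add: A.R.basis_elt_closed f_closed)

lemma F_hom: "F \<in> module_hom R A.RK B.RK"
  unfolding F_eq by (rule B.RK.lin_ext_hom) (rule basis_f_closed)

lemma F_basis: "g \<in> carrier K \<Longrightarrow> F (A.basis g) = B.basis (f g)"
  unfolding F_eq by (rule B.RK.lin_ext_basis) (rule basis_f_closed)

lemma augmentation_F:
  assumes "x \<in> carrier A.RK"
  shows "augmentation R (F x) = augmentation R x"
proof (rule A.R.module_hom_free_eqI[OF A.reg.module_axioms _ A.augmentation_hom _ assms])
  show "(\<lambda>x. augmentation R (F x)) \<in> module_hom R A.RK (regular_module R)"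
    by (rule module_hom_compose[OF F_hom B.augmentation_hom])
qed (simp add: F_basis A.augmentation_basis B.augmentation_basis f_closed)

lemma F_hom_aug: "F \<in> module_hom R A.I B.I"
  by (rule module_homI)
    (simp_all add: A.aug_ideal_simps B.aug_ideal_simps module_hom_closed[OF F_hom]
      module_hom_add[OF F_hom] module_hom_smult[OF F_hom] augmentation_F)

text \<open>\<open>F\<close> is moved through the two nested linear extensions of the convolution
  product, one at a time, until only the product of two group elements is left, where
  \<open>f_mult\<close> applies.\<close>

lemma F_gmult:
  assumes x: "x \<in> carrier A.RK" and y: "y \<in> carrier A.RK"
  shows "F (A.gmult x y) = B.gmult (F x) (F y)"
proof -
  note M = A.RK.module_axioms B.RK.module_axioms
  have inner: "lin_ext R B.RK (\<lambda>h. B.basis (f g \<otimes>\<^bsub>K'\<^esub> h)) (F y) =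
      F (lin_ext R A.RK (\<lambda>h. A.basis (g \<otimes>\<^bsub>K\<^esub> h)) y)" if g: "g \<in> carrier K" for g
  proof -
    have t: "h \<in> carrier K' \<Longrightarrow> B.basis (f g \<otimes>\<^bsub>K'\<^esub> h) \<in> carrier B.RK" for h
      using g by (simp add: A.R.basis_elt_closed f_closed)
    have "lin_ext R B.RK (\<lambda>h. B.basis (f g \<otimes>\<^bsub>K'\<^esub> h)) (F y) =
      lin_ext R B.RK (\<lambda>h. lin_ext R B.RK (\<lambda>h. B.basis (f g \<otimes>\<^bsub>K'\<^esub> h)) (B.basis (f h))) y"
      unfolding F_eq
      by (rule module_hom_lin_ext[OF M(2,2) B.RK.lin_ext_hom[OF t] y basis_f_closed])
    also have "\<dots> = lin_ext R B.RK (\<lambda>h. F (A.basis (g \<otimes>\<^bsub>K\<^esub> h))) y"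
      by (rule B.RK.lin_ext_cong[OF y])
        (use g in \<open>simp_all add: B.RK.lin_ext_basis t f_closed F_basis f_mult A.R.basis_elt_closed\<close>)
    also have "\<dots> = F (lin_ext R A.RK (\<lambda>h. A.basis (g \<otimes>\<^bsub>K\<^esub> h)) y)"
      by (rule module_hom_lin_ext[OF M F_hom y, symmetric]) (use g in \<open>simp add: A.R.basis_elt_closed\<close>)
    finally show ?thesis .
  qed
  have Fy: "F y \<in> carrier B.RK" by (rule module_hom_closed[OF F_hom y])
  let ?t = "\<lambda>g. lin_ext R B.RK (\<lambda>h. B.basis (g \<otimes>\<^bsub>K'\<^esub> h)) (F y)"
  have t: "g \<in> carrier K' \<Longrightarrow> ?t g \<in> carrier B.RK" for g by (rule B.lin_ext_basis_mult_closed[OF _ Fy])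
  have "B.gmult (F x) (F y) = lin_ext R B.RK ?t (lin_ext R B.RK (\<lambda>g. B.basis (f g)) x)"
    unfolding B.group_ring_simps by (simp add: F_eq)
  also have "\<dots> = lin_ext R B.RK (\<lambda>g. lin_ext R B.RK ?t (B.basis (f g))) x"
    by (rule module_hom_lin_ext[OF M(2,2) B.RK.lin_ext_hom[OF t] x basis_f_closed])
  also have "\<dots> = lin_ext R B.RK (\<lambda>g. F (lin_ext R A.RK (\<lambda>h. A.basis (g \<otimes>\<^bsub>K\<^esub> h)) y)) x"
    by (rule B.RK.lin_ext_cong[OF x])
      (simp_all add: B.RK.lin_ext_basis t f_closed inner module_hom_closed[OF F_hom]
        A.lin_ext_basis_mult_closed y)
  also have "\<dots> = F (A.gmult x y)"
    unfolding A.group_ring_simps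
    by (rule module_hom_lin_ext[OF M F_hom x, symmetric]) (rule A.lin_ext_basis_mult_closed[OF _ y])
  finally show ?thesis by simp
qed

end

section \<open>The first homology group\<close>

context cring_group
begin

declare One_nat_def [simp del]

abbreviation "bar n \<equiv> bar_module R K n"

lemma bar_eq: "bar n = free_module R {gs. length gs = n \<and> set gs \<subseteq> carrier K}"
  by (simp add: bar_module_def)

lemma module_bar: "module R (bar n)"
  unfolding bar_eq by (rule R.module_free_module)

lemma bar_basis_closed: "length gs = n \<Longrightarrow> set gs \<subseteq> carrier K \<Longrightarrow> basis gs \<in> carrier (bar n)"
  unfolding bar_eq by (rule R.basis_elt_closed) simp

lemma bar_face_closed:
  assumes "length gs = Suc n" "set gs \<subseteq> carrier K" "i \<le> Suc n"
  shows "length (bar_face K i gs) = n" "set (bar_face K i gs) \<subseteq> carrier K"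
proof -
  consider "i = 0" | "0 < i" "i < Suc n" | "i = Suc n" using assms(3) by linarith
  note cs = this
  show "length (bar_face K i gs) = n"
    using cs by cases (use assms in \<open>auto simp: bar_face_def\<close>)
  show "set (bar_face K i gs) \<subseteq> carrier K"
    using cs
  proof cases
    case 2
    hence "gs ! (i - 1) \<in> carrier K" "gs ! i \<in> carrier K"
      using assms nth_mem[of "i - 1" gs] nth_mem[of i gs] by auto
    thus ?thesis using 2 assms
      by (auto simp: bar_face_def dest: in_set_takeD in_set_dropD)
  qed (use assms in \<open>auto simp: bar_face_def dest: in_set_butlastD list.set_sel(2)[rotated]\<close>)
qed

text \<open>The boundary of a single tuple, indexed by the degree \<open>n\<close> of the target:
  tuples have length \<open>Suc n\<close>, and the \<open>n - 1\<close> of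
  \<open>bar_boundary\<close> disappears.\<close>

definition bdry where
  "bdry n gs = (\<Oplus>\<^bsub>bar n\<^esub>i\<in>{0..Suc n}. (\<ominus>\<^bsub>R\<^esub> \<one>\<^bsub>R\<^esub>) [^]\<^bsub>R\<^esub> i \<odot>\<^bsub>bar n\<^esub> basis (bar_face K i gs))"

lemma bdry_closed:
  assumes "length gs = Suc n" "set gs \<subseteq> carrier K"
  shows "bdry n gs \<in> carrier (bar n)"
proof -
  interpret M: module R "bar n" by (rule module_bar)
  show ?thesis unfolding bdry_def
    by (rule M.finsum_closed) (use assms bar_face_closed in \<open>auto simp: bar_basis_closed\<close>)
qed

lemma bar_boundary_eq: "bar_boundary R K (Suc n) = lin_ext R (bar n) (bdry n)"
  by (simp add: bar_boundary_def bdry_def[abs_def])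

lemma bar_boundary_hom: "bar_boundary R K (Suc n) \<in> module_hom R (bar (Suc n)) (bar n)"
  unfolding bar_boundary_eq bar_eq[of "Suc n"]
  by (rule module.lin_ext_hom[OF module_bar]) (simp add: bdry_closed)

lemma bar_boundary_basis:
  "length gs = Suc n \<Longrightarrow> set gs \<subseteq> carrier K \<Longrightarrow> bar_boundary R K (Suc n) (basis gs) = bdry n gs"
  unfolding bar_boundary_eq by (rule module.lin_ext_basis[OF module_bar]) (simp add: bdry_closed)

text \<open>Both faces of \<open>[g]\<close> are the empty tuple, and they occur with opposite
  signs.\<close>

lemma bdry_1:
  assumes "g \<in> carrier K"
  shows "bdry 0 [g] = \<zero>\<^bsub>bar 0\<^esub>"
proof -
  interpret M: module R "bar 0" by (rule module_bar)
  have c: "basis [] \<in> carrier (bar 0)" by (simp add: bar_basis_closed)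
  have "{0..Suc 0} = {0, 1}" by auto
  hence "bdry 0 [g] = basis [] \<oplus>\<^bsub>bar 0\<^esub> (\<ominus>\<^bsub>R\<^esub> \<one>\<^bsub>R\<^esub>) \<odot>\<^bsub>bar 0\<^esub> basis []"
    using c by (simp add: bdry_def bar_face_def M.finsum_insert One_nat_def)
  also have "\<dots> = \<zero>\<^bsub>bar 0\<^esub>" using c by (simp add: M.smult_l_minus M.r_neg)
  finally show ?thesis .
qed

text \<open>The faces of \<open>[g, h]\<close> are \<open>[h]\<close>, the product, and
  \<open>[g]\<close>, with alternating signs. In homology they give the defining relation: the class
  of a product is the sum of the classes.\<close>

lemma bdry_2:
  assumes "g \<in> carrier K" "h \<in> carrier K"
  shows "bdry 1 [g, h] = (basis [g] \<oplus>\<^bsub>bar 1\<^esub> basis [h]) \<ominus>\<^bsub>bar 1\<^esub> basis [g \<otimes>\<^bsub>K\<^esub> h]"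
proof -
  interpret M: module R "bar 1" by (rule module_bar)
  have c: "k \<in> carrier K \<Longrightarrow> basis [k] \<in> carrier (bar 1)" for k by (simp add: bar_basis_closed One_nat_def)
  have gh: "g \<otimes>\<^bsub>K\<^esub> h \<in> carrier K" using assms by simp
  have sq: "(\<ominus>\<^bsub>R\<^esub> \<one>\<^bsub>R\<^esub>) [^]\<^bsub>R\<^esub> (2 :: nat) = \<one>\<^bsub>R\<^esub>"
    by (simp add: numeral_2_eq_2 R.l_minus)
  define t where "t i = (\<ominus>\<^bsub>R\<^esub> \<one>\<^bsub>R\<^esub>) [^]\<^bsub>R\<^esub> i \<odot>\<^bsub>bar 1\<^esub> basis (bar_face K i [g, h])" for i
  have t: "t 0 = basis [h]" "t 1 = (\<ominus>\<^bsub>R\<^esub> \<one>\<^bsub>R\<^esub>) \<odot>\<^bsub>bar 1\<^esub> basis [g \<otimes>\<^bsub>K\<^esub> h]" "t 2 = basis [g]"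
    using c assms gh by (simp_all add: t_def bar_face_def sq R.nat_pow_Suc[of _ 0, folded One_nat_def])
  have "{0..Suc 1} = {0, 1, 2 :: nat}" by auto
  hence "bdry 1 [g, h] = finsum (bar 1) t {0, 1, 2}"
    by (simp only: bdry_def t_def[abs_def])
  also have "\<dots> = t 0 \<oplus>\<^bsub>bar 1\<^esub> (t 1 \<oplus>\<^bsub>bar 1\<^esub> t 2)"
    using c assms gh by (simp add: M.finsum_insert t)
  also have "\<dots> = basis [h] \<oplus>\<^bsub>bar 1\<^esub>
      ((\<ominus>\<^bsub>R\<^esub> \<one>\<^bsub>R\<^esub>) \<odot>\<^bsub>bar 1\<^esub> basis [g \<otimes>\<^bsub>K\<^esub> h] \<oplus>\<^bsub>bar 1\<^esub> basis [g])"
    by (simp only: t)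
  also have "\<dots> = (basis [g] \<oplus>\<^bsub>bar 1\<^esub> basis [h]) \<ominus>\<^bsub>bar 1\<^esub> basis [g \<otimes>\<^bsub>K\<^esub> h]"
    using c[OF assms(1)] c[OF assms(2)] c[OF gh]
    by (simp add: M.smult_l_minus a_minus_def M.a_ac)
  finally show ?thesis .
qed

lemma module_hom_bar1_eqI:
  assumes "module R M" "h \<in> module_hom R (bar 1) M" "h' \<in> module_hom R (bar 1) M"
    and "\<And>g. g \<in> carrier K \<Longrightarrow> h (basis [g]) = h' (basis [g])" "c \<in> carrier (bar 1)"
  shows "h c = h' c"
  by (rule R.module_hom_free_eqI[OF assms(1) assms(2,3)[unfolded bar_eq] _ assms(5)[unfolded bar_eq]])
    (use assms(4) in \<open>auto simp: One_nat_def length_Suc_conv\<close>)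

lemma bar_boundary_1:
  assumes "c \<in> carrier (bar 1)"
  shows "bar_boundary R K 1 c = \<zero>\<^bsub>bar 0\<^esub>"
proof (rule module_hom_bar1_eqI[OF module_bar _ _ _ assms])
  interpret M: module R "bar 0" by (rule module_bar)
  show "bar_boundary R K 1 \<in> module_hom R (bar 1) (bar 0)" using bar_boundary_hom[of 0] by (simp add: One_nat_def)
  show "(\<lambda>_. \<zero>\<^bsub>bar 0\<^esub>) \<in> module_hom R (bar 1) (bar 0)" by (rule module_homI) simp_all
  show "bar_boundary R K 1 (basis [g]) = \<zero>\<^bsub>bar 0\<^esub>" if "g \<in> carrier K" for g
    using that bar_boundary_basis[of "[g]" 0] by (simp add: bdry_1 One_nat_def)
qed

text \<open>The boundary into degree 0 vanishes for trivial coefficients. Thus \<open>H1\<close> is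
  a quotient of a free module, and maps out of it can be given on one-element tuples.\<close>

lemma bar_cycles_1: "bar_cycles R K 1 = bar 1"
proof -
  have "{c \<in> carrier (bar 1). (1::nat) = 0 \<or> bar_boundary R K 1 c = \<zero>\<^bsub>bar (1 - 1)\<^esub>} = carrier (bar 1)"
    using bar_boundary_1 by auto
  thus ?thesis by (simp add: bar_cycles_def)
qed

abbreviation "B1 \<equiv> bar_boundaries R K 1"
abbreviation "H1 \<equiv> group_homology R 1 K"

lemma B1_eq: "B1 = bar_boundary R K (Suc 1) ` carrier (bar (Suc 1))"
  by (simp add: bar_boundaries_def One_nat_def)

lemma H1_eq: "H1 = quot_module (bar 1) B1"
  by (simp add: group_homology_def bar_cycles_1)

sublocale H1: module_quotient R "bar 1" B1
  by (intro module_quotient.intro module_quotient_axioms.intro module_bar)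
    (unfold B1_eq, rule module_hom_image_submodule[OF module_bar module_bar bar_boundary_hom])

lemma module_H1: "module R H1"
  unfolding H1_eq by (rule H1.module_quot_module)

text \<open>The criterion for a map on 1-chains to descend to \<open>H1\<close>. Boundaries are the
  image of the free module on pairs, and on a pair the composite is
  \<open>h[g] + h[k] - h[gk]\<close>.\<close>

lemma module_hom_zero_on_B1:
  assumes P: "module R P" and h: "h \<in> module_hom R (bar 1) P"
    and eq: "\<And>g k. g \<in> carrier K \<Longrightarrow> k \<in> carrier K \<Longrightarrow>
      h (basis [g \<otimes>\<^bsub>K\<^esub> k]) = h (basis [g]) \<oplus>\<^bsub>P\<^esub> h (basis [k])"
    and x: "x \<in> B1"
  shows "h x = \<zero>\<^bsub>P\<^esub>"
proof -
  interpret P: module R P by fact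
  obtain c where c: "c \<in> carrier (bar (Suc 1))" "x = bar_boundary R K (Suc 1) c"
    using x unfolding B1_eq by blast
  have "h (bar_boundary R K (Suc 1) c) = \<zero>\<^bsub>P\<^esub>"
  proof (rule R.module_hom_free_eqI[OF P _ _ _ c(1)[unfolded bar_eq]])
    show "(\<lambda>c. h (bar_boundary R K (Suc 1) c)) \<in>
        module_hom R (free_module R {gs. length gs = Suc 1 \<and> set gs \<subseteq> carrier K}) P"
      unfolding bar_eq[symmetric] by (rule module_hom_compose[OF bar_boundary_hom h])
    show "(\<lambda>_. \<zero>\<^bsub>P\<^esub>) \<in> module_hom R (free_module R {gs. length gs = Suc 1 \<and> set gs \<subseteq> carrier K}) P"
      by (rule module_homI) simp_all
    fix gs assume "gs \<in> {gs. length gs = Suc 1 \<and> set gs \<subseteq> carrier K}"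
    then obtain g k where gs: "gs = [g, k]" "g \<in> carrier K" "k \<in> carrier K"
      by (auto simp: One_nat_def length_Suc_conv)
    have c: "g \<in> carrier K \<Longrightarrow> basis [g] \<in> carrier (bar 1)" for g by (simp add: bar_basis_closed One_nat_def)
    have "bar_boundary R K (Suc 1) (basis gs) =
        (basis [g] \<oplus>\<^bsub>bar 1\<^esub> basis [k]) \<ominus>\<^bsub>bar 1\<^esub> basis [g \<otimes>\<^bsub>K\<^esub> k]"
      using gs bar_boundary_basis[of gs 1] bdry_2[of g k] by (simp add: One_nat_def)
    hence "h (bar_boundary R K (Suc 1) (basis gs)) =
        (h (basis [g]) \<oplus>\<^bsub>P\<^esub> h (basis [k])) \<ominus>\<^bsub>P\<^esub> h (basis [g \<otimes>\<^bsub>K\<^esub> k])"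
      using gs c by (simp add: module_hom_diff[OF module_bar P h] module_hom_add[OF h])
    also have "\<dots> = \<zero>\<^bsub>P\<^esub>"
      using gs c by (simp add: eq module_hom_closed[OF h] a_minus_def P.r_neg)
    finally show "h (bar_boundary R K (Suc 1) (basis gs)) = \<zero>\<^bsub>P\<^esub>" .
  qed
  thus ?thesis using c by simp
qed

definition cls where "cls g = B1 +>\<^bsub>bar 1\<^esub> basis [g]"

lemma basis1_closed: "g \<in> carrier K \<Longrightarrow> basis [g] \<in> carrier (bar 1)"
  by (simp add: bar_basis_closed One_nat_def)

lemma cls_closed: "g \<in> carrier K \<Longrightarrow> cls g \<in> carrier H1"
  unfolding cls_def H1_eq by (rule H1.coset_closed) (rule basis1_closed)

lemma cls_mult:
  assumes "g \<in> carrier K" "h \<in> carrier K"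
  shows "cls (g \<otimes>\<^bsub>K\<^esub> h) = cls g \<oplus>\<^bsub>H1\<^esub> cls h"
proof -
  have gh: "g \<otimes>\<^bsub>K\<^esub> h \<in> carrier K" using assms by simp
  note c = basis1_closed[OF assms(1)] basis1_closed[OF assms(2)] basis1_closed[OF gh]
  have "bar_boundary R K (Suc 1) (basis [g, h]) \<in> B1"
    unfolding B1_eq by (rule imageI, rule bar_basis_closed) (use assms in \<open>simp_all add: One_nat_def\<close>)
  moreover have "bar_boundary R K (Suc 1) (basis [g, h]) = bdry 1 [g, h]"
    by (rule bar_boundary_basis) (use assms in \<open>simp_all add: One_nat_def\<close>)
  ultimately have "(basis [g] \<oplus>\<^bsub>bar 1\<^esub> basis [h]) \<ominus>\<^bsub>bar 1\<^esub> basis [g \<otimes>\<^bsub>K\<^esub> h] \<in> B1"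
    by (simp add: bdry_2[OF assms])
  hence "B1 +>\<^bsub>bar 1\<^esub> (basis [g] \<oplus>\<^bsub>bar 1\<^esub> basis [h]) = B1 +>\<^bsub>bar 1\<^esub> basis [g \<otimes>\<^bsub>K\<^esub> h]"
    using c by (intro H1.coset_eqI) simp_all
  thus ?thesis using c by (simp add: cls_def H1_eq H1.coset_add)
qed

text \<open>The complex is unnormalised, so the tuple at the unit is not discarded on chains. Its
  class equals its own double by \<open>cls_mult\<close>, and cancels.\<close>

lemma cls_one: "cls \<one>\<^bsub>K\<^esub> = \<zero>\<^bsub>H1\<^esub>"
proof -
  interpret H: module R H1 by (rule module_H1)
  have "cls \<one>\<^bsub>K\<^esub> \<oplus>\<^bsub>H1\<^esub> cls \<one>\<^bsub>K\<^esub> = cls \<one>\<^bsub>K\<^esub>"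
    using cls_mult[of "\<one>\<^bsub>K\<^esub>" "\<one>\<^bsub>K\<^esub>"] by simp
  thus ?thesis using cls_closed[OF K.one_closed] H.add.l_cancel_one by metis
qed

lemma H1_hom_eqI:
  assumes P: "module R P" and h: "h \<in> module_hom R H1 P" and h': "h' \<in> module_hom R H1 P"
    and eq: "\<And>g. g \<in> carrier K \<Longrightarrow> h (cls g) = h' (cls g)" and x: "x \<in> carrier H1"
  shows "h x = h' x"
proof -
  obtain c where c: "c \<in> carrier (bar 1)" "x = B1 +>\<^bsub>bar 1\<^esub> c"
    using x unfolding H1_eq by (rule H1.quot_carrierE)
  have "h (B1 +>\<^bsub>bar 1\<^esub> c) = h' (B1 +>\<^bsub>bar 1\<^esub> c)"
    by (rule module_hom_bar1_eqI[OF P module_hom_compose[OF H1.coset_hom]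
          module_hom_compose[OF H1.coset_hom] _ c(1)])
      (use h h' eq in \<open>simp_all add: H1_eq cls_def\<close>)
  thus ?thesis by (simp add: c(2))
qed

text \<open>Defined on the whole group ring, where a basis is at hand. Since the class of the unit
  is zero, the restriction to the augmentation ideal sends \<open>g - 1\<close> to the class of
  \<open>[g]\<close>.\<close>

definition \<phi> where "\<phi> = lin_ext R H1 cls"

lemma \<phi>_hom: "\<phi> \<in> module_hom R RK H1"
  unfolding \<phi>_def by (rule module.lin_ext_hom[OF module_H1 cls_closed])

lemma \<phi>_basis: "g \<in> carrier K \<Longrightarrow> \<phi> (basis g) = cls g"
  unfolding \<phi>_def by (rule module.lin_ext_basis[where t = cls, OF module_H1 cls_closed])

lemma \<phi>_hom_aug: "\<phi> \<in> module_hom R I H1"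
  by (rule module_homI)
    (simp_all add: aug_ideal_simps module_hom_closed[OF \<phi>_hom] module_hom_add[OF \<phi>_hom]
      module_hom_smult[OF \<phi>_hom])

lemma \<phi>_\<delta>: "g \<in> carrier K \<Longrightarrow> \<phi> (\<delta> g) = cls g"
proof -
  interpret H: module R H1 by (rule module_H1)
  assume g: "g \<in> carrier K"
  have "\<phi> (\<delta> g) = cls g \<ominus>\<^bsub>H1\<^esub> cls \<one>\<^bsub>K\<^esub>"
    unfolding \<delta>_def using g
    by (simp add: module_hom_diff[OF RK.module_axioms module_H1 \<phi>_hom] R.basis_elt_closed \<phi>_basis)
  thus ?thesis using cls_closed[OF g] by (simp add: cls_one a_minus_def)
qed

text \<open>The bilinear extension of \<open>cls_mult\<close>: \<open>\<phi>\<close> is a derivation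
  with values in a module on which the group ring acts through the augmentation from both sides. The
  augmentation of a factor appears because that factor is constant in one of the two
  summands.\<close>

lemma \<phi>_gmult:
  assumes x: "x \<in> carrier RK" and y: "y \<in> carrier RK"
  shows "\<phi> (gmult x y) = augmentation R y \<odot>\<^bsub>H1\<^esub> \<phi> x \<oplus>\<^bsub>H1\<^esub> augmentation R x \<odot>\<^bsub>H1\<^esub> \<phi> y"
proof -
  interpret H: module R H1 by (rule module_H1)
  note cl = cls_closed augmentation_closed[OF y] module_hom_closed[OF \<phi>_hom y]
  have inner: "\<phi> (lin_ext R RK (\<lambda>h. basis (g \<otimes>\<^bsub>K\<^esub> h)) y) = augmentation R y \<odot>\<^bsub>H1\<^esub> cls g \<oplus>\<^bsub>H1\<^esub> \<phi> y"
    if g: "g \<in> carrier K" for g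
  proof -
    have "\<phi> (lin_ext R RK (\<lambda>h. basis (g \<otimes>\<^bsub>K\<^esub> h)) y) = lin_ext R H1 (\<lambda>h. \<phi> (basis (g \<otimes>\<^bsub>K\<^esub> h))) y"
      by (rule module_hom_lin_ext[OF RK.module_axioms module_H1 \<phi>_hom y])
        (use g in \<open>simp add: R.basis_elt_closed\<close>)
    also have "\<dots> = lin_ext R H1 (\<lambda>h. cls g \<oplus>\<^bsub>H1\<^esub> cls h) y"
      by (rule H.lin_ext_cong[OF y]) (use g in \<open>simp_all add: \<phi>_basis cls_mult cls_closed\<close>)
    also have "\<dots> = lin_ext R H1 (\<lambda>_. cls g) y \<oplus>\<^bsub>H1\<^esub> lin_ext R H1 cls y"
      by (rule H.lin_ext_add_fun[OF y]) (use g in \<open>simp_all add: cls_closed\<close>)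
    finally show ?thesis using g by (simp add: H.lin_ext_const[OF y] cls_closed \<phi>_def)
  qed
  have "\<phi> (gmult x y) = lin_ext R H1 (\<lambda>g. \<phi> (lin_ext R RK (\<lambda>h. basis (g \<otimes>\<^bsub>K\<^esub> h)) y)) x"
    unfolding group_ring_simps
    by (rule module_hom_lin_ext[OF RK.module_axioms module_H1 \<phi>_hom x lin_ext_basis_mult_closed[OF _ y]])
  also have "\<dots> = lin_ext R H1 (\<lambda>g. augmentation R y \<odot>\<^bsub>H1\<^esub> cls g \<oplus>\<^bsub>H1\<^esub> \<phi> y) x"
    by (rule H.lin_ext_cong[OF x]) (simp_all add: inner cl)
  also have "\<dots> = lin_ext R H1 (\<lambda>g. augmentation R y \<odot>\<^bsub>H1\<^esub> cls g) x \<oplus>\<^bsub>H1\<^esub> lin_ext R H1 (\<lambda>_. \<phi> y) x"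
    by (rule H.lin_ext_add_fun[OF x]) (simp_all add: cl)
  also have "lin_ext R H1 (\<lambda>g. augmentation R y \<odot>\<^bsub>H1\<^esub> cls g) x = augmentation R y \<odot>\<^bsub>H1\<^esub> \<phi> x"
    unfolding \<phi>_def by (rule H.lin_ext_smult_fun[OF x cl(2)]) (simp add: cl)
  also have "lin_ext R H1 (\<lambda>_. \<phi> y) x = augmentation R x \<odot>\<^bsub>H1\<^esub> \<phi> y"
    by (rule H.lin_ext_const[OF x cl(3)])
  finally show ?thesis .
qed

lemma \<phi>_gmult_aug:
  assumes "x \<in> carrier I" "y \<in> carrier RK"
  shows "\<phi> (gmult x y) = augmentation R y \<odot>\<^bsub>H1\<^esub> \<phi> x"
proof -
  interpret H: module R H1 by (rule module_H1)
  show ?thesis using assms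
    by (simp add: \<phi>_gmult aug_ideal_simps module_hom_closed[OF \<phi>_hom] augmentation_closed)
qed

text \<open>The elements \<open>g - 1\<close> span the augmentation ideal: if the coefficients
  \<open>x g\<close> sum to zero, then replacing each \<open>g\<close> by \<open>g - 1\<close> in
  the expansion of \<open>x\<close> changes nothing, because the total coefficient of the subtracted
  unit is that sum.\<close>

lemma aug_ideal_hom_eqI:
  assumes P: "module R P" and h: "h \<in> module_hom R I P" and h': "h' \<in> module_hom R I P"
    and eq: "\<And>g. g \<in> carrier K \<Longrightarrow> h (\<delta> g) = h' (\<delta> g)" and x: "x \<in> carrier I"
  shows "h x = h' x"
proof -
  have one: "basis \<one>\<^bsub>K\<^esub> \<in> carrier RK" by (simp add: R.basis_elt_closed)
  have xRK: "x \<in> carrier RK" and x0: "augmentation R x = \<zero>\<^bsub>R\<^esub>"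
    using x by (simp_all add: aug_ideal_simps)
  have \<delta>I: "lin_ext R I \<delta> \<in> module_hom R RK I" by (rule I.lin_ext_hom) (rule \<delta>_closed)
  \<comment> \<open>The expansion is computed in \<open>RK\<close>, where \<open>\<delta> g\<close>
    can be split into its two terms; these need not lie in \<open>I\<close> separately.\<close>
  have incl: "(\<lambda>x. x) \<in> module_hom R I RK" by (rule module_homI) (simp_all add: aug_ideal_simps)
  have "lin_ext R I \<delta> x = lin_ext R RK \<delta> x"
    by (rule module_hom_lin_ext[OF I.module_axioms RK.module_axioms incl xRK \<delta>_closed])
  also have "\<dots> = lin_ext R RK (\<lambda>g. basis g \<oplus>\<^bsub>RK\<^esub> \<ominus>\<^bsub>RK\<^esub> basis \<one>\<^bsub>K\<^esub>) x"
    by (simp add: \<delta>_def[abs_def] a_minus_def)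
  also have "\<dots> = lin_ext R RK basis x \<oplus>\<^bsub>RK\<^esub> lin_ext R RK (\<lambda>_. \<ominus>\<^bsub>RK\<^esub> basis \<one>\<^bsub>K\<^esub>) x"
    by (rule RK.lin_ext_add_fun[OF xRK]) (simp_all add: R.basis_elt_closed)
  also have "\<dots> = x" using one xRK
    by (simp add: R.lin_ext_basis_id[OF xRK] RK.lin_ext_const[OF xRK] x0)
  finally have x_eq: "lin_ext R I \<delta> x = x" .
  have "h (lin_ext R I \<delta> x) = h' (lin_ext R I \<delta> x)"
    by (rule R.module_hom_free_eqI[OF P module_hom_compose[OF \<delta>I h] module_hom_compose[OF \<delta>I h'] _ xRK])
      (simp add: I.lin_ext_basis \<delta>_closed eq)
  thus ?thesis by (simp add: x_eq)
qed

end

section \<open>Functoriality of first homology and of the group ring map\<close>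

context cring_group_hom
begin

declare One_nat_def [simp del]

abbreviation Hf where "Hf \<equiv> group_homology_map R 1 K' f"

text \<open>That boundaries go to boundaries is read off in the quotient, without a chain map in
  degree 2: the composite \<open>A.bar 1 \<rightarrow> B.H1\<close> sends \<open>[g]\<close> to the
  class of \<open>f g\<close>, which is additive in \<open>g\<close>, so it kills
  \<open>A.B1\<close>.\<close>

lemma
  shows Hf_hom: "Hf \<in> module_hom R A.H1 B.H1"
    and Hf_cls: "g \<in> carrier K \<Longrightarrow> Hf (A.cls g) = B.cls (f g)"
proof -
  let ?t = "\<lambda>gs. basis_elt R (map f gs)"
  let ?h = "lin_ext R (B.bar 1) ?t"
  have t: "?t gs \<in> carrier (B.bar 1)" if "gs \<in> {gs. length gs = 1 \<and> set gs \<subseteq> carrier K}" for gs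
    by (rule B.bar_basis_closed) (use that f_closed in auto)
  have h: "?h \<in> module_hom R (A.bar 1) (B.bar 1)"
    unfolding A.bar_eq by (rule B.H1.lin_ext_hom[OF t])
  have h_basis: "?h (basis_elt R [g]) = basis_elt R [f g]" if "g \<in> carrier K" for g
    using B.H1.lin_ext_basis[of ?t "[g]"] t[of "[g]"] that by (simp add: One_nat_def)
  have ch: "(\<lambda>x. B.B1 +>\<^bsub>B.bar 1\<^esub> ?h x) \<in> module_hom R (A.bar 1) B.H1"
    using module_hom_compose[OF h B.H1.coset_hom] by (simp add: B.H1_eq)
  have "B.B1 +>\<^bsub>B.bar 1\<^esub> ?h x = B.B1" if "x \<in> A.B1" for x
    using A.module_hom_zero_on_B1[OF B.module_H1 ch _ that]
    by (simp add: h_basis B.cls_def[symmetric] f_mult f_closed B.cls_mult B.H1_eq quot_module_simps)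
  moreover have "?h x \<in> B.B1 +>\<^bsub>B.bar 1\<^esub> ?h x" if "x \<in> A.B1" for x
    by (intro B.H1.a_rcos_self module_hom_closed[OF h] subsetD[OF A.H1.a_subset] that)
  ultimately have B1: "?h ` A.B1 \<subseteq> B.B1" by auto
  have eq: "Hf = quot_map (B.bar 1) B.B1 ?h"
    by (simp add: group_homology_map_def B.bar_cycles_1)
  show "Hf \<in> module_hom R A.H1 B.H1"
    unfolding eq A.H1_eq B.H1_eq
    by (rule quot_map_hom[OF A.module_bar B.module_bar A.H1.submodule B.H1.submodule h B1])
  show "Hf (A.cls g) = B.cls (f g)" if "g \<in> carrier K"
    unfolding eq A.cls_def B.cls_def
    by (subst quot_map_coset[OF A.module_bar B.module_bar A.H1.submodule B.H1.submodule h B1])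
      (simp_all add: A.basis1_closed h_basis that)
qed

text \<open>Naturality of \<open>\<phi>\<close>. It holds on the whole group ring, where both sides
  send a group element \<open>g\<close> to the class of \<open>f g\<close>.\<close>

lemma Hf_\<phi>:
  assumes "x \<in> carrier A.I"
  shows "B.\<phi> (F x) = Hf (A.\<phi> x)"
  by (rule A.R.module_hom_free_eqI[OF B.module_H1 module_hom_compose[OF F_hom B.\<phi>_hom]
        module_hom_compose[OF A.\<phi>_hom Hf_hom]])
    (use assms in \<open>simp_all add: F_basis A.\<phi>_basis B.\<phi>_basis Hf_cls f_closed A.aug_ideal_simps\<close>)

end

text \<open>As in \<open>group_fctr\<close>, maps are controlled on carriers only, so
  \<open>f\<close> cannot be replaced by the identity function. The same reason makes
  \<open>f''\<close> a separate map in the two lemmas on composition below.\<close>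

lemma group_ring_map_ident:
  assumes "cring_group_hom R K K f" "\<And>g. g \<in> carrier K \<Longrightarrow> f g = g"
    and "x \<in> carrier (aug_ideal R K)"
  shows "group_ring_map R K f x = x"
proof -
  interpret cring_group_hom R K K f by fact
  show ?thesis
    by (rule A.R.module_hom_free_eqI[OF A.RK.module_axioms F_hom module_hom_ident])
      (use assms in \<open>simp_all add: F_basis A.aug_ideal_simps\<close>)
qed

lemma group_homology_map_ident:
  assumes "cring_group_hom R K K f" "\<And>g. g \<in> carrier K \<Longrightarrow> f g = g"
    and "x \<in> carrier (group_homology R 1 K)"
  shows "group_homology_map R 1 K f x = x"
proof -
  interpret cring_group_hom R K K f by fact
  show ?thesis
    by (rule A.H1_hom_eqI[OF A.module_H1 Hf_hom module_hom_ident _ assms(3)])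
      (simp_all add: Hf_cls assms(2))
qed

lemma group_ring_map_compose:
  assumes "cring_group_hom R K K' f" "cring_group_hom R K' K'' f'" "cring_group_hom R K K'' f''"
    and "\<And>g. g \<in> carrier K \<Longrightarrow> f'' g = f' (f g)"
    and "x \<in> carrier (aug_ideal R K)"
  shows "group_ring_map R K'' f'' x = group_ring_map R K'' f' (group_ring_map R K' f x)"
proof -
  interpret f: cring_group_hom R K K' f by fact
  interpret f': cring_group_hom R K' K'' f' by fact
  interpret f'': cring_group_hom R K K'' f'' by fact
  show ?thesis
    by (rule f.A.R.module_hom_free_eqI[OF f'.B.RK.module_axioms f''.F_hom
          module_hom_compose[OF f.F_hom f'.F_hom]])
      (use assms in \<open>simp_all add: f.F_basis f'.F_basis f''.F_basis f.f_closed f.A.aug_ideal_simps\<close>)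
qed

lemma group_homology_map_compose:
  assumes "cring_group_hom R K K' f" "cring_group_hom R K' K'' f'" "cring_group_hom R K K'' f''"
    and "\<And>g. g \<in> carrier K \<Longrightarrow> f'' g = f' (f g)"
    and "x \<in> carrier (group_homology R 1 K)"
  shows "group_homology_map R 1 K'' f'' x = group_homology_map R 1 K'' f' (group_homology_map R 1 K' f x)"
proof -
  interpret f: cring_group_hom R K K' f by fact
  interpret f': cring_group_hom R K' K'' f' by fact
  interpret f'': cring_group_hom R K K'' f'' by fact
  show ?thesis
    by (rule f.A.H1_hom_eqI[OF f'.B.module_H1 f''.Hf_hom module_hom_compose[OF f.Hf_hom f'.Hf_hom] _ assms(5)])
      (use assms(4) in \<open>simp_all add: f.Hf_cls f'.Hf_cls f''.Hf_cls f.f_closed\<close>)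
qed


section \<open>Tensoring the augmentation ideal with a trivial module\<close>

text \<open>The hypothesis \<open>act_eq\<close> is the linear extension of a trivial group action:
  each group element has augmentation \<open>\<one>\<close>, so a combination acts by the sum of its
  coefficients.\<close>

locale trivial_coefficients = cring_group R K + V: module R V
  for R :: "('r, 'z) ring_scheme" and K :: "'g monoid" and V :: "('r, 'v) module" +
  fixes act
  assumes act_eq: "s \<in> carrier RK \<Longrightarrow> v \<in> carrier V \<Longrightarrow> act s v = augmentation R s \<odot>\<^bsub>V\<^esub> v"
begin

sublocale IV: tensor_data R "carrier (group_ring R K)" I gmult V act
  by (intro tensor_data.intro tensor_data_axioms.intro I.module_axioms V.module_axioms)
    (use aug_ideal_gmult_closed act_eq augmentation_closed in \<open>simp_all add: group_ring_simps(1)\<close>)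

sublocale HV: tensor_data R "carrier R" H1 "\<lambda>m r. r \<odot>\<^bsub>H1\<^esub> m" V "\<lambda>r n. r \<odot>\<^bsub>V\<^esub> n"
proof -
  interpret H: module R H1 by (rule module_H1)
  show "tensor_data R (carrier R) H1 (\<lambda>m r. r \<odot>\<^bsub>H1\<^esub> m) V (\<lambda>r n. r \<odot>\<^bsub>V\<^esub> n)"
    by (intro tensor_data.intro tensor_data_axioms.intro H.module_axioms V.module_axioms) simp_all
qed

text \<open>The relations of the tensor product contain scalars on the left only. The element
  \<open>r 1\<close> of the group ring has augmentation \<open>r\<close>, hence acts on
  \<open>V\<close> as \<open>r\<close>; balancedness carries it to the left, where right
  multiplication by it is scaling by \<open>r\<close>.\<close>

lemma IV_pure_smult_right:
  assumes m: "m \<in> carrier I" and v: "v \<in> carrier V" and r: "r \<in> carrier R"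
  shows "IV.pure m (r \<odot>\<^bsub>V\<^esub> v) = r \<odot>\<^bsub>IV.T\<^esub> IV.pure m v"
proof -
  let ?s = "r \<odot>\<^bsub>RK\<^esub> basis \<one>\<^bsub>K\<^esub>"
  have one: "basis \<one>\<^bsub>K\<^esub> \<in> carrier RK" by (simp add: R.basis_elt_closed)
  have s: "?s \<in> carrier RK" using r one by simp
  have mRK: "m \<in> carrier RK" using m by (simp add: aug_ideal_simps)
  have "lin_ext R RK (\<lambda>h. basis (g \<otimes>\<^bsub>K\<^esub> h)) ?s = r \<odot>\<^bsub>RK\<^esub> basis g" if g: "g \<in> carrier K" for g
  proof -
    have t: "h \<in> carrier K \<Longrightarrow> basis (g \<otimes>\<^bsub>K\<^esub> h) \<in> carrier RK" for h
      using g by (simp add: R.basis_elt_closed)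
    have "lin_ext R RK (\<lambda>h. basis (g \<otimes>\<^bsub>K\<^esub> h)) ?s
        = r \<odot>\<^bsub>RK\<^esub> lin_ext R RK (\<lambda>h. basis (g \<otimes>\<^bsub>K\<^esub> h)) (basis \<one>\<^bsub>K\<^esub>)"
      by (rule module_hom_smult[OF RK.lin_ext_hom[OF t] r one])
    thus ?thesis using g by (simp add: RK.lin_ext_basis R.basis_elt_closed)
  qed
  hence "gmult m ?s = lin_ext R RK (\<lambda>g. r \<odot>\<^bsub>RK\<^esub> basis g) m"
    unfolding group_ring_simps
    by (intro RK.lin_ext_cong[OF mRK]) (use r in \<open>simp_all add: R.basis_elt_closed\<close>)
  also have "\<dots> = r \<odot>\<^bsub>I\<^esub> m"
    using r by (simp add: RK.lin_ext_smult_fun[OF mRK] R.basis_elt_closed R.lin_ext_basis_id[OF mRK]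
        aug_ideal_simps)
  finally have gm: "gmult m ?s = r \<odot>\<^bsub>I\<^esub> m" .
  have "augmentation R ?s = r"
    using module_hom_smult[OF augmentation_hom r one] r
    by (simp add: augmentation_basis regular_module_simps)
  hence "IV.pure m (r \<odot>\<^bsub>V\<^esub> v) = IV.pure (gmult m ?s) v"
    using IV.pure_balanced[OF m _ v, of ?s] s v by (simp add: act_eq group_ring_simps(1))
  thus ?thesis using IV.pure_smult[OF r m v] by (simp add: gm)
qed

definition \<Phi> where "\<Phi> = tensor_lift R HV.T (\<lambda>x v. HV.pure (\<phi> x) v)"

lemma HV_pure_smult_right:
  "m \<in> carrier H1 \<Longrightarrow> v \<in> carrier V \<Longrightarrow> r \<in> carrier R \<Longrightarrow>
    HV.pure m (r \<odot>\<^bsub>V\<^esub> v) = HV.pure (r \<odot>\<^bsub>H1\<^esub> m) v"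
  using HV.pure_balanced[of m r v] by simp

lemma balanced_\<phi>: "balanced R (carrier (group_ring R K)) I gmult V act HV.T (\<lambda>x v. HV.pure (\<phi> x) v)"
  unfolding balanced_def group_ring_simps(1)
proof (intro conjI ballI)
  fix m m' v v' s r
  note cl = module_hom_closed[OF \<phi>_hom_aug]
  show "HV.pure (\<phi> m) v \<in> carrier HV.T" if "m \<in> carrier I" "v \<in> carrier V"
    using that by (simp add: HV.pure_closed cl)
  show "HV.pure (\<phi> (m \<oplus>\<^bsub>I\<^esub> m')) v = HV.pure (\<phi> m) v \<oplus>\<^bsub>HV.T\<^esub> HV.pure (\<phi> m') v"
    if "m \<in> carrier I" "m' \<in> carrier I" "v \<in> carrier V"
    using that by (simp add: module_hom_add[OF \<phi>_hom_aug] HV.pure_add_left cl)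
  show "HV.pure (\<phi> m) (v \<oplus>\<^bsub>V\<^esub> v') = HV.pure (\<phi> m) v \<oplus>\<^bsub>HV.T\<^esub> HV.pure (\<phi> m) v'"
    if "m \<in> carrier I" "v \<in> carrier V" "v' \<in> carrier V"
    using that by (simp add: HV.pure_add_right cl)
  \<comment> \<open>As \<open>m\<close> has augmentation zero, \<open>\<phi>\<close> turns right
    multiplication by \<open>s\<close> into scaling by the augmentation of \<open>s\<close>. On
    \<open>V\<close> the element \<open>s\<close> acts by the same scalar, which moves across the
    tensor sign over \<open>R\<close>.\<close>
  show "HV.pure (\<phi> (gmult m s)) v = HV.pure (\<phi> m) (act s v)"
    if "m \<in> carrier I" "s \<in> carrier RK" "v \<in> carrier V"
    using that by (simp add: act_eq HV_pure_smult_right cl augmentation_closed \<phi>_gmult_aug)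
  show "HV.pure (\<phi> (r \<odot>\<^bsub>I\<^esub> m)) v = r \<odot>\<^bsub>HV.T\<^esub> HV.pure (\<phi> m) v"
    if "r \<in> carrier R" "m \<in> carrier I" "v \<in> carrier V"
    using that by (simp add: module_hom_smult[OF \<phi>_hom_aug] HV.pure_smult cl)
qed

lemmas \<Phi>_hom = IV.tensor_lift_hom[OF HV.module_T balanced_\<phi>, folded \<Phi>_def]
  and \<Phi>_pure = IV.tensor_lift_pure[OF HV.module_T balanced_\<phi>, folded \<Phi>_def]

text \<open>The chain-level candidate for an inverse of \<open>\<phi>\<close>, sending
  \<open>[g]\<close> to \<open>g - 1\<close>; \<open>hd\<close> reads off the single entry of a
  tuple of length 1. It stays on chains, since it kills boundaries only after tensoring with
  \<open>V\<close>.\<close>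

definition \<psi> where "\<psi> = lin_ext R I (\<lambda>gs. \<delta> (hd gs))"

lemma \<psi>_hom: "\<psi> \<in> module_hom R (bar 1) I"
  unfolding \<psi>_def bar_eq
  by (rule I.lin_ext_hom) (auto simp: One_nat_def length_Suc_conv \<delta>_closed)

lemma \<psi>_basis: "g \<in> carrier K \<Longrightarrow> \<psi> (basis [g]) = \<delta> g"
  unfolding \<psi>_def by (simp add: I.lin_ext_basis \<delta>_closed)

text \<open>The pairing that becomes the inverse map. The passage to the quotient is made with
  \<open>v\<close> fixed, because the values have to lie in the tensor product for the boundaries to
  vanish.\<close>

definition \<beta> where "\<beta> C v = quot_lift (\<lambda>c. IV.pure (\<psi> c) v) C"

lemma
  assumes v: "v \<in> carrier V"
  shows \<beta>_coset: "c \<in> carrier (bar 1) \<Longrightarrow> \<beta> (B1 +>\<^bsub>bar 1\<^esub> c) v = IV.pure (\<psi> c) v"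
    and \<beta>_hom: "(\<lambda>C. \<beta> C v) \<in> module_hom R H1 IV.T"
proof -
  have hom: "(\<lambda>c. IV.pure (\<psi> c) v) \<in> module_hom R (bar 1) IV.T"
    by (rule module_hom_compose[OF \<psi>_hom IV.pure_hom_left[OF v]])
  have zero: "IV.pure (\<psi> x) v = \<zero>\<^bsub>IV.T\<^esub>" if "x \<in> B1" for x
  proof (rule module_hom_zero_on_B1[OF IV.module_T hom _ that])
    fix g k assume g: "g \<in> carrier K" and k: "k \<in> carrier K"
    have b: "basis k \<in> carrier RK" using k by (simp add: R.basis_elt_closed)
    \<comment> \<open>\<open>gk - 1 = (g - 1)k + (k - 1)\<close>, and \<open>k\<close> moves across the tensor sign, where it acts trivially.\<close>
    have "IV.pure (\<delta> (g \<otimes>\<^bsub>K\<^esub> k)) v = IV.pure (gmult (\<delta> g) (basis k)) v \<oplus>\<^bsub>IV.T\<^esub> IV.pure (\<delta> k) v"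
      using g k b v by (simp add: \<delta>_mult IV.pure_add_left aug_ideal_gmult_closed \<delta>_closed)
    also have "IV.pure (gmult (\<delta> g) (basis k)) v = IV.pure (\<delta> g) v"
      using IV.pure_balanced[OF \<delta>_closed[OF g] _ v, of "basis k"] b k v
      by (simp add: act_eq augmentation_basis group_ring_simps(1))
    finally show "IV.pure (\<psi> (basis [g \<otimes>\<^bsub>K\<^esub> k])) v
        = IV.pure (\<psi> (basis [g])) v \<oplus>\<^bsub>IV.T\<^esub> IV.pure (\<psi> (basis [k])) v"
      using g k by (simp add: \<psi>_basis)
  qed
  show "c \<in> carrier (bar 1) \<Longrightarrow> \<beta> (B1 +>\<^bsub>bar 1\<^esub> c) v = IV.pure (\<psi> c) v" for c
    unfolding \<beta>_def by (rule H1.quot_lift_coset[OF IV.module_T hom zero])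
  show "(\<lambda>C. \<beta> C v) \<in> module_hom R H1 IV.T"
    unfolding \<beta>_def H1_eq by (rule H1.quot_lift_hom[OF IV.module_T hom zero])
qed

lemma \<beta>_cls: "g \<in> carrier K \<Longrightarrow> v \<in> carrier V \<Longrightarrow> \<beta> (cls g) v = IV.pure (\<delta> g) v"
  by (simp add: cls_def \<beta>_coset basis1_closed \<psi>_basis)

lemma balanced_\<beta>: "balanced R (carrier R) H1 (\<lambda>m r. r \<odot>\<^bsub>H1\<^esub> m) V (\<lambda>r n. r \<odot>\<^bsub>V\<^esub> n) IV.T \<beta>"
  unfolding balanced_def
proof (intro conjI ballI)
  fix C C' v v' r
  note cl = module_hom_closed[OF \<psi>_hom]
  show "\<beta> C v \<in> carrier IV.T" if "C \<in> carrier H1" "v \<in> carrier V"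
    using that module_hom_closed[OF \<beta>_hom] by simp
  show "\<beta> (C \<oplus>\<^bsub>H1\<^esub> C') v = \<beta> C v \<oplus>\<^bsub>IV.T\<^esub> \<beta> C' v"
    if "C \<in> carrier H1" "C' \<in> carrier H1" "v \<in> carrier V"
    using that module_hom_add[OF \<beta>_hom] by simp
  show sm: "\<beta> (r \<odot>\<^bsub>H1\<^esub> C) v = r \<odot>\<^bsub>IV.T\<^esub> \<beta> C v"
    if "r \<in> carrier R" "C \<in> carrier H1" "v \<in> carrier V"
    using that module_hom_smult[OF \<beta>_hom] by simp
  \<comment> \<open>Linearity in \<open>C\<close> came with the lift for a fixed \<open>v\<close>.
    For the dependence on \<open>v\<close>, one chain representing \<open>C\<close> serves all
    vectors at once and reduces the claim to pure tensors.\<close>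
  show "\<beta> C (v \<oplus>\<^bsub>V\<^esub> v') = \<beta> C v \<oplus>\<^bsub>IV.T\<^esub> \<beta> C v'"
    if "C \<in> carrier H1" "v \<in> carrier V" "v' \<in> carrier V"
    using that(1) unfolding H1_eq
    by (rule H1.quot_carrierE) (use that in \<open>simp add: \<beta>_coset IV.pure_add_right cl\<close>)
  \<comment> \<open>Both sides equal \<open>r\<close> times \<open>\<beta> C v\<close>, the right
    one by \<open>IV_pure_smult_right\<close> on a representing chain.\<close>
  show "\<beta> (r \<odot>\<^bsub>H1\<^esub> C) v = \<beta> C (r \<odot>\<^bsub>V\<^esub> v)"
    if C: "C \<in> carrier H1" and r: "r \<in> carrier R" and v: "v \<in> carrier V"
  proof -
    obtain c where "c \<in> carrier (bar 1)" "C = B1 +>\<^bsub>bar 1\<^esub> c"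
      using C unfolding H1_eq by (rule H1.quot_carrierE)
    hence "\<beta> C (r \<odot>\<^bsub>V\<^esub> v) = r \<odot>\<^bsub>IV.T\<^esub> \<beta> C v"
      using r v by (simp add: \<beta>_coset IV_pure_smult_right cl)
    thus ?thesis using sm[OF r C v] by simp
  qed
qed

definition \<Psi> where "\<Psi> = tensor_lift R IV.T \<beta>"

lemmas \<Psi>_hom = HV.tensor_lift_hom[OF IV.module_T balanced_\<beta>, folded \<Psi>_def]
  and \<Psi>_pure = HV.tensor_lift_pure[OF IV.module_T balanced_\<beta>, folded \<Psi>_def]

lemma \<Psi>_\<Phi>:
  assumes "t \<in> carrier IV.T"
  shows "\<Psi> (\<Phi> t) = t"
proof (rule IV.tensor_hom_eqI[OF IV.module_T module_hom_compose[OF \<Phi>_hom \<Psi>_hom] module_hom_ident _ assms])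
  fix x v assume x: "x \<in> carrier I" and v: "v \<in> carrier V"
  \<comment> \<open>Both sides are linear in \<open>x\<close>, so \<open>x = \<delta> g\<close>
    suffices: \<open>\<phi>\<close> takes it to \<open>cls g\<close>, and \<open>\<beta>\<close>
    brings this back to \<open>\<delta> g \<otimes> v\<close>.\<close>
  have "\<beta> (\<phi> x) v = IV.pure x v"
    by (rule aug_ideal_hom_eqI[OF IV.module_T module_hom_compose[OF \<phi>_hom_aug \<beta>_hom[OF v]]
          IV.pure_hom_left[OF v] _ x])
      (simp add: \<phi>_\<delta> \<beta>_cls v)
  thus "\<Psi> (\<Phi> (IV.pure x v)) = IV.pure x v"
    using x v by (simp add: \<Phi>_pure \<Psi>_pure module_hom_closed[OF \<phi>_hom_aug])
qed

lemma \<Phi>_\<Psi>: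
  assumes "t \<in> carrier HV.T"
  shows "\<Phi> (\<Psi> t) = t"
proof (rule HV.tensor_hom_eqI[OF HV.module_T module_hom_compose[OF \<Psi>_hom \<Phi>_hom] module_hom_ident _ assms])
  fix C v assume C: "C \<in> carrier H1" and v: "v \<in> carrier V"
  have "\<Phi> (\<beta> C v) = HV.pure C v"
  proof (rule H1_hom_eqI[OF HV.module_T module_hom_compose[OF \<beta>_hom[OF v] \<Phi>_hom]
          HV.pure_hom_left[OF v] _ C])
    fix g assume "g \<in> carrier K"
    thus "\<Phi> (\<beta> (cls g) v) = HV.pure (cls g) v"
      by (simp only: \<beta>_cls \<Phi>_pure \<delta>_closed \<phi>_\<delta> v)
  qed
  thus "\<Phi> (\<Psi> (HV.pure C v)) = HV.pure C v"
    using C v by (simp add: \<Psi>_pure)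
qed

lemma \<Phi>_bij: "bij_betw \<Phi> (carrier IV.T) (carrier HV.T)"
proof (rule bij_betw_byWitness[where f' = \<Psi>])
  show "\<forall>t\<in>carrier IV.T. \<Psi> (\<Phi> t) = t" by (intro ballI \<Psi>_\<Phi>)
  show "\<forall>t\<in>carrier HV.T. \<Phi> (\<Psi> t) = t" by (intro ballI \<Phi>_\<Psi>)
  show "\<Phi> ` carrier IV.T \<subseteq> carrier HV.T" by (intro image_subsetI module_hom_closed[OF \<Phi>_hom])
  show "\<Psi> ` carrier HV.T \<subseteq> carrier IV.T" by (intro image_subsetI module_hom_closed[OF \<Psi>_hom])
qed

end

section \<open>Naturality of the isomorphism in the group and the coefficient module\<close>

locale trivial_coefficients_hom =
  cring_group_hom R K K' f +
  AV: trivial_coefficients R K V act + BV: trivial_coefficients R K' V' act'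
  for R :: "('r, 'z) ring_scheme" and K :: "'g monoid" and K' :: "'h monoid" and f
    and V :: "('r, 'v) module" and act and V' :: "('r, 'w) module" and act' +
  fixes g assumes g_hom: "g \<in> module_hom R V V'"
begin

text \<open>The linear map \<open>g\<close> is automatically compatible with the two actions along
  \<open>F\<close>: each action is through the augmentation, and \<open>F\<close> preserves the
  augmentation.\<close>

sublocale IV: tensor_data_map R "carrier (group_ring R K)" A.I A.gmult V act
    "carrier (group_ring R K')" B.I B.gmult V' act' F g F
  by (intro tensor_data_map.intro tensor_data_map_axioms.intro AV.IV.tensor_data_axioms
      BV.IV.tensor_data_axioms F_hom_aug g_hom)
    (simp_all add: A.group_ring_simps(1) B.group_ring_simps(1) module_hom_closed[OF F_hom] F_gmult
      A.aug_ideal_simps AV.act_eq BV.act_eq module_hom_smult[OF g_hom] module_hom_closed[OF g_hom]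
      A.augmentation_closed augmentation_F)

sublocale HV: tensor_data_map R "carrier R" A.H1 "\<lambda>m r. r \<odot>\<^bsub>A.H1\<^esub> m" V "\<lambda>r n. r \<odot>\<^bsub>V\<^esub> n"
    "carrier R" B.H1 "\<lambda>m r. r \<odot>\<^bsub>B.H1\<^esub> m" V' "\<lambda>r n. r \<odot>\<^bsub>V'\<^esub> n" Hf g "\<lambda>r. r"
  by (intro tensor_data_map.intro tensor_data_map_axioms.intro AV.HV.tensor_data_axioms
      BV.HV.tensor_data_axioms Hf_hom g_hom)
    (simp_all add: module_hom_smult[OF g_hom] module_hom_smult[OF Hf_hom])

lemma \<Phi>_natural:
  assumes "t \<in> carrier AV.IV.T"
  shows "BV.\<Phi> (IV.tmap t) = HV.tmap (AV.\<Phi> t)"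
  by (rule AV.IV.tensor_hom_eqI[OF BV.HV.module_T
        module_hom_compose[OF IV.tensor_map_hom BV.\<Phi>_hom]
        module_hom_compose[OF AV.\<Phi>_hom HV.tensor_map_hom] _ assms])
    (simp add: IV.tensor_map_pure HV.tensor_map_pure AV.\<Phi>_pure BV.\<Phi>_pure
      module_hom_closed[OF F_hom_aug] module_hom_closed[OF g_hom]
      module_hom_closed[OF A.\<phi>_hom_aug] Hf_\<phi>)

end


section \<open>Functors on a category with endofunctor\<close>

text \<open>Stated for families of tensor data over rings \<open>S n\<close> that may vary with the
  object, so that it covers both sides of the isomorphism: group rings on the left, the constant
  ring \<open>R\<close> on the right. Identities and composition are checked on pure
  tensors.\<close>

lemma module_fctr_tensor:
  fixes C :: "('o, 'a, 'w) cat_scheme"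
  assumes obj: "\<And>f. f \<in> arr C \<Longrightarrow> src C f \<in> obj C" "\<And>f. f \<in> arr C \<Longrightarrow> tgt C f \<in> obj C"
    and id: "\<And>n. n \<in> obj C \<Longrightarrow> ident C n \<in> hom_set C n n"
    and comp: "\<And>f g. f \<in> arr C \<Longrightarrow> g \<in> arr C \<Longrightarrow> src C g = tgt C f \<Longrightarrow>
        g \<bullet>\<^bsub>C\<^esub> f \<in> hom_set C (src C f) (tgt C g)"
    and data: "\<And>n. n \<in> obj C \<Longrightarrow> tensor_data R (S n) (M n) (\<rho> n) (N n) (\<Lambda> n)"
    and maps: "\<And>f. f \<in> arr C \<Longrightarrow>
        tensor_data_map R (S (src C f)) (M (src C f)) (\<rho> (src C f)) (N (src C f)) (\<Lambda> (src C f))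
          (S (tgt C f)) (M (tgt C f)) (\<rho> (tgt C f)) (N (tgt C f)) (\<Lambda> (tgt C f)) (p f) (q f) (\<sigma> f)"
    and p_id: "\<And>n x. n \<in> obj C \<Longrightarrow> x \<in> carrier (M n) \<Longrightarrow> p (ident C n) x = x"
    and q_id: "\<And>n x. n \<in> obj C \<Longrightarrow> x \<in> carrier (N n) \<Longrightarrow> q (ident C n) x = x"
    and p_comp: "\<And>f g x. f \<in> arr C \<Longrightarrow> g \<in> arr C \<Longrightarrow> src C g = tgt C f \<Longrightarrow>
        x \<in> carrier (M (src C f)) \<Longrightarrow> p (g \<bullet>\<^bsub>C\<^esub> f) x = p g (p f x)"
    and q_comp: "\<And>f g x. f \<in> arr C \<Longrightarrow> g \<in> arr C \<Longrightarrow> src C g = tgt C f \<Longrightarrow>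
        x \<in> carrier (N (src C f)) \<Longrightarrow> q (g \<bullet>\<^bsub>C\<^esub> f) x = q g (q f x)"
    and F: "\<And>n. fobj F n = tensor_prod R (S n) (M n) (\<rho> n) (N n) (\<Lambda> n)"
      "\<And>f. farr F f = tensor_map R (S (tgt C f)) (M (tgt C f)) (\<rho> (tgt C f)) (N (tgt C f))
          (\<Lambda> (tgt C f)) (p f) (q f)"
  shows "module_fctr R C F"
  unfolding module_fctr_def F
proof (intro conjI ballI impI)
  fix n assume n: "n \<in> obj C"
  interpret n: tensor_data R "S n" "M n" "\<rho> n" "N n" "\<Lambda> n" by (rule data[OF n])
  show "module R n.T" by (rule n.module_T)
  have i: "ident C n \<in> arr C" "src C (ident C n) = n" "tgt C (ident C n) = n"
    using id[OF n] by (simp_all add: hom_set_def)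
  interpret i: tensor_data_map R "S n" "M n" "\<rho> n" "N n" "\<Lambda> n" "S n" "M n" "\<rho> n" "N n" "\<Lambda> n"
    "p (ident C n)" "q (ident C n)" "\<sigma> (ident C n)"
    using maps[OF i(1)] by (simp add: i)
  fix x assume x: "x \<in> carrier n.T"
  have "i.tmap x = x"
    by (rule n.tensor_hom_eqI[OF n.module_T i.tensor_map_hom module_hom_ident _ x])
      (simp_all add: i.tensor_map_pure p_id q_id n)
  thus "tensor_map R (S (tgt C (ident C n))) (M (tgt C (ident C n))) (\<rho> (tgt C (ident C n)))
      (N (tgt C (ident C n))) (\<Lambda> (tgt C (ident C n))) (p (ident C n)) (q (ident C n)) x = x"
    by (simp add: i)
next
  fix f assume f: "f \<in> arr C"
  interpret f: tensor_data_map R "S (src C f)" "M (src C f)" "\<rho> (src C f)" "N (src C f)" "\<Lambda> (src C f)"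
    "S (tgt C f)" "M (tgt C f)" "\<rho> (tgt C f)" "N (tgt C f)" "\<Lambda> (tgt C f)" "p f" "q f" "\<sigma> f"
    by (rule maps[OF f])
  show "f.tmap \<in> module_hom R f.A.T f.B.T" by (rule f.tensor_map_hom)
  fix g x assume g: "g \<in> arr C" and gf: "src C g = tgt C f" and x: "x \<in> carrier f.A.T"
  interpret g: tensor_data_map R "S (tgt C f)" "M (tgt C f)" "\<rho> (tgt C f)" "N (tgt C f)" "\<Lambda> (tgt C f)"
    "S (tgt C g)" "M (tgt C g)" "\<rho> (tgt C g)" "N (tgt C g)" "\<Lambda> (tgt C g)" "p g" "q g" "\<sigma> g"
    using maps[OF g] by (simp add: gf)
  let ?h = "g \<bullet>\<^bsub>C\<^esub> f"
  have h: "?h \<in> arr C" "src C ?h = src C f" "tgt C ?h = tgt C g"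
    using comp[OF f g gf] by (simp_all add: hom_set_def)
  interpret h: tensor_data_map R "S (src C f)" "M (src C f)" "\<rho> (src C f)" "N (src C f)" "\<Lambda> (src C f)"
    "S (tgt C g)" "M (tgt C g)" "\<rho> (tgt C g)" "N (tgt C g)" "\<Lambda> (tgt C g)" "p ?h" "q ?h" "\<sigma> ?h"
    using maps[OF h(1)] by (simp add: h)
  have "h.tmap x = g.tmap (f.tmap x)"
    by (rule f.A.tensor_hom_eqI[OF g.B.module_T h.tensor_map_hom
          module_hom_compose[OF f.tensor_map_hom g.tensor_map_hom] _ x])
      (simp add: h.tensor_map_pure f.tensor_map_pure g.tensor_map_pure p_comp q_comp f g gf
        module_hom_closed[OF f.f_hom] module_hom_closed[OF f.g_hom])
  thus "tensor_map R (S (tgt C ?h)) (M (tgt C ?h)) (\<rho> (tgt C ?h)) (N (tgt C ?h)) (\<Lambda> (tgt C ?h))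
      (p ?h) (q ?h) x = g.tmap (f.tmap x)"
    by (simp add: h)
qed

text \<open>The common form of the two cases, over the groupoid and over its bracket category.
  Besides naturality it has to establish that both sides are functors; for the left side the
  required compatibility of \<open>F\<close> applied to \<open>T\<close> with the group ring actions
  is supplied by triviality.\<close>

lemma LM_trivial_naturally_isomorphic:
  fixes R :: "('r, 'z) ring_scheme" and C :: "('o, 'a, 'w) cat_scheme"
    and A :: "('o, 'a, 'g monoid, 'g \<Rightarrow> 'g) fctr"
    and F :: "('o, 'a, ('r, 'v) module, 'v \<Rightarrow> 'v) fctr"
  assumes R: "cring R"
    and obj: "\<And>f. f \<in> arr C \<Longrightarrow> src C f \<in> obj C" "\<And>f. f \<in> arr C \<Longrightarrow> tgt C f \<in> obj C"
    and id: "\<And>n. n \<in> obj C \<Longrightarrow> ident C n \<in> hom_set C n n"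
    and comp: "\<And>f g. f \<in> arr C \<Longrightarrow> g \<in> arr C \<Longrightarrow> src C g = tgt C f \<Longrightarrow>
        g \<bullet>\<^bsub>C\<^esub> f \<in> hom_set C (src C f) (tgt C g)"
    and A: "group_fctr C A" and F: "module_fctr R C F" and T: "cat_fctr C C T"
    and x: "\<And>n h. n \<in> obj C \<Longrightarrow> h \<in> carrier (fobj A n) \<Longrightarrow>
        x n h \<in> hom_set C (fobj T n) (fobj T n)"
    and triv: "\<And>n. n \<in> obj C \<Longrightarrow>
        trivial_group_ring_module R (fobj A n) (fobj F (fobj T n)) (LM_action R T x F n)"
  shows "naturally_isomorphic R C (LM R C A T x F)
    (tensor_fctr R C (H1_fctr R C A) (fctr_comp F T))"
proof -
  have T_obj: "n \<in> obj C \<Longrightarrow> fobj T n \<in> obj C" for n using T by (simp add: cat_fctr_def)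
  have T_arr: "f \<in> arr C \<Longrightarrow> farr T f \<in> arr C" "f \<in> arr C \<Longrightarrow> src C (farr T f) = fobj T (src C f)"
    "f \<in> arr C \<Longrightarrow> tgt C (farr T f) = fobj T (tgt C f)" for f
    using T by (auto simp: cat_fctr_def hom_set_def)
  have T_id: "n \<in> obj C \<Longrightarrow> farr T (ident C n) = ident C (fobj T n)" for n
    using T by (simp add: cat_fctr_def)
  have T_comp: "f \<in> arr C \<Longrightarrow> g \<in> arr C \<Longrightarrow> src C g = tgt C f \<Longrightarrow>
      farr T (g \<bullet>\<^bsub>C\<^esub> f) = farr T g \<bullet>\<^bsub>C\<^esub> farr T f" for f g
    using T by (simp add: cat_fctr_def)
  have tc: "trivial_coefficients R (fobj A n) (fobj F (fobj T n)) (LM_action R T x F n)"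
    if n: "n \<in> obj C" for n
  proof -
    let ?K = "fobj A n" and ?V = "fobj F (fobj T n)"
    have K: "group ?K" using A n by (simp add: group_fctr_def)
    have V: "module R ?V" using F T_obj[OF n] by (simp add: module_fctr_def)
    interpret cring_group R ?K using R K by (simp add: cring_group_def)
    interpret V: module R ?V by (rule V)
    show ?thesis
    proof (intro trivial_coefficients.intro trivial_coefficients_axioms.intro cring_group_axioms V)
      fix s v assume s: "s \<in> carrier RK" and v: "v \<in> carrier ?V"
      have "farr F (x n h) v = v" if h: "h \<in> carrier ?K" for h
      proof -
        have a: "x n h \<in> arr C" "src C (x n h) = fobj T n" "tgt C (x n h) = fobj T n"
          using x[OF n h] by (simp_all add: hom_set_def)
        have "farr F (x n h) \<in> module_hom R ?V ?V"
          using F a by (fastforce simp: module_fctr_def)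
        \<comment> \<open>Evaluating the linearly extended action at a basis element requires this
          value to lie in the module, which is why \<open>x n h\<close> has to be an endomorphism of
          \<open>T n\<close>.\<close>
        hence "farr F (x n h) v \<in> carrier ?V" by (rule module_hom_closed[OF _ v])
        hence "LM_action R T x F n (basis h) v = farr F (x n h) v"
          by (simp add: LM_action_def group_ring_action_def V.lin_ext_basis)
        thus ?thesis using triv[OF n] h v by (simp add: trivial_group_ring_module_def)
      qed
      hence "LM_action R T x F n s v = lin_ext R ?V (\<lambda>_. v) s"
        unfolding LM_action_def group_ring_action_def
        by (intro V.lin_ext_cong[OF s]) (simp_all add: v)
      thus "LM_action R T x F n s v = augmentation R s \<odot>\<^bsub>?V\<^esub> v"
        by (simp add: V.lin_ext_const[OF s v])
    qed
  qed
  have tch: "trivial_coefficients_hom R (fobj A (src C f)) (fobj A (tgt C f)) (farr A f)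
      (fobj F (fobj T (src C f))) (LM_action R T x F (src C f))
      (fobj F (fobj T (tgt C f))) (LM_action R T x F (tgt C f)) (farr F (farr T f))"
    if f: "f \<in> arr C" for f
  proof -
    have "farr A f \<in> hom (fobj A (src C f)) (fobj A (tgt C f))" using A f by (simp add: group_fctr_def)
    moreover have "farr F (farr T f) \<in> module_hom R (fobj F (fobj T (src C f))) (fobj F (fobj T (tgt C f)))"
      using F T_arr[OF f] by (fastforce simp: module_fctr_def)
    ultimately show ?thesis
      using tc[OF obj(1)[OF f]] tc[OF obj(2)[OF f]]
      by (simp add: trivial_coefficients_hom_def trivial_coefficients_hom_axioms_def
          cring_group_hom_def cring_group_hom_axioms_def trivial_coefficients_def)
  qed
  have cgh: "f \<in> arr C \<Longrightarrow> cring_group_hom R (fobj A (src C f)) (fobj A (tgt C f)) (farr A f)" for f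
    using tch by (simp add: trivial_coefficients_hom_def)
  have cgh_id: "cring_group_hom R (fobj A n) (fobj A n) (farr A (ident C n))" if "n \<in> obj C" for n
    using cgh[of "ident C n"] id[OF that] by (simp add: hom_set_def)
  have cgh_comp: "cring_group_hom R (fobj A (src C f)) (fobj A (tgt C g)) (farr A (g \<bullet>\<^bsub>C\<^esub> f))"
    if "f \<in> arr C" "g \<in> arr C" "src C g = tgt C f" for f g
    using cgh[of "g \<bullet>\<^bsub>C\<^esub> f"] comp[OF that] by (simp add: hom_set_def)
  have A_id: "farr A (ident C n) h = h" if "n \<in> obj C" "h \<in> carrier (fobj A n)" for n h
    using A that by (simp add: group_fctr_def)
  have A_comp: "farr A (g \<bullet>\<^bsub>C\<^esub> f) h = farr A g (farr A f h)"
    if "f \<in> arr C" "g \<in> arr C" "src C g = tgt C f" "h \<in> carrier (fobj A (src C f))" for f g h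
    using A that by (simp add: group_fctr_def)
  have cgh': "cring_group_hom R (fobj A (tgt C f)) (fobj A (tgt C g)) (farr A g)"
    if "g \<in> arr C" "src C g = tgt C f" for f g
    using cgh[OF that(1)] that(2) by simp
  have ring_comp: "group_ring_map R (fobj A (tgt C g)) (farr A (g \<bullet>\<^bsub>C\<^esub> f)) i =
      group_ring_map R (fobj A (tgt C g)) (farr A g) (group_ring_map R (fobj A (tgt C f)) (farr A f) i)"
    if "f \<in> arr C" "g \<in> arr C" "src C g = tgt C f" "i \<in> carrier (aug_ideal R (fobj A (src C f)))"
    for f g i
    by (rule group_ring_map_compose[OF cgh[OF that(1)] cgh'[OF that(2,3)] cgh_comp[OF that(1-3)]
          A_comp[OF that(1-3)] that(4)])
  have homology_comp: "group_homology_map R 1 (fobj A (tgt C g)) (farr A (g \<bullet>\<^bsub>C\<^esub> f)) c =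
      group_homology_map R 1 (fobj A (tgt C g)) (farr A g)
        (group_homology_map R 1 (fobj A (tgt C f)) (farr A f) c)"
    if "f \<in> arr C" "g \<in> arr C" "src C g = tgt C f"
      "c \<in> carrier (group_homology R 1 (fobj A (src C f)))" for f g c
    by (rule group_homology_map_compose[OF cgh[OF that(1)] cgh'[OF that(2,3)] cgh_comp[OF that(1-3)]
          A_comp[OF that(1-3)] that(4)])
  have tgt_id: "n \<in> obj C \<Longrightarrow> tgt C (ident C n) = n" for n using id by (simp add: hom_set_def)
  have tgt_comp: "f \<in> arr C \<Longrightarrow> g \<in> arr C \<Longrightarrow> src C g = tgt C f \<Longrightarrow> tgt C (g \<bullet>\<^bsub>C\<^esub> f) = tgt C g" for f g
    using comp by (simp add: hom_set_def)
  have F_id: "farr F (farr T (ident C n)) v = v" if "n \<in> obj C" "v \<in> carrier (fobj F (fobj T n))" for n v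
    using F T_obj that by (simp add: T_id module_fctr_def)
  have F_comp: "farr F (farr T (g \<bullet>\<^bsub>C\<^esub> f)) v = farr F (farr T g) (farr F (farr T f) v)"
    if "f \<in> arr C" "g \<in> arr C" "src C g = tgt C f" "v \<in> carrier (fobj F (fobj T (src C f)))" for f g v
    using F T_arr that by (simp add: T_comp module_fctr_def)
  have "module_fctr R C (LM R C A T x F)"
  proof (rule module_fctr_tensor[OF obj id comp, where S = "\<lambda>n. carrier (group_ring R (fobj A n))"
        and M = "\<lambda>n. aug_ideal R (fobj A n)" and \<rho> = "\<lambda>n. mult (group_ring R (fobj A n))"
        and N = "\<lambda>n. fobj F (fobj T n)" and \<Lambda> = "LM_action R T x F"
        and p = "\<lambda>f. group_ring_map R (fobj A (tgt C f)) (farr A f)"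
        and q = "\<lambda>f. farr F (farr T f)"
        and \<sigma> = "\<lambda>f. group_ring_map R (fobj A (tgt C f)) (farr A f)"])
    fix f n assume "n \<in> obj C"
    then interpret trivial_coefficients R "fobj A n" "fobj F (fobj T n)" "LM_action R T x F n" by (rule tc)
    show "tensor_data R (carrier (group_ring R (fobj A n))) I gmult (fobj F (fobj T n)) (LM_action R T x F n)"
      by (rule IV.tensor_data_axioms)
  next
    fix f assume "f \<in> arr C"
    then interpret trivial_coefficients_hom R "fobj A (src C f)" "fobj A (tgt C f)" "farr A f"
      "fobj F (fobj T (src C f))" "LM_action R T x F (src C f)"
      "fobj F (fobj T (tgt C f))" "LM_action R T x F (tgt C f)" "farr F (farr T f)" by (rule tch)
    show "tensor_data_map R (carrier (group_ring R (fobj A (src C f)))) A.I A.gmult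
        (fobj F (fobj T (src C f))) (LM_action R T x F (src C f))
        (carrier (group_ring R (fobj A (tgt C f)))) B.I B.gmult
        (fobj F (fobj T (tgt C f))) (LM_action R T x F (tgt C f))
        (group_ring_map R (fobj A (tgt C f)) (farr A f)) (farr F (farr T f))
        (group_ring_map R (fobj A (tgt C f)) (farr A f))"
      by (rule IV.tensor_data_map_axioms)
  qed (simp_all add: tgt_id tgt_comp F_id F_comp LM_def Let_def
      group_ring_map_ident[OF cgh_id A_id] ring_comp)
  moreover have "module_fctr R C (tensor_fctr R C (H1_fctr R C A) (fctr_comp F T))"
  proof (rule module_fctr_tensor[OF obj id comp, where S = "\<lambda>n. carrier R"
        and M = "\<lambda>n. group_homology R 1 (fobj A n)"
        and \<rho> = "\<lambda>n m r. r \<odot>\<^bsub>group_homology R 1 (fobj A n)\<^esub> m"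
        and N = "\<lambda>n. fobj F (fobj T n)" and \<Lambda> = "\<lambda>n r v. r \<odot>\<^bsub>fobj F (fobj T n)\<^esub> v"
        and p = "\<lambda>f. group_homology_map R 1 (fobj A (tgt C f)) (farr A f)"
        and q = "\<lambda>f. farr F (farr T f)" and \<sigma> = "\<lambda>f r. r"])
    fix f n assume "n \<in> obj C"
    then interpret trivial_coefficients R "fobj A n" "fobj F (fobj T n)" "LM_action R T x F n" by (rule tc)
    show "tensor_data R (carrier R) H1 (\<lambda>m r. r \<odot>\<^bsub>H1\<^esub> m) (fobj F (fobj T n))
        (\<lambda>r v. r \<odot>\<^bsub>fobj F (fobj T n)\<^esub> v)"
      by (rule HV.tensor_data_axioms)
  next
    fix f assume "f \<in> arr C"
    then interpret trivial_coefficients_hom R "fobj A (src C f)" "fobj A (tgt C f)" "farr A f"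
      "fobj F (fobj T (src C f))" "LM_action R T x F (src C f)"
      "fobj F (fobj T (tgt C f))" "LM_action R T x F (tgt C f)" "farr F (farr T f)" by (rule tch)
    show "tensor_data_map R (carrier R) A.H1 (\<lambda>m r. r \<odot>\<^bsub>A.H1\<^esub> m)
        (fobj F (fobj T (src C f))) (\<lambda>r v. r \<odot>\<^bsub>fobj F (fobj T (src C f))\<^esub> v)
        (carrier R) B.H1 (\<lambda>m r. r \<odot>\<^bsub>B.H1\<^esub> m)
        (fobj F (fobj T (tgt C f))) (\<lambda>r v. r \<odot>\<^bsub>fobj F (fobj T (tgt C f))\<^esub> v) Hf (farr F (farr T f)) (\<lambda>r. r)"
      by (rule HV.tensor_data_map_axioms)
  qed (simp_all add: tgt_id tgt_comp F_id F_comp tensor_fctr_def H1_fctr_def fctr_comp_def Let_def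
      group_homology_map_ident[OF cgh_id A_id] homology_comp del: One_nat_def)
  moreover define \<eta> where "\<eta> n = trivial_coefficients.\<Phi> R (fobj A n) (fobj F (fobj T n))" for n
  have "\<eta> n \<in> module_hom R (fobj (LM R C A T x F) n)
        (fobj (tensor_fctr R C (H1_fctr R C A) (fctr_comp F T)) n) \<and>
      bij_betw (\<eta> n) (carrier (fobj (LM R C A T x F) n))
        (carrier (fobj (tensor_fctr R C (H1_fctr R C A) (fctr_comp F T)) n))"
    if "n \<in> obj C" for n
  proof -
    interpret trivial_coefficients R "fobj A n" "fobj F (fobj T n)" "LM_action R T x F n"
      by (rule tc[OF that])
    show ?thesis
      using \<Phi>_hom \<Phi>_bij
      by (simp add: \<eta>_def LM_def Let_def tensor_fctr_def H1_fctr_def fctr_comp_def del: One_nat_def)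
  qed
  moreover have "\<eta> (tgt C f) (farr (LM R C A T x F) f t) =
      farr (tensor_fctr R C (H1_fctr R C A) (fctr_comp F T)) f (\<eta> (src C f) t)"
    if f: "f \<in> arr C" and t: "t \<in> carrier (fobj (LM R C A T x F) (src C f))" for f t
  proof -
    interpret trivial_coefficients_hom R "fobj A (src C f)" "fobj A (tgt C f)" "farr A f"
      "fobj F (fobj T (src C f))" "LM_action R T x F (src C f)"
      "fobj F (fobj T (tgt C f))" "LM_action R T x F (tgt C f)" "farr F (farr T f)"
      by (rule tch[OF f])
    show ?thesis
      using \<Phi>_natural[of t] t
      by (simp add: \<eta>_def LM_def Let_def tensor_fctr_def H1_fctr_def fctr_comp_def del: One_nat_def)
  qed
  ultimately show ?thesis
    unfolding naturally_isomorphic_def by blast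
qed

section \<open>The bracket construction\<close>

lemma (in groupoid) iso_set_eq: "iso_set C A B = hom_set C A B"
  using invertible by (auto simp: iso_set_def hom_set_def)

context strict_braided_groupoid
begin

lemma iso_inverse:
  assumes "\<psi> \<in> hom_set G X Y"
  obtains \<psi>' where "\<psi>' \<in> hom_set G Y X" "\<psi>' \<bullet> \<psi> = ident G X" "\<psi> \<bullet> \<psi>' = ident G Y"
  using invertible[of \<psi>] assms by (auto simp: is_inverse_def hom_set_def)

text \<open>A class is the set of pairs reachable from \<open>(X, f)\<close> by an isomorphism. Such
  isomorphisms are translated between \<open>(X, f)\<close> and \<open>(X', f')\<close> by composing
  with \<open>\<psi>\<close> or with its inverse, so the two sets coincide.\<close>

lemma bracket_eqI:
  assumes A: "A \<in> obj G" and X: "X \<in> obj G" "X' \<in> obj G"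
    and f': "f' \<in> hom_set G (X' \<natural> A) B"
    and \<psi>: "\<psi> \<in> hom_set G X X'" and f: "f' \<bullet> (\<psi> \<sharp> ident G A) = f"
  shows "bracket G A B X f = bracket G A B X' f'"
proof -
  note iA = ident_hom[OF A]
  have split: "(\<theta>' \<bullet> \<theta>) \<sharp> ident G A = (\<theta>' \<sharp> ident G A) \<bullet> (\<theta> \<sharp> ident G A)"
    if "\<theta> \<in> hom_set G P Q" "\<theta>' \<in> hom_set G Q S" for \<theta> \<theta>' P Q S
    using interchange[OF that iA iA] ident_left[OF iA] by simp
  have key: "(\<exists>\<theta>\<in>hom_set G X Y. h \<bullet> (\<theta> \<sharp> ident G A) = f) \<longleftrightarrow>
      (\<exists>\<theta>\<in>hom_set G X' Y. h \<bullet> (\<theta> \<sharp> ident G A) = f')"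
    if h: "h \<in> hom_set G (Y \<natural> A) B" for Y h
  proof
    obtain \<psi>' where \<psi>': "\<psi>' \<in> hom_set G X' X" "\<psi> \<bullet> \<psi>' = ident G X'" using iso_inverse[OF \<psi>] by blast
    assume "\<exists>\<theta>\<in>hom_set G X Y. h \<bullet> (\<theta> \<sharp> ident G A) = f"
    then obtain \<theta> where \<theta>: "\<theta> \<in> hom_set G X Y" "h \<bullet> (\<theta> \<sharp> ident G A) = f" by blast
    note t = tensor_arr_in[OF \<theta>(1) iA] tensor_arr_in[OF \<psi> iA] tensor_arr_in[OF \<psi>'(1) iA]
    have "h \<bullet> ((\<theta> \<bullet> \<psi>') \<sharp> ident G A) = (f' \<bullet> (\<psi> \<sharp> ident G A)) \<bullet> (\<psi>' \<sharp> ident G A)"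
      by (simp add: split[OF \<psi>'(1) \<theta>(1)] cmp_assoc[OF t(3,1) h] \<theta>(2) f)
    also have "\<dots> = f' \<bullet> ((\<psi> \<bullet> \<psi>') \<sharp> ident G A)"
      by (simp add: split[OF \<psi>'(1) \<psi>] cmp_assoc[OF t(3,2) f'])
    also have "\<dots> = f'" using X A by (simp add: \<psi>'(2) tensor_ident ident_right[OF f'])
    finally show "\<exists>\<theta>\<in>hom_set G X' Y. h \<bullet> (\<theta> \<sharp> ident G A) = f'"
      using cmp_hom[OF \<psi>'(1) \<theta>(1)] by blast
  next
    assume "\<exists>\<theta>\<in>hom_set G X' Y. h \<bullet> (\<theta> \<sharp> ident G A) = f'"
    then obtain \<theta> where \<theta>: "\<theta> \<in> hom_set G X' Y" "h \<bullet> (\<theta> \<sharp> ident G A) = f'" by blast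
    have "h \<bullet> ((\<theta> \<bullet> \<psi>) \<sharp> ident G A) = f"
      by (simp add: split[OF \<psi> \<theta>(1)] cmp_assoc[OF tensor_arr_in[OF \<psi> iA] tensor_arr_in[OF \<theta>(1) iA] h]
          \<theta>(2) f)
    thus "\<exists>\<theta>\<in>hom_set G X Y. h \<bullet> (\<theta> \<sharp> ident G A) = f"
      using cmp_hom[OF \<psi> \<theta>(1)] by blast
  qed
  show ?thesis
    unfolding bracket_def iso_set_eq using key by auto
qed

lemma bracket_mem_self:
  assumes "A \<in> obj G" "X \<in> obj G" "f \<in> hom_set G (X \<natural> A) B"
  shows "(X, f) \<in> qcls (bracket G A B X f)"
  using assms ident_hom[OF assms(2)]
  by (auto simp: bracket_def iso_set_eq tensor_ident ident_right intro!: bexI[of _ "ident G X"])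

lemma bracket_memD:
  assumes "(X', f') \<in> qcls (bracket G A B X f)"
  obtains \<psi> where "X' \<in> obj G" "f' \<in> hom_set G (X' \<natural> A) B"
    "\<psi> \<in> hom_set G X X'" "f' \<bullet> (\<psi> \<sharp> ident G A) = f"
  using assms by (auto simp: bracket_def iso_set_eq)

text \<open>\<open>qcomp\<close> is a union over all representatives, and the point is that each
  contributes the same class: if \<open>\<psi>\<close> and \<open>\<theta>\<close> relate two
  choices of representatives, then \<open>\<theta> \<sharp> \<psi>\<close> relates the composites,
  by interchange. The given pairs are members of their own classes, so the union is not
  empty.\<close>

lemma qcomp_bracket:
  assumes A: "A \<in> obj G" and B: "B \<in> obj G" and X: "X \<in> obj G" and Y: "Y \<in> obj G"
    and f: "f \<in> hom_set G (X \<natural> A) B" and g: "g \<in> hom_set G (Y \<natural> B) D"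
  shows "qcomp G (bracket G B D Y g) (bracket G A B X f) =
    bracket G A D (Y \<natural> X) (g \<bullet> (ident G Y \<sharp> f))"
proof -
  let ?c = "qcls (bracket G A D (Y \<natural> X) (g \<bullet> (ident G Y \<sharp> f)))"
  note iA = ident_hom[OF A] and iB = ident_hom[OF B]
  have eq: "qcls (bracket G A D (Y' \<natural> X') (g' \<bullet> (ident G Y' \<sharp> f'))) = ?c"
    if f': "(X', f') \<in> qcls (bracket G A B X f)" and g': "(Y', g') \<in> qcls (bracket G B D Y g)"
    for X' f' Y' g'
  proof -
    obtain \<psi> where \<psi>: "X' \<in> obj G" "f' \<in> hom_set G (X' \<natural> A) B"
      "\<psi> \<in> hom_set G X X'" "f' \<bullet> (\<psi> \<sharp> ident G A) = f" using bracket_memD[OF f'] .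
    obtain \<theta> where \<theta>: "Y' \<in> obj G" "g' \<in> hom_set G (Y' \<natural> B) D"
      "\<theta> \<in> hom_set G Y Y'" "g' \<bullet> (\<theta> \<sharp> ident G B) = g" using bracket_memD[OF g'] .
    note iY = ident_hom[OF Y] and iY' = ident_hom[OF \<theta>(1)]
    note t1 = tensor_arr_in[OF \<theta>(3) iB] and t2 = tensor_arr_in[OF iY f]
      and t3 = tensor_arr_in[OF iY' \<psi>(2)] and t4 = tensor_arr_in[OF \<psi>(3) iA]
    have t5: "\<theta> \<sharp> (\<psi> \<sharp> ident G A) \<in> hom_set G (Y \<natural> X \<natural> A) (Y' \<natural> X' \<natural> A)"
      by (rule tensor_arr_in[OF \<theta>(3) t4])
    have "g \<bullet> (ident G Y \<sharp> f) = g' \<bullet> ((\<theta> \<sharp> ident G B) \<bullet> (ident G Y \<sharp> f))"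
      by (simp add: cmp_assoc[OF t2 t1 \<theta>(2)] \<theta>(4))
    also have "(\<theta> \<sharp> ident G B) \<bullet> (ident G Y \<sharp> f) = \<theta> \<sharp> f"
      using interchange[OF iY \<theta>(3) f iB] by (simp add: ident_left[OF f] ident_right[OF \<theta>(3)])
    also have "\<dots> = (ident G Y' \<sharp> f') \<bullet> (\<theta> \<sharp> (\<psi> \<sharp> ident G A))"
      using interchange[OF \<theta>(3) iY' t4 \<psi>(2)] by (simp add: \<psi>(4) ident_left[OF \<theta>(3)])
    also have "\<theta> \<sharp> (\<psi> \<sharp> ident G A) = (\<theta> \<sharp> \<psi>) \<sharp> ident G A"
      using \<theta>(3) \<psi>(3) iA by (simp add: hom_set_def arr_assoc)
    finally have e: "g \<bullet> (ident G Y \<sharp> f) = g' \<bullet> ((ident G Y' \<sharp> f') \<bullet> ((\<theta> \<sharp> \<psi>) \<sharp> ident G A))" .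
    have gf': "g' \<bullet> (ident G Y' \<sharp> f') \<in> hom_set G ((Y' \<natural> X') \<natural> A) D"
      using cmp_hom[OF t3 \<theta>(2)] by (simp add: obj_assoc \<theta>(1) \<psi>(1) A)
    have t6: "(\<theta> \<sharp> \<psi>) \<sharp> ident G A \<in> hom_set G ((Y \<natural> X) \<natural> A) (Y' \<natural> X' \<natural> A)"
      using tensor_arr_in[OF tensor_arr_in[OF \<theta>(3) \<psi>(3)] iA] by (simp add: obj_assoc \<theta>(1) \<psi>(1) A)
    have "bracket G A D (Y \<natural> X) (g \<bullet> (ident G Y \<sharp> f)) =
        bracket G A D (Y' \<natural> X') (g' \<bullet> (ident G Y' \<sharp> f'))"
      by (rule bracket_eqI[OF A tensor_obj_in[OF Y X] tensor_obj_in[OF \<theta>(1) \<psi>(1)] gf'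
            tensor_arr_in[OF \<theta>(3) \<psi>(3)]])
        (simp add: e cmp_assoc[OF t6 t3 \<theta>(2)])
    thus ?thesis by simp
  qed
  have "(\<Union>(X', f')\<in>qcls (bracket G A B X f). \<Union>(Y', g')\<in>qcls (bracket G B D Y g).
      qcls (bracket G A D (Y' \<natural> X') (g' \<bullet> (ident G Y' \<sharp> f')))) = ?c"
    using bracket_mem_self[OF A X f] bracket_mem_self[OF B Y g] eq by fast
  thus ?thesis by (simp add: qcomp_def bracket_def)
qed

lemma quillen_arrE:
  assumes "\<phi> \<in> arr (quillen G)"
  obtains A B X f where "\<phi> = bracket G A B X f" "A \<in> obj G" "B \<in> obj G" "X \<in> obj G"
    "f \<in> hom_set G (X \<natural> A) B"
  using assms by (auto simp: quillen_def)

lemma quillen_simps: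
  "obj (quillen G) = obj G"
  "src (quillen G) (bracket G A B X f) = A" "tgt (quillen G) (bracket G A B X f) = B"
  "ident (quillen G) A = bracket G A A (unit_obj G) (ident G A)"
  "cmp (quillen G) = qcomp G"
  by (simp_all add: quillen_def bracket_def)

lemma bracket_quillen:
  assumes "A \<in> obj G" "B \<in> obj G" "X \<in> obj G" "f \<in> hom_set G (X \<natural> A) B"
  shows "bracket G A B X f \<in> hom_set (quillen G) A B"
  using assms unfolding hom_set_def[of "quillen G"] by (auto simp: quillen_simps) (auto simp: quillen_def)

lemma quillen_ident: "A \<in> obj G \<Longrightarrow> ident (quillen G) A \<in> hom_set (quillen G) A A"
  unfolding quillen_simps using ident_hom[of A]
  by (intro bracket_quillen) (simp_all add: unit_in obj_unit_left)

lemma quillen_comp: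
  assumes "\<phi> \<in> arr (quillen G)" "\<gamma> \<in> arr (quillen G)" "src (quillen G) \<gamma> = tgt (quillen G) \<phi>"
  shows "\<gamma> \<bullet>\<^bsub>quillen G\<^esub> \<phi> \<in> hom_set (quillen G) (src (quillen G) \<phi>) (tgt (quillen G) \<gamma>)"
proof -
  obtain A B X f where \<phi>: "\<phi> = bracket G A B X f" "A \<in> obj G" "B \<in> obj G" "X \<in> obj G"
    "f \<in> hom_set G (X \<natural> A) B" using quillen_arrE[OF assms(1)] .
  obtain B' D Y g where \<gamma>: "\<gamma> = bracket G B' D Y g" "B' \<in> obj G" "D \<in> obj G" "Y \<in> obj G"
    "g \<in> hom_set G (Y \<natural> B') D" using quillen_arrE[OF assms(2)] .
  have B': "B' = B" using assms(3) by (simp add: \<phi>(1) \<gamma>(1) quillen_simps)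
  have "g \<bullet> (ident G Y \<sharp> f) \<in> hom_set G ((Y \<natural> X) \<natural> A) D"
    using cmp_hom[OF tensor_arr_in[OF ident_hom[OF \<gamma>(4)] \<phi>(5)] \<gamma>(5)[unfolded B']]
    by (simp add: obj_assoc \<gamma>(4) \<phi>(2,4))
  thus ?thesis
    using qcomp_bracket[OF \<phi>(2,3,4) \<gamma>(4) \<phi>(5) \<gamma>(5)[unfolded B']] \<phi> \<gamma> B'
    by (simp add: quillen_simps bracket_quillen tensor_obj_in)
qed

lemma emb_hom:
  assumes "f \<in> hom_set G A B"
  shows "emb G f \<in> hom_set (quillen G) A B"
proof -
  have "A \<in> obj G" "B \<in> obj G" using assms src_obj tgt_obj by (auto simp: hom_set_def)
  thus ?thesis
    using assms bracket_quillen[of A B "unit_obj G" f]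
    by (auto simp: emb_def unit_in obj_unit_left hom_set_def)
qed

lemma emb_ident: "A \<in> obj G \<Longrightarrow> emb G (ident G A) = ident (quillen G) A"
  using ident_hom[of A] by (simp add: emb_def quillen_simps hom_set_def)

lemma emb_comp:
  assumes f: "f \<in> hom_set G A B" and g: "g \<in> hom_set G B D"
  shows "emb G (g \<bullet> f) = emb G g \<bullet>\<^bsub>quillen G\<^esub> emb G f"
proof -
  have AB: "A \<in> obj G" "B \<in> obj G" using f src_obj tgt_obj by (auto simp: hom_set_def)
  have "emb G g \<bullet>\<^bsub>quillen G\<^esub> emb G f =
      bracket G A D (unit_obj G \<natural> unit_obj G) (g \<bullet> (ident G (unit_obj G) \<sharp> f))"
    using qcomp_bracket[of A B "unit_obj G" "unit_obj G" f g D] f g AB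
    by (simp add: emb_def quillen_simps hom_set_def unit_in obj_unit_left)
  thus ?thesis
    using cmp_hom[OF f g] f by (simp add: emb_def hom_set_def unit_in obj_unit_left arr_unit_left)
qed

end


section \<open>The categories of the Long-Moody construction\<close>

lemma full_subcat_simps:
  "obj (full_subcat C S) = S"
  "arr (full_subcat C S) = {f \<in> arr C. src C f \<in> S \<and> tgt C f \<in> S}"
  "src (full_subcat C S) = src C" "tgt (full_subcat C S) = tgt C"
  "ident (full_subcat C S) = ident C" "cmp (full_subcat C S) = cmp C"
  "hom_set (full_subcat C S) A B = {f \<in> hom_set C A B. A \<in> S \<and> B \<in> S}"
  by (auto simp: full_subcat_def hom_set_def)

text \<open>The section respects composition because group homomorphisms preserve the unit:
  composing the pairs of \<open>g\<close> and \<open>f\<close> gives the first component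
  \<open>1 A(g)(1) = 1\<close>. Its composite with \<open>\<chi>\<close> is therefore a functor, and
  \<open>T\<close> agrees with it on objects and arrows.\<close>

lemma section_fctr:
  assumes id: "\<And>n. n \<in> obj C \<Longrightarrow> ident C n \<in> hom_set C n n"
    and obj: "\<And>f. f \<in> arr C \<Longrightarrow> src C f \<in> obj C" "\<And>f. f \<in> arr C \<Longrightarrow> tgt C f \<in> obj C"
    and comp: "\<And>f g. f \<in> arr C \<Longrightarrow> g \<in> arr C \<Longrightarrow> src C g = tgt C f \<Longrightarrow>
        g \<bullet>\<^bsub>C\<^esub> f \<in> hom_set C (src C f) (tgt C g)"
    and A: "group_fctr C A" and \<chi>: "cat_fctr (grothendieck C A) C \<chi>"
    and eq: "fctr_eq_on C (fctr_comp \<chi> (gsection C A)) T"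
  shows "cat_fctr C C T"
proof -
  have T_obj: "fobj T n = fobj \<chi> n" if "n \<in> obj C" for n
    using eq that by (simp add: fctr_eq_on_def fctr_comp_def gsection_def)
  have T_arr: "farr T f = farr \<chi> (\<one>\<^bsub>fobj A (tgt C f)\<^esub>, f)" if "f \<in> arr C" for f
    using eq that by (simp add: fctr_eq_on_def fctr_comp_def gsection_def)
  have one: "\<one>\<^bsub>fobj A n\<^esub> \<in> carrier (fobj A n)" if "n \<in> obj C" for n
    using A that by (auto simp: group_fctr_def intro!: monoid.one_closed group.is_monoid)
  have sec: "(\<one>\<^bsub>fobj A (tgt C f)\<^esub>, f) \<in> arr (grothendieck C A)" if "f \<in> arr C" for f
    using that one obj by (simp add: grothendieck_def)
  have \<chi>D: "n \<in> obj C \<Longrightarrow> fobj \<chi> n \<in> obj C"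
    "f \<in> arr (grothendieck C A) \<Longrightarrow>
      farr \<chi> f \<in> hom_set C (fobj \<chi> (src C (snd f))) (fobj \<chi> (tgt C (snd f)))"
    "n \<in> obj C \<Longrightarrow> farr \<chi> (\<one>\<^bsub>fobj A n\<^esub>, ident C n) = ident C (fobj \<chi> n)"
    "f \<in> arr (grothendieck C A) \<Longrightarrow> g \<in> arr (grothendieck C A) \<Longrightarrow> src C (snd g) = tgt C (snd f) \<Longrightarrow>
      farr \<chi> (fst g \<otimes>\<^bsub>fobj A (tgt C (snd g))\<^esub> farr A (snd g) (fst f), snd g \<bullet>\<^bsub>C\<^esub> snd f)
        = farr \<chi> g \<bullet>\<^bsub>C\<^esub> farr \<chi> f" for n f g
    using \<chi> by (auto simp: cat_fctr_def grothendieck_def)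
  show ?thesis
    unfolding cat_fctr_def
  proof (intro conjI ballI impI)
    fix n assume n: "n \<in> obj C"
    show "fobj T n \<in> obj C" using n \<chi>D(1) by (simp add: T_obj)
    show "farr T (ident C n) = ident C (fobj T n)"
      using id[OF n] n \<chi>D(3) by (simp add: T_obj T_arr hom_set_def)
  next
    fix f assume f: "f \<in> arr C"
    show "farr T f \<in> hom_set C (fobj T (src C f)) (fobj T (tgt C f))"
      using \<chi>D(2)[OF sec[OF f]] f obj by (simp add: T_obj T_arr)
    fix g assume g: "g \<in> arr C" and gf: "src C g = tgt C f"
    have h: "g \<bullet>\<^bsub>C\<^esub> f \<in> arr C" "tgt C (g \<bullet>\<^bsub>C\<^esub> f) = tgt C g"
      using comp[OF f g gf] by (simp_all add: hom_set_def)
    have K: "group (fobj A (tgt C f))" "group (fobj A (tgt C g))"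
      using A obj f g by (simp_all add: group_fctr_def)
    have "farr A g \<in> hom (fobj A (tgt C f)) (fobj A (tgt C g))"
      using A g gf by (auto simp: group_fctr_def)
    hence "farr A g \<one>\<^bsub>fobj A (tgt C f)\<^esub> = \<one>\<^bsub>fobj A (tgt C g)\<^esub>"
      using K by (rule hom_one)
    moreover have "\<one>\<^bsub>fobj A (tgt C g)\<^esub> \<otimes>\<^bsub>fobj A (tgt C g)\<^esub> \<one>\<^bsub>fobj A (tgt C g)\<^esub> = \<one>\<^bsub>fobj A (tgt C g)\<^esub>"
      using K(2) by (simp add: monoid.l_one group.is_monoid one obj g)
    ultimately show "farr T (g \<bullet>\<^bsub>C\<^esub> f) = farr T g \<bullet>\<^bsub>C\<^esub> farr T f"
      using \<chi>D(4)[OF sec[OF f] sec[OF g]] gf by (simp add: T_arr f g h)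
  qed
qed

context long_moody_setting
begin

lemma nobj_in: "nobj G z u n \<in> obj G"
proof -
  have "((\<lambda>A. u \<natural> A) ^^ n) (unit_obj G) \<in> obj G"
    by (induction n) (simp_all add: unit_in tensor_obj_in u_in)
  thus ?thesis by (simp add: nobj_def tensor_obj_in z_in)
qed

text \<open>Only the bracketing differs. This identifies the module at \<open>n + 1\<close> in the
  triviality hypothesis with the value of the shifted functor at \<open>n\<close>.\<close>

lemma nobj_Suc: "nobj G z u (Suc n) = u \<natural> nobj G z u n"
proof -
  have "((\<lambda>A. u \<natural> A) ^^ n) (unit_obj G) \<in> obj G"
    by (induction n) (simp_all add: unit_in tensor_obj_in u_in)
  thus ?thesis by (simp add: nobj_def obj_assoc u_in z_in)
qed

lemma subG_category:
  "f \<in> arr (subG G z u) \<Longrightarrow> src (subG G z u) f \<in> obj (subG G z u)"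
  "f \<in> arr (subG G z u) \<Longrightarrow> tgt (subG G z u) f \<in> obj (subG G z u)"
  "n \<in> obj (subG G z u) \<Longrightarrow> ident (subG G z u) n \<in> hom_set (subG G z u) n n"
  "f \<in> arr (subG G z u) \<Longrightarrow> g \<in> arr (subG G z u) \<Longrightarrow> src (subG G z u) g = tgt (subG G z u) f \<Longrightarrow>
    g \<bullet>\<^bsub>subG G z u\<^esub> f \<in> hom_set (subG G z u) (src (subG G z u) f) (tgt (subG G z u) g)"
  using ident_hom nobj_in cmp_hom
  by (auto simp: subG_def full_subcat_simps) (auto simp: hom_set_def)

lemma subUG_category:
  "f \<in> arr (subUG G z u) \<Longrightarrow> src (subUG G z u) f \<in> obj (subUG G z u)"
  "f \<in> arr (subUG G z u) \<Longrightarrow> tgt (subUG G z u) f \<in> obj (subUG G z u)"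
  "n \<in> obj (subUG G z u) \<Longrightarrow> ident (subUG G z u) n \<in> hom_set (subUG G z u) n n"
  "f \<in> arr (subUG G z u) \<Longrightarrow> g \<in> arr (subUG G z u) \<Longrightarrow> src (subUG G z u) g = tgt (subUG G z u) f \<Longrightarrow>
    g \<bullet>\<^bsub>subUG G z u\<^esub> f \<in> hom_set (subUG G z u) (src (subUG G z u) f) (tgt (subUG G z u) g)"
  using quillen_ident nobj_in quillen_comp
  by (auto simp: subUG_def full_subcat_simps)

lemma emb_sub: "f \<in> hom_set (subG G z u) m n \<Longrightarrow> emb G f \<in> hom_set (subUG G z u) m n"
  by (simp add: subG_def subUG_def full_subcat_simps emb_hom)

lemma group_fctr_emb:
  assumes A: "group_fctr (subUG G z u) A"
  shows "group_fctr (subG G z u) (fctr_comp A (emb_fctr G))"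
proof -
  let ?C = "subG G z u" and ?D = "subUG G z u"
  have obj: "obj ?D = obj ?C" by (simp add: subG_def subUG_def full_subcat_simps)
  have e: "emb G f \<in> arr ?D" "src ?D (emb G f) = src ?C f" "tgt ?D (emb G f) = tgt ?C f"
    if "f \<in> arr ?C" for f
    using emb_sub[of f "src ?C f" "tgt ?C f"] that by (simp_all add: hom_set_def)
  have i: "emb G (ident ?C n) = ident ?D n" if "n \<in> obj ?C" for n
    using that nobj_in by (auto simp: subG_def subUG_def full_subcat_simps emb_ident)
  have c: "emb G (g \<bullet>\<^bsub>?C\<^esub> f) = emb G g \<bullet>\<^bsub>?D\<^esub> emb G f"
    if "f \<in> arr ?C" "g \<in> arr ?C" "src ?C g = tgt ?C f" for f g
    using that by (simp add: subG_def subUG_def full_subcat_simps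
        emb_comp[of f "src G f" "tgt G f" g "tgt G g"] hom_set_def)
  show ?thesis
    unfolding group_fctr_def
  proof (intro conjI ballI impI)
    fix n assume n: "n \<in> obj ?C"
    show "group (fobj (fctr_comp A (emb_fctr G)) n)"
      using A n by (simp add: group_fctr_def fctr_comp_def emb_fctr_def obj)
    fix x assume "x \<in> carrier (fobj (fctr_comp A (emb_fctr G)) n)"
    thus "farr (fctr_comp A (emb_fctr G)) (ident ?C n) x = x"
      using A n by (simp add: group_fctr_def fctr_comp_def emb_fctr_def obj i)
  next
    fix f assume f: "f \<in> arr ?C"
    have "farr A (emb G f) \<in> hom (fobj A (src ?D (emb G f))) (fobj A (tgt ?D (emb G f)))"
      using A e(1)[OF f] by (simp only: group_fctr_def)
    thus "farr (fctr_comp A (emb_fctr G)) f \<in>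
        hom (fobj (fctr_comp A (emb_fctr G)) (src ?C f)) (fobj (fctr_comp A (emb_fctr G)) (tgt ?C f))"
      by (simp add: fctr_comp_def emb_fctr_def e f)
    fix g x assume g: "g \<in> arr ?C" "src ?C g = tgt ?C f"
      and x: "x \<in> carrier (fobj (fctr_comp A (emb_fctr G)) (src ?C f))"
    thus "farr (fctr_comp A (emb_fctr G)) (g \<bullet>\<^bsub>?C\<^esub> f) x =
        farr (fctr_comp A (emb_fctr G)) g (farr (fctr_comp A (emb_fctr G)) f x)"
      using A e[OF f] e[OF g(1)] by (simp add: fctr_comp_def emb_fctr_def c[OF f g] group_fctr_def)
  qed
qed

end

text \<open>The pair of \<open>h\<close> and the identity is an endomorphism in the Grothendieck
  construction, so its image is an endomorphism of the value of \<open>\<chi>\<close> at this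
  object. The section is the identity on objects, so that value is the one given by the
  shift.\<close>

lemma (in long_moody_setting) chi_hom:
  assumes lm: "long_moody_system G z u A \<chi>" and h: "h \<in> carrier (fobj A (nobj G z u k))"
  shows "chi G \<chi> (nobj G z u k) h \<in> hom_set (subG G z u) (u \<natural> nobj G z u k) (u \<natural> nobj G z u k)"
proof -
  let ?n = "nobj G z u k" and ?C = "subG G z u" and ?A = "fctr_comp A (emb_fctr G)"
  have n: "?n \<in> obj ?C" by (simp add: subG_def full_subcat_simps)
  have i: "ident G ?n \<in> arr ?C" "src ?C (ident G ?n) = ?n" "tgt ?C (ident G ?n) = ?n"
    using ident_hom[OF nobj_in] by (auto simp: subG_def full_subcat_simps hom_set_def)
  have "(h, ident G ?n) \<in> arr (grothendieck ?C ?A)"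
    using h i by (simp add: grothendieck_def fctr_comp_def emb_fctr_def)
  moreover have "src (grothendieck ?C ?A) (h, ident G ?n) = ?n" "tgt (grothendieck ?C ?A) (h, ident G ?n) = ?n"
    by (simp_all add: grothendieck_def i)
  moreover have "cat_fctr (grothendieck ?C ?A) ?C \<chi>" using lm by (simp add: long_moody_system_def)
  ultimately have "farr \<chi> (h, ident G ?n) \<in> hom_set ?C (fobj \<chi> ?n) (fobj \<chi> ?n)"
    by (metis cat_fctr_def)
  moreover have "fobj \<chi> ?n = u \<natural> ?n"
    using lm n by (auto simp: long_moody_system_def fctr_eq_on_def fctr_comp_def gsection_def shift_def)
  ultimately show ?thesis by (simp add: chi_def)
qed

theorem proposition2p16:
  fixes R :: "('r, 'z) ring_scheme"
    and G :: "('o, 'a) braided_cat"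
    and zo uo :: 'o
    and A :: "('o, ('o, 'a) qarr, 'g monoid, 'g \<Rightarrow> 'g) fctr"
    and \<chi> :: "('o, 'g \<times> 'a, 'o, 'a) fctr"
    and F :: "('o, 'a, ('r, 'v) module, 'v \<Rightarrow> 'v) fctr"
    and F' :: "('o, ('o, 'a) qarr, ('r, 'w) module, 'w \<Rightarrow> 'w) fctr"
  assumes "cring R" and "\<one>\<^bsub>R\<^esub> \<noteq> \<zero>\<^bsub>R\<^esub>"
  shows
    "(long_moody_system G zo uo A \<chi> \<and>
      module_fctr R (subG G zo uo) F \<and>
      (\<forall>n. trivial_group_ring_module R
             (fobj A (nobj G zo uo n)) (fobj F (nobj G zo uo (n + 1)))
             (LM_action R (shift G uo) (chi G \<chi>) F (nobj G zo uo n)))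
      \<longrightarrow>
      naturally_isomorphic R (subG G zo uo)
        (LM R (subG G zo uo) (fctr_comp A (emb_fctr G)) (shift G uo) (chi G \<chi>) F)
        (tensor_fctr R (subG G zo uo)
          (H1_fctr R (subG G zo uo) (fctr_comp A (emb_fctr G))) (fctr_comp F (shift G uo))))
     \<and>
     (coherent_long_moody_system G zo uo A \<chi> \<and>
      module_fctr R (subUG G zo uo) F' \<and>
      (\<forall>n. trivial_group_ring_module R
             (fobj A (nobj G zo uo n)) (fobj F' (nobj G zo uo (n + 1)))
             (LM_action R (shiftU G uo) (\<lambda>n h. emb G (chi G \<chi> n h)) F' (nobj G zo uo n)))
      \<longrightarrow>
      naturally_isomorphic R (subUG G zo uo)
        (LM R (subUG G zo uo) A (shiftU G uo) (\<lambda>n h. emb G (chi G \<chi> n h)) F')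
        (tensor_fctr R (subUG G zo uo)
          (H1_fctr R (subUG G zo uo) A) (fctr_comp F' (shiftU G uo))))"
proof (intro conjI impI; elim conjE)
  assume lm: "long_moody_system G zo uo A \<chi>" and F: "module_fctr R (subG G zo uo) F"
    and triv: "\<forall>n. trivial_group_ring_module R
      (fobj A (nobj G zo uo n)) (fobj F (nobj G zo uo (n + 1)))
      (LM_action R (shift G uo) (chi G \<chi>) F (nobj G zo uo n))"
  interpret long_moody_setting G zo uo using lm by (simp add: long_moody_system_def)
  let ?C = "subG G zo uo" and ?A = "fctr_comp A (emb_fctr G)"
  have A: "group_fctr ?C ?A" using lm by (intro group_fctr_emb) (simp add: long_moody_system_def)
  have T: "cat_fctr ?C ?C (shift G uo)"
    by (rule section_fctr[where \<chi> = \<chi>, OF subG_category(3,1,2,4) A]) (use lm in \<open>simp_all add: long_moody_system_def\<close>)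
  show "naturally_isomorphic R ?C (LM R ?C ?A (shift G uo) (chi G \<chi>) F)
      (tensor_fctr R ?C (H1_fctr R ?C ?A) (fctr_comp F (shift G uo)))"
  proof (rule LM_trivial_naturally_isomorphic[OF assms(1) subG_category A F T])
    fix n assume "n \<in> obj ?C"
    then obtain k where k: "n = nobj G zo uo k" by (auto simp: subG_def full_subcat_simps)
    show "chi G \<chi> n h \<in> hom_set ?C (fobj (shift G uo) n) (fobj (shift G uo) n)"
      if "h \<in> carrier (fobj ?A n)" for h
      using chi_hom[OF lm, of h k] that by (simp add: k fctr_comp_def emb_fctr_def shift_def)
    show "trivial_group_ring_module R (fobj ?A n) (fobj F (fobj (shift G uo) n))
        (LM_action R (shift G uo) (chi G \<chi>) F n)"
      using triv by (simp add: k fctr_comp_def emb_fctr_def shift_def nobj_Suc)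
  qed
next
  assume clm: "coherent_long_moody_system G zo uo A \<chi>" and F': "module_fctr R (subUG G zo uo) F'"
    and triv: "\<forall>n. trivial_group_ring_module R
      (fobj A (nobj G zo uo n)) (fobj F' (nobj G zo uo (n + 1)))
      (LM_action R (shiftU G uo) (\<lambda>n h. emb G (chi G \<chi> n h)) F' (nobj G zo uo n))"
  have lm: "long_moody_system G zo uo A \<chi>" using clm by (simp add: coherent_long_moody_system_def)
  interpret long_moody_setting G zo uo using lm by (simp add: long_moody_system_def)
  let ?C = "subUG G zo uo" and ?x = "\<lambda>n h. emb G (chi G \<chi> n h)"
  have A: "group_fctr ?C A" using lm by (simp add: long_moody_system_def)
  \<comment> \<open>The extension \<open>\<chi>'\<close> provides the functoriality of
    \<open>shiftU\<close>, while the action on \<open>F'\<close> is given by the original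
    \<open>\<chi>\<close> composed with \<open>emb\<close>.\<close>
  obtain \<chi>' where \<chi>': "cat_fctr (grothendieck ?C A) ?C \<chi>'"
    "fctr_eq_on ?C (fctr_comp \<chi>' (gsection ?C A)) (shiftU G uo)"
    using clm unfolding coherent_long_moody_system_def by blast
  have T: "cat_fctr ?C ?C (shiftU G uo)"
    by (rule section_fctr[OF subUG_category(3,1,2,4) A \<chi>'])
  show "naturally_isomorphic R ?C (LM R ?C A (shiftU G uo) ?x F')
      (tensor_fctr R ?C (H1_fctr R ?C A) (fctr_comp F' (shiftU G uo)))"
  proof (rule LM_trivial_naturally_isomorphic[OF assms(1) subUG_category A F' T])
    fix n assume "n \<in> obj ?C"
    then obtain k where k: "n = nobj G zo uo k" by (auto simp: subUG_def full_subcat_simps)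
    show "?x n h \<in> hom_set ?C (fobj (shiftU G uo) n) (fobj (shiftU G uo) n)"
      if "h \<in> carrier (fobj A n)" for h
      using emb_sub[OF chi_hom[OF lm, of h k]] that by (simp add: k shiftU_def)
    show "trivial_group_ring_module R (fobj A n) (fobj F' (fobj (shiftU G uo) n))
        (LM_action R (shiftU G uo) ?x F' n)"
      using triv by (simp add: k shiftU_def nobj_Suc)
  qed
qed

end
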